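(* Let $n\ge 1$ be an integer, let $\gamma:\mathbb{C}^n\to\mathbb{C}^n$ be a biholomorphic contraction centered at $0$, and let $H=(\mathbb{C}^n\setminus\{0\})/\langle\gamma\rangle$ be the associated Hopf manifold. Then the Futaki invariant of $H$ vanishes: $\mathrm{F}_H(V)=0$ for every holomorphic vector field $V\in H^0(H,T^{1,0}_H)$.
   Context: Biholomorphic contraction centered at $0$: a biholomorphism $\gamma:\mathbb{C}^n\to\mathbb{C}^n$ with $\gamma(0)=0$ such that for every compact $K\subset\mathbb{C}^n$ and every open neighbourhood $W$ of $0$ one has $\gamma^N(K)\subset W$ for all sufficiently large $N$. The Hopf manifold $H$ is the quotient of $\mathbb{C}^n\setminus\{0\}$ by the infinite cyclic group $\langle\gamma\rangle$ generated by $\gamma$; it is a compact complex manifold of complex dimension $n$. No linearity or diagonalizability of $\gamma$ is assumed. Futaki invariant: let $M$ be a compact complex manifold of complex dimension $n$ and let $\Omega$ be a (smooth, positive) volume form on $M$. It induces a Hermitian metric $H_\Omega$ on the canonical bundle $K_M$. The Ricci form of $\Omega$ is $\mathrm{Ric}_\Omega:=-i\,\Theta(K_M,H_\Omega)$, where $\Theta(K_M,H_\Omega)$ is the Chern curvature of $(K_M,H_\Omega)$; in local holomorphic coordinates, if $\Omega=a\; i\,dz_1\wedge d\bar z_1\wedge\cdots\wedge i\,dz_n\wedge d\bar z_n$ with $a>0$ smooth, then $\mathrm{Ric}_\Omega=-i\,\partial\bar\partial\log a$. For a holomorphic vector field $V\in H^0(M,T^{1,0}_M)$, the divergence $\mathrm{div}_\Omega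 V$ is the complex-valued function defined by $\mathrm{div}_\Omega V\cdot\Omega=\mathcal{L}_V\Omega=d(\iota_V\Omega)$; locally, if $V=\sum_{l=1}^n V_l\,\partial/\partial z_l$, then $\mathrm{div}_\Omega V=V(\log a)+\sum_{l=1}^n\partial V_l/\partial z_l$. The Futaki invariant of $M$ is the map $\mathrm{F}_M:H^0(M,T^{1,0}_M)\to\mathbb{C}$, $$\mathrm{F}_M(V):=\int_M \mathrm{div}_\Omega V\;\mathrm{Ric}_\Omega^n,$$ where $\mathrm{Ric}_\Omega^n$ is the $n$-fold wedge power. It is known that $\mathrm{F}_M$ does not depend on the choice of the volume form $\Omega$. *)

theory Defs
  imports "HOL-Analysis.Analysis" "HOL-Combinatorics.Permutations"
begin

section \<open>Calculus on \<open>\<complex>\<^sup>n\<close>\<close>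

text \<open>Holomorphic means Frechet differentiable with complex-linear derivative.\<close>

definition holomorphic_map_on ::
    "(complex^'n \<Rightarrow> complex^'m) \<Rightarrow> (complex^'n) set \<Rightarrow> bool" where
  "holomorphic_map_on F S \<longleftrightarrow>
     (\<forall>z\<in>S. \<exists>D. (F has_derivative D) (at z) \<and> (\<forall>c v. D (c *s v) = c *s D v))"

primrec Ck_on ::
    "nat \<Rightarrow> 'a::real_normed_vector set \<Rightarrow> ('a \<Rightarrow> 'b::real_normed_vector) \<Rightarrow> bool" where
  "Ck_on 0 S f \<longleftrightarrow> continuous_on S f"
| "Ck_on (Suc k) S f \<longleftrightarrow>
     (\<forall>x\<in>S. f differentiable (at x)) \<and>
     (\<forall>v. Ck_on k S (\<lambda>x. frechet_derivative f (at x) v))"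

text \<open>Only meant for open \<open>S\<close>, since \<^const>\<open>Ck_on\<close> uses unrestricted derivatives.\<close>

definition smooth_on ::
    "'a::real_normed_vector set \<Rightarrow> ('a \<Rightarrow> 'b::real_normed_vector) \<Rightarrow> bool" where
  "smooth_on S f \<longleftrightarrow> (\<forall>k. Ck_on k S f)"

text \<open>The Wirtinger operators \<open>\<partial>/\<partial>z\<^sub>j = (\<partial>/\<partial>x\<^sub>j - i \<partial>/\<partial>y\<^sub>j) / 2\<close> and
  \<open>\<partial>/\<partial>\<zeta>\<^sub>j = (\<partial>/\<partial>x\<^sub>j + i \<partial>/\<partial>y\<^sub>j) / 2\<close>, where \<open>\<zeta>\<^sub>j\<close> is the conjugate of \<open>z\<^sub>j\<close>.\<close>

definition wirtinger :: "'n \<Rightarrow> (complex^'n \<Rightarrow> complex) \<Rightarrow> complex^'n \<Rightarrow> complex" where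
  "wirtinger j f z =
     (frechet_derivative f (at z) (axis j 1) - \<i> * frechet_derivative f (at z) (axis j \<i>)) / 2"

definition wirtinger_bar :: "'n \<Rightarrow> (complex^'n \<Rightarrow> complex) \<Rightarrow> complex^'n \<Rightarrow> complex" where
  "wirtinger_bar j f z =
     (frechet_derivative f (at z) (axis j 1) + \<i> * frechet_derivative f (at z) (axis j \<i>)) / 2"

definition complex_jacobian :: "(complex^'n \<Rightarrow> complex^'n) \<Rightarrow> complex^'n \<Rightarrow> complex^'n^'n" where
  "complex_jacobian F z = (\<chi> i j. wirtinger j (\<lambda>w. F w $ i) z)"


section \<open>Complex manifolds\<close>

text \<open>A chart is its domain together with its coordinate map, whose values outside the domain are
  irrelevant. A manifold is represented by a holomorphic atlas, which determines both the
  underlying set and the topology.\<close>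

type_synonym ('m, 'n) chart = "'m set \<times> ('m \<Rightarrow> (complex, 'n) vec)"
type_synonym ('m, 'n) atlas = "('m, 'n) chart set"

definition manifold_carrier :: "('m, 'n::finite) atlas \<Rightarrow> 'm set" where
  "manifold_carrier M = (\<Union>c\<in>M. fst c)"

definition manifold_topology :: "('m, 'n::finite) atlas \<Rightarrow> 'm topology" where
  "manifold_topology M =
     topology (\<lambda>S. S \<subseteq> manifold_carrier M \<and> (\<forall>c\<in>M. open (snd c ` (S \<inter> fst c))))"

definition transition ::
    "('m, 'n::finite) chart \<Rightarrow> ('m, 'n) chart \<Rightarrow> complex^'n \<Rightarrow> complex^'n" where
  "transition c c' = snd c' \<circ> inv_into (fst c) (snd c)"

definition overlap :: "('m, 'n::finite) chart \<Rightarrow> ('m, 'n) chart \<Rightarrow> (complex^'n) set" where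
  "overlap c c' = snd c ` (fst c \<inter> fst c')"

text \<open>Second countability is automatic here: compactness gives a finite cover by charts.\<close>

definition compact_complex_manifold :: "('m, 'n::finite) atlas \<Rightarrow> bool" where
  "compact_complex_manifold M \<longleftrightarrow>
     (\<forall>c\<in>M. inj_on (snd c) (fst c) \<and> open (snd c ` fst c)) \<and>
     (\<forall>c\<in>M. \<forall>c'\<in>M. open (overlap c c') \<and> holomorphic_map_on (transition c c') (overlap c c')) \<and>
     Hausdorff_space (manifold_topology M) \<and> compact_space (manifold_topology M)"

text \<open>Tensor fields are families of coordinate expressions, one for each chart, related by the
  transition maps.\<close>

text \<open>\<open>V c\<close> stands for the vector field \<open>\<Sum>l. V c $ l \<partial>/\<partial>z\<^sub>l\<close>.\<close>

definition holomorphic_vector_field ::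
    "('m, 'n::finite) atlas \<Rightarrow> (('m, 'n) chart \<Rightarrow> complex^'n \<Rightarrow> complex^'n) \<Rightarrow> bool" where
  "holomorphic_vector_field M V \<longleftrightarrow>
     (\<forall>c\<in>M. holomorphic_map_on (V c) (snd c ` fst c)) \<and>
     (\<forall>c\<in>M. \<forall>c'\<in>M. \<forall>z\<in>overlap c c'.
        V c' (transition c c' z) = frechet_derivative (transition c c') (at z) (V c z))"

text \<open>\<open>a c\<close> stands for the volume form
  \<open>a c i dz\<^sub>1 \<and> d\<zeta>\<^sub>1 \<and> \<dots> \<and> i dz\<^sub>n \<and> d\<zeta>\<^sub>n\<close>, whose pullback under a holomorphic map \<open>F\<close>
  carries the factor \<open>\<bar>det F'\<bar>\<^sup>2\<close>.\<close>

definition volume_form ::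
    "('m, 'n::finite) atlas \<Rightarrow> (('m, 'n) chart \<Rightarrow> complex^'n \<Rightarrow> real) \<Rightarrow> bool" where
  "volume_form M a \<longleftrightarrow>
     (\<forall>c\<in>M. smooth_on (snd c ` fst c) (a c) \<and> (\<forall>z\<in>snd c ` fst c. 0 < a c z)) \<and>
     (\<forall>c\<in>M. \<forall>c'\<in>M. \<forall>z\<in>overlap c c'.
        a c z = a c' (transition c c' z) *
                (cmod (det (complex_jacobian (transition c c') z)))\<^sup>2)"


section \<open>Forms and integration\<close>

text \<open>The \<open>m\<close>-fold wedge power of an alternating 2-form, evaluated at
  \<open>v 0, \<dots>, v (2 m - 1)\<close>. The normalization is
  \<open>(\<alpha> \<and> \<beta>) (u, v) = \<alpha> u \<beta> v - \<alpha> v \<beta> u\<close> for 1-forms.\<close>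

definition wedge_power :: "nat \<Rightarrow> ('v \<Rightarrow> 'v \<Rightarrow> complex) \<Rightarrow> (nat \<Rightarrow> 'v) \<Rightarrow> complex" where
  "wedge_power m \<omega> v =
     (\<Sum>\<sigma> | \<sigma> permutes {..<2 * m}.
        of_int (sign \<sigma>) * (\<Prod>i<m. \<omega> (v (\<sigma> (2 * i))) (v (\<sigma> (2 * i + 1))))) / 2 ^ m"

text \<open>The real frame \<open>\<partial>/\<partial>x\<^sub>1, \<partial>/\<partial>y\<^sub>1, \<dots>, \<partial>/\<partial>x\<^sub>n, \<partial>/\<partial>y\<^sub>n\<close>. The enumeration of the index type is
  immaterial, because permuting the pairs does not change the orientation.\<close>

definition complex_frame :: "nat \<Rightarrow> complex^'n" where
  "complex_frame k = axis (from_nat_into UNIV (k div 2)) (if even k then 1 else \<i>)"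

definition chart_partition ::
    "('m, 'n::finite) atlas \<Rightarrow> ('m, 'n) chart set \<Rightarrow> (('m, 'n) chart \<Rightarrow> 'm set) \<Rightarrow> bool" where
  "chart_partition M C B \<longleftrightarrow>
     finite C \<and> C \<subseteq> M \<and>
     (\<forall>c\<in>C. B c \<subseteq> fst c \<and> snd c ` B c \<in> sets borel) \<and>
     disjoint_family_on B C \<and> (\<Union>c\<in>C. B c) = manifold_carrier M"

text \<open>The integral of a form of top degree over a compact complex manifold with its complex
  orientation. \<open>\<omega> c z v\<close> is the value at \<open>z\<close> of the coordinate expression in the chart \<open>c\<close> on the
  tangent vectors \<open>v 0, \<dots>, v (2 n - 1)\<close>. The manifold is cut into finitely many Borel pieces, each
  inside a chart; the sum of the Lebesgue integrals over the pieces does not depend on the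
  partition, by the change of variables formula.\<close>

definition form_integral ::
    "('m, 'n::finite) atlas \<Rightarrow>
     (('m, 'n) chart \<Rightarrow> complex^'n \<Rightarrow> (nat \<Rightarrow> complex^'n) \<Rightarrow> complex) \<Rightarrow> complex" where
  "form_integral M \<omega> =
     (THE I. \<exists>C B. chart_partition M C B \<and>
        I = (\<Sum>c\<in>C. LINT z : snd c ` B c | lborel. \<omega> c z complex_frame))"


section \<open>The Futaki invariant\<close>

text \<open>The form \<open>-i \<Sum>j k. (\<partial>\<^sup>2 log a / \<partial>z\<^sub>j \<partial>\<zeta>\<^sub>k) dz\<^sub>j \<and> d\<zeta>\<^sub>k\<close> at \<open>z\<close>, evaluated on
  the real tangent vectors \<open>u\<close> and \<open>v\<close>.\<close>

definition ricci_form ::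
    "(complex^'n \<Rightarrow> real) \<Rightarrow> complex^'n \<Rightarrow> complex^'n \<Rightarrow> complex^'n \<Rightarrow> complex" where
  "ricci_form a z u v =
     - \<i> * (\<Sum>j\<in>UNIV. \<Sum>k\<in>UNIV.
        wirtinger j (wirtinger_bar k (\<lambda>w. complex_of_real (ln (a w)))) z *
        (u $ j * cnj (v $ k) - v $ j * cnj (u $ k)))"

text \<open>\<open>V (log a) + \<Sum>l. \<partial>V\<^sub>l/\<partial>z\<^sub>l\<close>, the coordinate expression of the function \<open>f\<close> with
  \<open>f \<Omega> = d (\<iota>\<^sub>V \<Omega>)\<close>.\<close>

definition divergence ::
    "(complex^'n \<Rightarrow> real) \<Rightarrow> (complex^'n \<Rightarrow> complex^'n) \<Rightarrow> complex^'n \<Rightarrow> complex" where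
  "divergence a V z =
     (\<Sum>l\<in>UNIV. V z $ l * wirtinger l (\<lambda>w. complex_of_real (ln (a w))) z) +
     (\<Sum>l\<in>UNIV. wirtinger l (\<lambda>w. V w $ l) z)"

text \<open>The Futaki invariant of \<open>M\<close> at \<open>V\<close>, computed with the volume form \<open>a\<close>.\<close>

definition futaki_invariant ::
    "('m, 'n::finite) atlas \<Rightarrow> (('m, 'n) chart \<Rightarrow> complex^'n \<Rightarrow> real) \<Rightarrow>
     (('m, 'n) chart \<Rightarrow> complex^'n \<Rightarrow> complex^'n) \<Rightarrow> complex" where
  "futaki_invariant M a V =
     form_integral M (\<lambda>c z v.
       divergence (a c) (V c) z * wedge_power CARD('n) (ricci_form (a c) z) v)"


section \<open>Hopf manifolds\<close>

definition biholomorphic_contraction :: "(complex^'n \<Rightarrow> complex^'n) \<Rightarrow> bool" where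
  "biholomorphic_contraction \<gamma> \<longleftrightarrow>
     bij \<gamma> \<and> holomorphic_map_on \<gamma> UNIV \<and> holomorphic_map_on (inv \<gamma>) UNIV \<and> \<gamma> 0 = 0 \<and>
     (\<forall>K W. compact K \<longrightarrow> open W \<longrightarrow> 0 \<in> W \<longrightarrow>
        (\<forall>\<^sub>F N in sequentially. (\<gamma> ^^ N) ` K \<subseteq> W))"

definition int_iterate :: "('a \<Rightarrow> 'a) \<Rightarrow> int \<Rightarrow> 'a \<Rightarrow> 'a" where
  "int_iterate g k = (if 0 \<le> k then g ^^ nat k else inv g ^^ nat (- k))"

definition hopf_rel :: "(complex^'n \<Rightarrow> complex^'n) \<Rightarrow> ((complex^'n) \<times> (complex^'n)) set" where
  "hopf_rel \<gamma> = {(z, w). z \<noteq> 0 \<and> w \<noteq> 0 \<and> (\<exists>k. w = int_iterate \<gamma> k z)}"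

definition hopf_proj :: "(complex^'n \<Rightarrow> complex^'n) \<Rightarrow> complex^'n \<Rightarrow> (complex^'n) set" where
  "hopf_proj \<gamma> z = hopf_rel \<gamma> `` {z}"

text \<open>The points of the Hopf manifold are the classes of \<^const>\<open>hopf_rel\<close>. Its charts are the
  inverses of the projection on the open sets where the projection is injective.\<close>

definition hopf_manifold :: "(complex^'n \<Rightarrow> complex^'n) \<Rightarrow> ((complex^'n) set, 'n) atlas" where
  "hopf_manifold \<gamma> =
     {(hopf_proj \<gamma> ` W, inv_into W (hopf_proj \<gamma>)) | W.
        open W \<and> 0 \<notin> W \<and> inj_on (hopf_proj \<gamma>) W}"


subsection \<open>Hopf manifolds are compact complex manifolds\<close>

definition evenly_covered :: "(complex^'n \<Rightarrow> complex^'n) \<Rightarrow> (complex^'n) set \<Rightarrow> bool" where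
  "evenly_covered \<gamma> W \<longleftrightarrow> open W \<and> 0 \<notin> W \<and> inj_on (hopf_proj \<gamma>) W"

lemma int_iterate_0 [simp]: "int_iterate g 0 = id"
  by (simp add: int_iterate_def)

lemma int_iterate_1 [simp]: "int_iterate g 1 = g"
  by (simp add: int_iterate_def)

lemma int_iterate_of_nat: "int_iterate g (int m) = g ^^ m"
  by (simp add: int_iterate_def)

lemma int_iterate_succ:
  assumes "bij g"
  shows "int_iterate g (k + 1) = g \<circ> int_iterate g k"
proof (cases "0 \<le> k")
  case True
  then show ?thesis by (simp add: int_iterate_def nat_add_distrib)
next
  case False
  define m where "m = nat (- k - 1)"
  have "g \<circ> (inv g ^^ Suc m) = inv g ^^ m"
    using assms by (simp add: fun_eq_iff bij_is_surj surj_f_inv_f)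
  moreover have "nat (- k) = Suc m" "nat (- (k + 1)) = m"
    using False by (auto simp: m_def)
  ultimately show ?thesis
    using False by (cases "k = -1") (auto simp: int_iterate_def)
qed

lemma int_iterate_add:
  assumes "bij g"
  shows "int_iterate g (j + k) = int_iterate g j \<circ> int_iterate g k"
proof (induction j rule: int_induct[where k = 0])
  case base
  then show ?case by simp
next
  case (step1 i)
  have "i + 1 + k = (i + k) + 1" by simp
  then show ?case
    using step1.IH by (simp only: int_iterate_succ[OF assms] comp_assoc)
next
  case (step2 i)
  have succ: "int_iterate g j x = g (int_iterate g (j - 1) x)" for j x
    using int_iterate_succ[OF assms, of "j - 1"] by simp
  have "g (int_iterate g (i - 1 + k) x) = g (int_iterate g (i - 1) (int_iterate g k x))" for x
  proof -
    have "g (int_iterate g (i - 1 + k) x) = int_iterate g (i + k) x"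
      using succ[of "i + k" x] by (simp add: algebra_simps)
    also have "\<dots> = int_iterate g i (int_iterate g k x)" using step2.IH by simp
    also have "\<dots> = g (int_iterate g (i - 1) (int_iterate g k x))" by (rule succ)
    finally show ?thesis .
  qed
  then show ?case using assms by (auto simp: fun_eq_iff dest: bij_is_inj injD)
qed

lemma int_iterate_cancel:
  assumes "bij g"
  shows "int_iterate g (- k) (int_iterate g k z) = z" "int_iterate g k (int_iterate g (- k) z) = z"
  using int_iterate_add[OF assms, of "- k" k] int_iterate_add[OF assms, of k "- k"]
  by (auto simp: fun_eq_iff)

lemma holomorphic_map_on_continuous:
  "holomorphic_map_on F S \<Longrightarrow> continuous_on S F"
  unfolding holomorphic_map_on_def
  by (meson continuous_at_imp_continuous_on has_derivative_continuous)

lemma holomorphic_map_compose: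
  assumes "holomorphic_map_on F UNIV" "holomorphic_map_on G UNIV"
  shows "holomorphic_map_on (F \<circ> G) UNIV"
  unfolding holomorphic_map_on_def
proof
  fix z
  obtain D where D: "(G has_derivative D) (at z)" "\<And>c v. D (c *s v) = c *s D v"
    using assms(2) unfolding holomorphic_map_on_def by blast
  obtain E where E: "(F has_derivative E) (at (G z))" "\<And>c v. E (c *s v) = c *s E v"
    using assms(1) unfolding holomorphic_map_on_def by blast
  have "(F \<circ> G has_derivative E \<circ> D) (at z)"
    using D(1) E(1) by (rule diff_chain_at)
  then show "\<exists>D. (F \<circ> G has_derivative D) (at z) \<and> (\<forall>c v. D (c *s v) = c *s D v)"
    using D(2) E(2) by (intro exI[of _ "E \<circ> D"]) auto
qed

lemma holomorphic_map_funpow: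
  fixes F :: "complex^'n \<Rightarrow> complex^'n"
  assumes "holomorphic_map_on F UNIV"
  shows "holomorphic_map_on (F ^^ m) UNIV"
proof (induction m)
  case 0
  have "(id has_derivative id) (at z)" for z :: "complex^'n"
    by (simp add: id_def)
  then show ?case unfolding holomorphic_map_on_def funpow.simps(1) by (intro ballI exI[of _ "id :: complex^'n \<Rightarrow> complex^'n"]) simp
next
  case (Suc m)
  then show ?case unfolding funpow.simps(2) by (intro holomorphic_map_compose assms)
qed

context
  fixes \<gamma> :: "complex^'n \<Rightarrow> complex^'n"
  assumes \<gamma>: "biholomorphic_contraction \<gamma>"
begin

private abbreviation (input) "pw \<equiv> int_iterate \<gamma>"
private abbreviation (input) "pr \<equiv> hopf_proj \<gamma>"

lemma contraction_bij: "bij \<gamma>"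
  and contraction_eventually: "compact K \<Longrightarrow> open W \<Longrightarrow> 0 \<in> W \<Longrightarrow> \<forall>\<^sub>F N in sequentially. (\<gamma> ^^ N) ` K \<subseteq> W"
  and contraction_0: "\<gamma> 0 = 0"
  using \<gamma> by (auto simp: biholomorphic_contraction_def)

lemma holomorphic_int_iterate: "holomorphic_map_on (pw k) UNIV"
  using \<gamma> by (auto simp: int_iterate_def biholomorphic_contraction_def intro!: holomorphic_map_funpow)

lemma continuous_int_iterate: "continuous_on S (pw k)"
  using holomorphic_int_iterate holomorphic_map_on_continuous continuous_on_subset by blast

lemmas hopf_iterate_cancel = int_iterate_cancel[OF contraction_bij]
lemmas hopf_iterate_add = int_iterate_add[OF contraction_bij, THEN fun_cong, simplified]

lemma hopf_iterate_image: "pw k ` S = pw (-k) -` S"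
proof (intro equalityI subsetI)
  fix z assume "z \<in> pw (-k) -` S"
  then show "z \<in> pw k ` S" using hopf_iterate_cancel(2)[of k z] by (metis imageI vimage_eq)
qed (auto simp: hopf_iterate_cancel)

lemma hopf_iterate_open: "open S \<Longrightarrow> open (pw k ` S)"
  unfolding hopf_iterate_image using open_vimage continuous_int_iterate by blast

lemma hopf_iterate_0 [simp]: "pw k 0 = 0"
proof -
  have "inv \<gamma> 0 = 0" using contraction_bij contraction_0 by (metis bij_inv_eq_iff)
  moreover have "(f ^^ m) 0 = 0" if "f 0 = 0" for f :: "complex^'n \<Rightarrow> complex^'n" and m
    using that by (induction m) auto
  ultimately show ?thesis using contraction_0 by (auto simp: int_iterate_def)
qed

lemma hopf_iterate_eq_0 [simp]: "pw k z = 0 \<longleftrightarrow> z = 0"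
  using hopf_iterate_cancel(1)[of k z] by (metis hopf_iterate_0)

lemma hopf_equiv: "equiv (- {0}) (hopf_rel \<gamma>)"
proof (rule equivI)
  show "hopf_rel \<gamma> \<subseteq> (- {0}) \<times> (- {0})" by (auto simp: hopf_rel_def)
  show "refl_on (- {0}) (hopf_rel \<gamma>)"
    by (auto simp: refl_on_def hopf_rel_def intro!: exI[of _ 0])
  show "sym (hopf_rel \<gamma>)"
    by (rule symI) (auto simp: hopf_rel_def hopf_iterate_cancel intro: hopf_iterate_cancel(1)[symmetric])
  show "trans (hopf_rel \<gamma>)"
    by (rule transI) (auto simp: hopf_rel_def hopf_iterate_add[symmetric])
qed

lemma hopf_proj_eq_iff: "z \<noteq> 0 \<Longrightarrow> w \<noteq> 0 \<Longrightarrow> pr z = pr w \<longleftrightarrow> (\<exists>k. w = pw k z)"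
  unfolding hopf_proj_def
  using eq_equiv_class_iff[OF hopf_equiv, of z w] by (auto simp: hopf_rel_def)

lemma hopf_properly_discontinuous:
  assumes "compact K" "0 \<notin> K"
  obtains N where "\<And>k. int N \<le> \<bar>k\<bar> \<Longrightarrow> pw k ` K \<inter> K = {}"
proof -
  have "open (- K)" "0 \<in> - K" using assms by (auto simp: compact_imp_closed open_Compl)
  then obtain N where N: "\<And>m. m \<ge> N \<Longrightarrow> (\<gamma> ^^ m) ` K \<subseteq> - K"
    using contraction_eventually[OF assms(1), of "- K"] by (auto simp: eventually_sequentially)
  have pos: "pw k ` K \<inter> K = {}" if "k \<ge> int N" for k
  proof -
    have "pw k ` K \<subseteq> - K" using N[of "nat k"] that int_iterate_of_nat[of \<gamma> "nat k"] by simp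
    then show ?thesis by blast
  qed
  have "pw k ` K \<inter> K = {}" if "int N \<le> \<bar>k\<bar>" for k
  proof (cases "k \<ge> 0")
    case False
    then have "pw (-k) ` K \<inter> K = {}" using that by (intro pos) auto
    then show ?thesis unfolding disjoint_iff by (metis imageE imageI hopf_iterate_cancel(1))
  qed (use that pos in auto)
  then show ?thesis using that by blast
qed

lemma hopf_iterate_free:
  assumes "z \<noteq> 0" "pw k z = z"
  shows "k = 0"
proof (rule ccontr)
  assume "k \<noteq> 0"
  obtain N where N: "\<And>k. int N \<le> \<bar>k\<bar> \<Longrightarrow> pw k ` {z} \<inter> {z} = {}"
    using hopf_properly_discontinuous[of "{z}"] assms(1) by auto
  have "pw (int m * k) z = z" for m
    by (induction m) (auto simp: distrib_right hopf_iterate_add assms(2))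
  moreover have "int N \<le> \<bar>int N * k\<bar>"
    using \<open>k \<noteq> 0\<close> by (auto simp: abs_mult mult_le_cancel_left1)
  ultimately show False using N[of "int N * k"] by auto
qed

text \<open>Separation: translates of small neighbourhoods of \<open>x\<close> avoid a small neighbourhood of \<open>y\<close>,
  except where a power of \<open>\<gamma>\<close> maps \<open>x\<close> to \<open>y\<close>.\<close>

lemma hopf_separation:
  assumes "x \<noteq> 0" "y \<noteq> 0"
  obtains U U' where "open U" "open U'" "x \<in> U" "y \<in> U'" "0 \<notin> U" "0 \<notin> U'"
    "\<And>k. pw k x \<noteq> y \<Longrightarrow> pw k ` U \<inter> U' = {}"
proof -
  obtain r where r: "r > 0" "r < norm x" "r < norm y"
  proof -
    have "0 < min (norm x) (norm y)" using assms by simp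
    then obtain r where "0 < r" "r < min (norm x) (norm y)" using dense by blast
    then show ?thesis using that[of r] by simp
  qed
  define K where "K = cball x r \<union> cball y r"
  have "compact K" "0 \<notin> K" using r by (auto simp: K_def)
  then obtain N where N: "\<And>k. int N \<le> \<bar>k\<bar> \<Longrightarrow> pw k ` K \<inter> K = {}" using hopf_properly_discontinuous by blast
  have "\<exists>A B. open A \<and> open B \<and> x \<in> A \<and> y \<in> B \<and> (pw k x \<noteq> y \<longrightarrow> pw k ` A \<inter> B = {})" for k
  proof (cases "pw k x = y")
    case False
    then obtain A B where AB: "open A" "open B" "pw k x \<in> A" "y \<in> B" "A \<inter> B = {}"
      by (meson hausdorff)
    then show ?thesis
      using open_vimage[OF AB(1) continuous_int_iterate] by (intro exI[of _ "pw k -` A"] exI[of _ B]) auto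
  qed auto
  then obtain A B where AB: "\<And>k. open (A k)" "\<And>k. open (B k)" "\<And>k. x \<in> A k" "\<And>k. y \<in> B k"
    "\<And>k. pw k x \<noteq> y \<Longrightarrow> pw k ` A k \<inter> B k = {}" by metis
  define I where "I = {- int N..int N}"
  define U where "U = ball x r \<inter> (\<Inter>k\<in>I. A k)"
  define U' where "U' = ball y r \<inter> (\<Inter>k\<in>I. B k)"
  have fin: "finite I" by (simp add: I_def)
  show ?thesis
  proof
    show "open U" "open U'" unfolding U_def U'_def using AB fin by auto
    show "x \<in> U" "y \<in> U'" using AB r by (auto simp: U_def U'_def)
    show "0 \<notin> U" "0 \<notin> U'" using r by (auto simp: U_def U'_def)
    fix k assume k: "pw k x \<noteq> y"
    show "pw k ` U \<inter> U' = {}"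
    proof (cases "k \<in> I")
      case True
      then have "U \<subseteq> A k" "U' \<subseteq> B k" by (auto simp: U_def U'_def)
      then show ?thesis using AB(5)[OF k] by blast
    next
      case False
      then have "pw k ` K \<inter> K = {}" by (intro N) (auto simp: I_def)
      moreover have "U \<subseteq> K" "U' \<subseteq> K" by (auto simp: U_def U'_def K_def)
      ultimately show ?thesis by blast
    qed
  qed
qed

lemma hopf_chart: "c \<in> hopf_manifold \<gamma> \<longleftrightarrow> (\<exists>W. evenly_covered \<gamma> W \<and> c = (pr ` W, inv_into W pr))"
  by (auto simp: hopf_manifold_def evenly_covered_def)

lemma evenly_covered_nbhd:
  assumes "x \<noteq> 0" obtains W where "evenly_covered \<gamma> W" "x \<in> W"
proof -
  obtain U U' where U: "open U" "open U'" "x \<in> U" "x \<in> U'" "0 \<notin> U" "0 \<notin> U'"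
    "\<And>k. pw k x \<noteq> x \<Longrightarrow> pw k ` U \<inter> U' = {}"
    using hopf_separation[OF assms assms] by blast
  have "inj_on pr (U \<inter> U')"
  proof (rule inj_onI)
    fix z w assume zw: "z \<in> U \<inter> U'" "w \<in> U \<inter> U'" "pr z = pr w"
    then have "z \<noteq> 0" "w \<noteq> 0" using U by auto
    then obtain k where k: "w = pw k z" using zw(3) hopf_proj_eq_iff by blast
    have "pw k x = x" using U(7)[of k] zw k by blast
    then have "k = 0" using hopf_iterate_free assms by blast
    then show "z = w" using k by simp
  qed
  then show ?thesis using U by (intro that[of "U \<inter> U'"]) (auto simp: evenly_covered_def)
qed

lemma hopf_carrier: "manifold_carrier (hopf_manifold \<gamma>) = pr ` (- {0})"
proof -
  have "manifold_carrier (hopf_manifold \<gamma>) = (\<Union>W\<in>{W. evenly_covered \<gamma> W}. pr ` W)"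
    unfolding manifold_carrier_def by (force simp: hopf_chart)
  also have "\<dots> = pr ` (- {0})"
  proof -
    have "(\<Union>W\<in>{W. evenly_covered \<gamma> W}. W) = - {0}"
    proof -
      have "x \<in> (\<Union>W\<in>{W. evenly_covered \<gamma> W}. W)" if "x \<noteq> 0" for x
        using evenly_covered_nbhd[OF that] by auto
      then show ?thesis by (auto simp: evenly_covered_def)
    qed
    then show ?thesis by (simp only: image_UN[symmetric])
  qed
  finally show ?thesis .
qed

lemma inv_into_image_Int:
  assumes "inj_on f W"
  shows "inv_into W f ` (f ` W \<inter> S) = {w \<in> W. f w \<in> S}"
proof -
  have "f ` W \<inter> S = f ` {w \<in> W. f w \<in> S}" by auto
  then show ?thesis using assms by (metis (no_types, lifting) inv_into_image_cancel mem_Collect_eq subsetI)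
qed

lemma openin_hopf:
  "openin (manifold_topology (hopf_manifold \<gamma>)) S \<longleftrightarrow>
     S \<subseteq> pr ` (- {0}) \<and> open {z. z \<noteq> 0 \<and> pr z \<in> S}"
proof -
  let ?P = "\<lambda>S. S \<subseteq> manifold_carrier (hopf_manifold \<gamma>) \<and>
     (\<forall>c\<in>hopf_manifold \<gamma>. open (snd c ` (S \<inter> fst c)))"
  let ?Q = "\<lambda>S. S \<subseteq> pr ` (- {0}) \<and> open {z. z \<noteq> 0 \<and> pr z \<in> S}"
  have "?P S \<longleftrightarrow> ?Q S" for S
  proof -
    have "(\<forall>c\<in>hopf_manifold \<gamma>. open (snd c ` (S \<inter> fst c))) \<longleftrightarrow>
        (\<forall>W. evenly_covered \<gamma> W \<longrightarrow> open {w \<in> W. pr w \<in> S})"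
    proof -
      have "inv_into W pr ` (S \<inter> pr ` W) = {w \<in> W. pr w \<in> S}" if "evenly_covered \<gamma> W" for W
        using inv_into_image_Int[of pr W S] that by (simp add: evenly_covered_def Int_commute)
      moreover have "hopf_manifold \<gamma> = (\<lambda>W. (pr ` W, inv_into W pr)) ` {W. evenly_covered \<gamma> W}"
        by (auto simp: hopf_manifold_def evenly_covered_def)
      ultimately show ?thesis by simp
    qed
    also have "\<dots> \<longleftrightarrow> open {z. z \<noteq> 0 \<and> pr z \<in> S}" (is "?L \<longleftrightarrow> ?R")
    proof
      assume L: ?L
      have "{z. z \<noteq> 0 \<and> pr z \<in> S} = (\<Union>W\<in>{W. evenly_covered \<gamma> W}. {w \<in> W. pr w \<in> S})"
        using evenly_covered_nbhd by (auto simp: evenly_covered_def)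
      then show ?R using L by auto
    next
      assume R: ?R
      have "{w \<in> W. pr w \<in> S} = W \<inter> {z. z \<noteq> 0 \<and> pr z \<in> S}" if "evenly_covered \<gamma> W" for W
        using that by (auto simp: evenly_covered_def)
      then show ?L using R by (auto simp: evenly_covered_def)
    qed
    finally show ?thesis by (simp add: hopf_carrier)
  qed
  moreover have "istopology ?Q"
    unfolding istopology_def
  proof (intro conjI allI impI)
    fix S T assume "?Q S" "?Q T"
    moreover have "{z. z \<noteq> 0 \<and> pr z \<in> S \<inter> T} = {z. z \<noteq> 0 \<and> pr z \<in> S} \<inter> {z. z \<noteq> 0 \<and> pr z \<in> T}"
      by auto
    ultimately show "S \<inter> T \<subseteq> pr ` (- {0})" "open {z. z \<noteq> 0 \<and> pr z \<in> S \<inter> T}" by auto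
  next
    fix \<K> assume "\<forall>S\<in>\<K>. ?Q S"
    moreover have "{z. z \<noteq> 0 \<and> pr z \<in> \<Union>\<K>} = (\<Union>S\<in>\<K>. {z. z \<noteq> 0 \<and> pr z \<in> S})"
      by auto
    ultimately show "\<Union>\<K> \<subseteq> pr ` (- {0})" "open {z. z \<noteq> 0 \<and> pr z \<in> \<Union>\<K>}" by auto
  qed
  ultimately show ?thesis
    unfolding manifold_topology_def by (simp add: topology_inverse')
qed

lemma hopf_saturation:
  assumes "0 \<notin> U"
  shows "{z. z \<noteq> 0 \<and> pr z \<in> pr ` U} = (\<Union>k. pw k ` U)"
proof -
  have *: "(\<exists>u\<in>U. pr z = pr u) \<longleftrightarrow> (\<exists>k. \<exists>u\<in>U. z = pw k u)" if "z \<noteq> 0" for z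
    using hopf_proj_eq_iff[OF _ that] assms by (metis)
  show ?thesis
  proof (intro equalityI subsetI)
    fix z assume "z \<in> {z. z \<noteq> 0 \<and> pr z \<in> pr ` U}"
    then show "z \<in> (\<Union>k. pw k ` U)" using *[of z] by blast
  next
    fix z assume z: "z \<in> (\<Union>k. pw k ` U)"
    then have "z \<noteq> 0" using assms by auto
    then show "z \<in> {z. z \<noteq> 0 \<and> pr z \<in> pr ` U}" using *[of z] z by blast
  qed
qed

lemma hopf_proj_open:
  assumes "open U" "0 \<notin> U"
  shows "openin (manifold_topology (hopf_manifold \<gamma>)) (pr ` U)"
  unfolding openin_hopf hopf_saturation[OF assms(2)] using assms hopf_iterate_open by auto

lemma topspace_hopf: "topspace (manifold_topology (hopf_manifold \<gamma>)) = pr ` (- {0})"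
proof -
  have "openin (manifold_topology (hopf_manifold \<gamma>)) (pr ` (- {0}))" by (intro hopf_proj_open) auto
  moreover have "topspace (manifold_topology (hopf_manifold \<gamma>)) \<subseteq> pr ` (- {0})"
    using openin_topspace openin_hopf by blast
  ultimately show ?thesis using openin_subset by blast
qed

lemma hausdorff_hopf: "Hausdorff_space (manifold_topology (hopf_manifold \<gamma>))"
  unfolding Hausdorff_space_def topspace_hopf
proof (intro allI impI)
  fix p q assume "p \<in> pr ` (- {0}) \<and> q \<in> pr ` (- {0}) \<and> p \<noteq> q"
  then obtain x y where xy: "p = pr x" "q = pr y" "x \<noteq> 0" "y \<noteq> 0" "pr x \<noteq> pr y" by auto
  obtain U U' where U: "open U" "open U'" "x \<in> U" "y \<in> U'" "0 \<notin> U" "0 \<notin> U'"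
    "\<And>k. pw k x \<noteq> y \<Longrightarrow> pw k ` U \<inter> U' = {}"
    using hopf_separation[OF xy(3,4)] by blast
  have "disjnt (pr ` U) (pr ` U')"
  proof -
    have False if uv: "u \<in> U" "v \<in> U'" "pr u = pr v" for u v
    proof -
      have "u \<noteq> 0" "v \<noteq> 0" using uv U(5,6) by auto
      then obtain k where k: "v = pw k u" using uv(3) hopf_proj_eq_iff by blast
      have "pw k x \<noteq> y" using xy(3-5) hopf_proj_eq_iff by blast
      from U(7)[OF this] show False using uv k by blast
    qed
    then show ?thesis unfolding disjnt_iff by blast
  qed
  then show "\<exists>A B. openin (manifold_topology (hopf_manifold \<gamma>)) A \<and>
      openin (manifold_topology (hopf_manifold \<gamma>)) B \<and> p \<in> A \<and> q \<in> B \<and> disjnt A B"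
    unfolding xy(1,2) using hopf_proj_open[OF U(1,5)] hopf_proj_open[OF U(2,6)] U(3,4) by blast
qed

lemma hopf_fundamental_compact:
  obtains K where "compact K" "0 \<notin> K" "pr ` K = pr ` (- {0})"
proof -
  let ?B = "cball 0 1 :: (complex^'n) set"
  define K where "K = ?B - pw 1 ` ball 0 1"
  have "compact K" unfolding K_def by (intro compact_diff hopf_iterate_open) auto
  moreover have "0 \<notin> K" unfolding K_def using imageI[of 0 "ball 0 1" \<gamma>] contraction_0 by simp
  moreover have "pr z \<in> pr ` K" if z: "z \<noteq> 0" for z
  proof -
    obtain m0 where m0: "pw (- int m0) z \<notin> ?B"
    proof (rule ccontr)
      assume "\<not> ?thesis"
      then have *: "pw (- int m) z \<in> ?B" for m using that by blast
      have "\<forall>\<^sub>F m in sequentially. (\<gamma> ^^ m) ` ?B \<subseteq> - {z}"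
        using z by (intro contraction_eventually) auto
      then obtain m where m: "(\<gamma> ^^ m) ` ?B \<subseteq> - {z}"
        unfolding eventually_sequentially by blast
      have "(\<gamma> ^^ m) (pw (- int m) z) = z"
        using hopf_iterate_cancel(2)[of "int m" z] by (simp only: int_iterate_of_nat)
      then show False using *[of m] m by blast
    qed
    define y where "y = pw (- int m0) z"
    have "y \<noteq> 0" "y \<notin> ?B" using z m0 by (simp_all add: y_def)
    have "pr z = pr y" using hopf_proj_eq_iff[OF z \<open>y \<noteq> 0\<close>] y_def by blast
    have "\<forall>\<^sub>F m in sequentially. (\<gamma> ^^ m) ` {y} \<subseteq> ball 0 1" by (intro contraction_eventually) auto
    then obtain m1 where "(\<gamma> ^^ m1) ` {y} \<subseteq> ball 0 1"
      unfolding eventually_sequentially by blast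
    then have ex1: "(\<gamma> ^^ m1) y \<in> ?B" by auto
    define k where "k = (LEAST k. (\<gamma> ^^ k) y \<in> ?B)"
    have k: "(\<gamma> ^^ k) y \<in> ?B" unfolding k_def by (rule LeastI) (rule ex1)
    then have "k \<noteq> 0" using \<open>y \<notin> ?B\<close> by (metis funpow_0)
    then obtain j where j: "k = Suc j" by (cases k) auto
    then have notj: "(\<gamma> ^^ j) y \<notin> ?B"
      unfolding k_def by (metis lessI not_less_Least)
    have "(\<gamma> ^^ k) y \<notin> pw 1 ` ball 0 1"
    proof
      assume "(\<gamma> ^^ k) y \<in> pw 1 ` ball 0 1"
      then obtain w where w: "w \<in> ball 0 1" "\<gamma> ((\<gamma> ^^ j) y) = \<gamma> w"
        unfolding j by (auto simp del: mem_ball)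
      then have "w = (\<gamma> ^^ j) y" using contraction_bij by (metis bij_is_inj injD)
      then show False using w(1) notj by auto
    qed
    then have "(\<gamma> ^^ k) y \<in> K" using k unfolding K_def by blast
    moreover have "(\<gamma> ^^ k) y = pw (int k) y" by (simp only: int_iterate_of_nat)
    then have "pr y = pr ((\<gamma> ^^ k) y)"
      using hopf_proj_eq_iff[of y "(\<gamma> ^^ k) y"] \<open>y \<noteq> 0\<close> hopf_iterate_eq_0 by metis
    ultimately show ?thesis using \<open>pr z = pr y\<close> by (metis imageI)
  qed
  then have "pr ` (- {0}) \<subseteq> pr ` K" by blast
  moreover have "K \<subseteq> - {0}" using \<open>0 \<notin> K\<close> by blast
  ultimately show ?thesis using that[of K] \<open>0 \<notin> K\<close> by blast
qed

lemma compact_hopf: "compact_space (manifold_topology (hopf_manifold \<gamma>))"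
proof -
  obtain K where K: "compact K" "0 \<notin> K" "pr ` K = pr ` (- {0})" by (rule hopf_fundamental_compact)
  have "continuous_map (top_of_set (- {0})) (manifold_topology (hopf_manifold \<gamma>)) pr"
    unfolding continuous_map
  proof (intro conjI allI impI)
    fix S assume "openin (manifold_topology (hopf_manifold \<gamma>)) S"
    then have "open {z. z \<noteq> 0 \<and> pr z \<in> S}" by (simp add: openin_hopf)
    then show "openin (top_of_set (- {0})) {z \<in> topspace (top_of_set (- {0})). pr z \<in> S}"
      by (simp add: openin_open_eq open_Compl)
  qed (simp add: topspace_hopf)
  moreover have "compactin (top_of_set (- {0})) K"
    using K by (auto simp: compactin_subtopology)
  ultimately have "compactin (manifold_topology (hopf_manifold \<gamma>)) (pr ` K)"
    by (metis image_compactin)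
  then show ?thesis using K(3) topspace_hopf by (simp add: compact_space_def)
qed

lemma transition_hopf:
  assumes "evenly_covered \<gamma> W" "evenly_covered \<gamma> W'"
    and "c = (pr ` W, inv_into W pr)" "c' = (pr ` W', inv_into W' pr)"
  shows "open (overlap c c')" and "holomorphic_map_on (transition c c') (overlap c c')"
proof -
  have inj: "inj_on pr W" "inj_on pr W'" and o: "open W" "open W'" and nz: "0 \<notin> W" "0 \<notin> W'"
    using assms by (auto simp: evenly_covered_def)
  have ov: "overlap c c' = {w \<in> W. pr w \<in> pr ` W'}"
    unfolding overlap_def assms(3,4) using inv_into_image_Int[OF inj(1)] by simp
  also have "\<dots> = W \<inter> {z. z \<noteq> 0 \<and> pr z \<in> pr ` W'}"
    using nz(1) by blast
  also have "\<dots> = W \<inter> (\<Union>k. pw k ` W')"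
    by (simp only: hopf_saturation[OF nz(2)])
  finally have ov2: "overlap c c' = W \<inter> (\<Union>k. pw k ` W')" .
  show "open (overlap c c')" unfolding ov2 using o hopf_iterate_open by auto
  show "holomorphic_map_on (transition c c') (overlap c c')"
    unfolding holomorphic_map_on_def
  proof
    fix z assume z: "z \<in> overlap c c'"
    then obtain k w' where k: "z = pw k w'" "w' \<in> W'" by (auto simp: ov2)
    define U where "U = W \<inter> pw k ` W'"
    have U: "open U" "z \<in> U" using z k o hopf_iterate_open by (auto simp: U_def ov2)
    have eq: "transition c c' w = pw (- k) w" if w: "w \<in> U" for w
    proof -
      obtain v where v: "v \<in> W'" "w = pw k v" "w \<in> W" using w unfolding U_def by blast
      then have "v \<noteq> 0" "w \<noteq> 0" using nz by auto
      then have "pr w = pr v" using v(2) hopf_proj_eq_iff by metis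
      have "inv_into (pr ` W) (inv_into W pr) w = pr w"
        using inv_into_f_eq[OF inj_on_inv_into[OF order_refl]] v(3) inj(1) by (metis imageI inv_into_f_f)
      then have "transition c c' w = v"
        using \<open>pr w = pr v\<close> v(1) inj(2) by (simp add: transition_def assms(3,4))
      then show ?thesis using v(2) hopf_iterate_cancel(1) by simp
    qed
    obtain D where D: "(pw (- k) has_derivative D) (at z)" "\<And>c v. D (c *s v) = c *s D v"
      using holomorphic_int_iterate[of "- k"] unfolding holomorphic_map_on_def by blast
    have "(transition c c' has_derivative D) (at z)"
      by (rule has_derivative_transform_within_open[OF D(1) U]) (simp add: eq)
    then show "\<exists>D. (transition c c' has_derivative D) (at z) \<and> (\<forall>c v. D (c *s v) = c *s D v)"
      using D(2) by blast
  qed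
qed

theorem hopf_compact_complex_manifold: "compact_complex_manifold (hopf_manifold \<gamma>)"
  unfolding compact_complex_manifold_def
proof (intro conjI ballI)
  fix c assume "c \<in> hopf_manifold \<gamma>"
  then obtain W where W: "evenly_covered \<gamma> W" "c = (pr ` W, inv_into W pr)" by (auto simp: hopf_chart)
  then show "inj_on (snd c) (fst c)" by (simp add: inj_on_inv_into)
  show "open (snd c ` fst c)" using W by (simp add: evenly_covered_def inv_into_image_cancel)
next
  fix c c' assume "c \<in> hopf_manifold \<gamma>" "c' \<in> hopf_manifold \<gamma>"
  then obtain W W' where "evenly_covered \<gamma> W" "evenly_covered \<gamma> W'" "c = (pr ` W, inv_into W pr)" "c' = (pr ` W', inv_into W' pr)"
    unfolding hopf_chart by blast
  then show "open (overlap c c')" "holomorphic_map_on (transition c c') (overlap c c')"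
    by (rule transition_hopf)+
qed (rule hausdorff_hopf compact_hopf)+

end

end

theory Submission
  imports Defs "HOL-Complex_Analysis.Cauchy_Integral_Formula"
begin

text \<open>Lift \<open>\<Omega>\<close> to \<open>\<complex>\<^sup>n\<close> minus the origin, as a function \<open>a\<close> with \<open>a = (a \<circ> \<gamma>) \<bar>J\<bar>\<^sup>2\<close>, where \<open>J = det \<gamma>'\<close>. As \<open>J \<circ> \<gamma>\<^sup>k\<close>
  tends to \<open>J 0\<close> geometrically, \<open>p = \<Sum>k. \<partial> log (J \<circ> \<gamma>\<^sup>k)\<close> is a holomorphic (1,0)-form on the whole of
  \<open>\<complex>\<^sup>n\<close> with \<open>p - \<gamma>\<^sup>* p = \<partial> log J\<close>. Hence \<open>q = \<partial> log a - p\<close> is an invariant (1,0)-form, so the Ricci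
  form is, up to a constant factor, the exact form \<open>dbar q\<close>, and
  \<open>div V = q V + f\<close> with \<open>f\<close> holomorphic and invariant. Integration by parts gives
  \<open>\<integral> f (dbar q)\<^sup>n = 0\<close>, because \<open>dbar f = 0\<close>, and \<open>\<integral> q V (dbar q)\<^sup>n = - n \<integral> q V (dbar q)\<^sup>n\<close>, because
  \<open>dbar (q V)\<close> is the contraction of \<open>dbar q\<close> with \<open>V\<close>. So both contributions vanish.

  Stokes' theorem is only needed on \<open>\<complex>\<^sup>n\<close>: for a cutoff function \<open>\<psi>\<close> that is 1 near 0, the translates of
  \<open>\<psi> \<circ> \<gamma> - \<psi>\<close> under the powers of \<open>\<gamma>\<close> telescope to 1, so that the integral of an invariant form over
  a fundamental domain is its integral against \<open>\<psi> \<circ> \<gamma> - \<psi>\<close> over \<open>\<complex>\<^sup>n\<close>.\<close>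

section \<open>Maps of class \<open>C\<^sup>k\<close> and the Wirtinger operators\<close>

text \<open>The series for \<open>p\<close> is summed only after differentiation: the terms
  \<open>log (J \<circ> \<gamma> ^^ k)\<close> tend to \<open>log (J 0)\<close>, which is not 0, and
  \<open>\<partial>\<close> removes this constant together with the choice of a branch. What enters
  about \<open>\<gamma>\<close> is its geometric rate of contraction, which is the same argument for
  linear, diagonalizable and resonant maps. Forms are replaced by their coefficients. Up to constant
  factors, \<open>(dbar q)^n\<close> is \<open>det M\<close>, with \<open>M\<close> the matrix of
  the antiholomorphic derivatives of \<open>q\<close>, and the product of \<open>q\<close>,
  \<open>dbar w\<close> and \<open>n - 1\<close> factors \<open>dbar q\<close> is
  \<open>rank_one_det M q (dbar w)\<close>. Stokes' theorem becomes the divergence theorem for a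
  vector field built from cofactors, closedness of \<open>dbar q\<close> becomes the vanishing
  divergence of rows of cofactors, and invariance becomes a factor \<open>|J|^2\<close>, which the
  change of variables formula absorbs. For an invariant \<open>w\<close> with
  \<open>rank_one_det M q (dbar w) = c w det M\<close> the outcome is
  \<open>(c + n) \<integral> w (dbar q)^n = 0\<close>; here \<open>c = 1\<close> for
  \<open>w = q V\<close> and \<open>c = 0\<close> for \<open>w = f\<close>.\<close>

lemma frechet_derivative_cong_open:
  assumes "open S" "x \<in> S" "\<And>y. y \<in> S \<Longrightarrow> f y = g y"
  shows "frechet_derivative f (at x) = frechet_derivative g (at x)"
    and "f differentiable (at x) \<longleftrightarrow> g differentiable (at x)"
proof -
  have D: "(f has_derivative F) (at x) \<longleftrightarrow> (g has_derivative F) (at x)" for F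
    using has_derivative_transform_within_open[OF _ assms(1,2), of _ _ UNIV] assms(3) by metis
  then show "frechet_derivative f (at x) = frechet_derivative g (at x)"
    "f differentiable (at x) \<longleftrightarrow> g differentiable (at x)"
    by (simp_all add: frechet_derivative_def differentiable_def)
qed

lemma Ck_on_cong:
  assumes "open S" "\<And>x. x \<in> S \<Longrightarrow> f x = g x"
  shows "Ck_on k S f \<longleftrightarrow> Ck_on k S g"
  using assms(2)
proof (induction k arbitrary: f g)
  case 0
  then show ?case by (simp cong: continuous_on_cong)
next
  case (Suc k)
  show ?case
    using frechet_derivative_cong_open[OF assms(1) _ Suc.prems]
      Suc.IH[of "\<lambda>x. frechet_derivative f (at x) v" "\<lambda>x. frechet_derivative g (at x) v" for v]
    by simp
qed

lemma wirtinger_cong_open: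
  assumes "open S" "z \<in> S" "\<And>y. y \<in> S \<Longrightarrow> f y = g y"
  shows "wirtinger j f z = wirtinger j g z" "wirtinger_bar j f z = wirtinger_bar j g z"
  using frechet_derivative_cong_open(1)[OF assms] by (simp_all add: wirtinger_def wirtinger_bar_def)

lemma Ck_on_Suc_imp: "Ck_on (Suc k) S f \<Longrightarrow> Ck_on k S f"
proof (induction k arbitrary: f)
  case 0
  then show ?case by (auto intro!: differentiable_imp_continuous_on simp: differentiable_on_def differentiable_at_withinI)
qed auto

text \<open>\<open>Ck_on\<close> is phrased with the chosen \<open>frechet_derivative\<close>;
  uniqueness of the derivative on an open set lets any explicit formula take its place. The
  inductive closure properties below rest on this rule.\<close>

lemma Ck_on_SucI:
  assumes "open S" "\<And>x. x \<in> S \<Longrightarrow> (f has_derivative F x) (at x)" "\<And>v. Ck_on k S (\<lambda>x. F x v)"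
  shows "Ck_on (Suc k) S f"
  unfolding Ck_on.simps(2)
proof (intro conjI ballI allI)
  show "f differentiable (at x)" if "x \<in> S" for x using assms(2)[OF that] by (auto simp: differentiable_def)
  have "frechet_derivative f (at x) v = F x v" if "x \<in> S" for x v
    using frechet_derivative_at[OF assms(2)[OF that]] by simp
  then show "Ck_on k S (\<lambda>x. frechet_derivative f (at x) v)" for v
    using assms(3) by (subst Ck_on_cong[OF assms(1)]) auto
qed

lemma Ck_on_derivative:
  "Ck_on (Suc k) S f \<Longrightarrow> x \<in> S \<Longrightarrow> (f has_derivative frechet_derivative f (at x)) (at x)"
  by (simp add: frechet_derivative_works)

lemma Ck_on_const: "open S \<Longrightarrow> Ck_on k S (\<lambda>x. c)"
proof (induction k arbitrary: c)
  case (Suc k)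
  then show ?case by (intro Ck_on_SucI[where F = "\<lambda>_ _. 0"]) auto
qed simp

lemma Ck_on_add: "open S \<Longrightarrow> Ck_on k S f \<Longrightarrow> Ck_on k S g \<Longrightarrow> Ck_on k S (\<lambda>x. f x + g x)"
proof (induction k arbitrary: f g)
  case (Suc k)
  show ?case
    using Suc by (intro Ck_on_SucI[where F = "\<lambda>x v. frechet_derivative f (at x) v + frechet_derivative g (at x) v"]
       has_derivative_add Ck_on_derivative[OF Suc.prems(2)] Ck_on_derivative[OF Suc.prems(3)]) auto
qed (auto intro: continuous_on_add)

lemma Ck_on_bounded_linear:
  assumes "bounded_linear L" "open S"
  shows "Ck_on k S f \<Longrightarrow> Ck_on k S (\<lambda>x. L (f x))"
proof (induction k arbitrary: f)
  case 0
  then show ?case using bounded_linear.continuous_on[OF assms(1)] by auto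
next
  case (Suc k)
  then show ?case
    by (intro Ck_on_SucI[where F = "\<lambda>x v. L (frechet_derivative f (at x) v)"]
       bounded_linear.has_derivative[OF assms(1)] Ck_on_derivative[OF Suc.prems] assms) auto
qed

lemma Ck_on_mult:
  fixes f g :: "'a::real_normed_vector \<Rightarrow> 'b::real_normed_algebra"
  shows "open S \<Longrightarrow> Ck_on k S f \<Longrightarrow> Ck_on k S g \<Longrightarrow> Ck_on k S (\<lambda>x. f x * g x)"
proof (induction k arbitrary: f g)
  case (Suc k)
  then have "Ck_on k S f" "Ck_on k S g" by (blast intro: Ck_on_Suc_imp)+
  then show ?case
    using Suc by (intro Ck_on_SucI[where F = "\<lambda>x v. f x * frechet_derivative g (at x) v + frechet_derivative f (at x) v * g x"]
       has_derivative_mult Ck_on_derivative[OF Suc.prems(2)] Ck_on_derivative[OF Suc.prems(3)] Ck_on_add) auto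
qed (auto intro: continuous_on_mult)

lemma Ck_on_inverse:
  fixes f :: "'a::real_normed_vector \<Rightarrow> 'b::real_normed_field"
  assumes "open S" "\<And>x. x \<in> S \<Longrightarrow> f x \<noteq> 0"
  shows "Ck_on k S f \<Longrightarrow> Ck_on k S (\<lambda>x. inverse (f x))"
proof (induction k)
  case 0
  then show ?case using assms by (auto intro: continuous_on_inverse)
next
  case (Suc k)
  then have "Ck_on k S f" by (blast intro: Ck_on_Suc_imp)
  then have i: "Ck_on k S (\<lambda>x. inverse (f x))" using Suc.IH by blast
  show ?case
  proof (rule Ck_on_SucI[where F = "\<lambda>x v. - (inverse (f x) * frechet_derivative f (at x) v * inverse (f x))", OF assms(1)])
    show "((\<lambda>x. inverse (f x)) has_derivative
         (\<lambda>v. - (inverse (f x) * frechet_derivative f (at x) v * inverse (f x)))) (at x)" if "x \<in> S" for x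
      using assms(2)[OF that] Ck_on_derivative[OF Suc.prems that] by (rule Deriv.has_derivative_inverse)
    show "Ck_on k S (\<lambda>x. - (inverse (f x) * frechet_derivative f (at x) v * inverse (f x)))" for v
      using Suc.prems by (intro Ck_on_bounded_linear[OF bounded_linear_minus[OF bounded_linear_ident]] Ck_on_mult assms i) auto
  qed
qed

lemma Ck_on_sum:
  "open S \<Longrightarrow> (\<And>i. i \<in> A \<Longrightarrow> Ck_on k S (f i)) \<Longrightarrow> Ck_on k S (\<lambda>x. \<Sum>i\<in>A. f i x)"
  by (induction A rule: infinite_finite_induct) (auto intro: Ck_on_const Ck_on_add)

lemma Ck_on_prod:
  fixes f :: "'i \<Rightarrow> 'a::real_normed_vector \<Rightarrow> 'b::real_normed_field"
  shows "open S \<Longrightarrow> (\<And>i. i \<in> A \<Longrightarrow> Ck_on k S (f i)) \<Longrightarrow> Ck_on k S (\<lambda>x. \<Prod>i\<in>A. f i x)"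
  by (induction A rule: infinite_finite_induct) (auto intro: Ck_on_const Ck_on_mult)

lemma Ck_on_diff:
  "open S \<Longrightarrow> Ck_on k S f \<Longrightarrow> Ck_on k S g \<Longrightarrow> Ck_on k S (\<lambda>x. f x - g x)"
  using Ck_on_add[of S k f "\<lambda>x. - g x"] Ck_on_bounded_linear[OF bounded_linear_minus[OF bounded_linear_ident], of S k g]
  by simp

lemma Ck_on_det:
  fixes A :: "'a::real_normed_vector \<Rightarrow> 'b::real_normed_field^'n^'n"
  assumes "open S" "\<And>i j. Ck_on k S (\<lambda>x. A x $ i $ j)"
  shows "Ck_on k S (\<lambda>x. det (A x))"
  unfolding det_def by (intro Ck_on_sum Ck_on_mult Ck_on_prod Ck_on_const assms)

text \<open>The derivative of \<open>ln a\<close> is the derivative of \<open>a\<close> divided by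
  \<open>a\<close>, of class \<open>C\<^sup>k\<close> as soon as \<open>a\<close> is one order
  better. Smoothness of \<open>a\<close> to all orders thus takes the place of an induction.\<close>

lemma smooth_on_ln:
  assumes "open S" "smooth_on S a" "\<And>x. x \<in> S \<Longrightarrow> 0 < a x"
  shows "Ck_on k S (\<lambda>x. complex_of_real (ln (a x)))"
proof -
  have a: "Ck_on k S a" for k using assms(2) by (simp add: smooth_on_def)
  have "Ck_on (Suc k) S (\<lambda>x. ln (a x))" for k
  proof (rule Ck_on_SucI[OF assms(1)])
    show "((\<lambda>x. ln (a x)) has_derivative (\<lambda>v. frechet_derivative a (at x) v * inverse (a x))) (at x)" if "x \<in> S" for x
      using has_derivative_ln[OF assms(3)[OF that] Ck_on_derivative[OF a that]] .
    show "Ck_on k S (\<lambda>x. frechet_derivative a (at x) v * inverse (a x))" for v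
      using a[of "Suc k"] assms(3) by (intro Ck_on_mult Ck_on_inverse a assms(1)) force+
  qed
  then show ?thesis using Ck_on_bounded_linear[OF bounded_linear_of_real assms(1)] Ck_on_Suc_imp by blast
qed

lemma Ck_on_wirtinger:
  assumes "open S" "Ck_on (Suc k) S f"
  shows "Ck_on k S (wirtinger j f)" "Ck_on k S (wirtinger_bar j f)"
proof -
  have *: "Ck_on k S (\<lambda>x. frechet_derivative f (at x) v)" for v using assms by simp
  show "Ck_on k S (wirtinger j f)"
    unfolding wirtinger_def[abs_def] divide_inverse
    by (intro Ck_on_mult Ck_on_diff Ck_on_const assms *)
  show "Ck_on k S (wirtinger_bar j f)"
    unfolding wirtinger_bar_def[abs_def] divide_inverse
    by (intro Ck_on_mult Ck_on_add Ck_on_const assms *)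
qed

section \<open>Calculus rules for the Wirtinger operators\<close>

lemma wirtinger_has_derivative:
  assumes "(f has_derivative D) (at z)"
  shows "wirtinger j f z = (D (axis j 1) - \<i> * D (axis j \<i>)) / 2"
    and "wirtinger_bar j f z = (D (axis j 1) + \<i> * D (axis j \<i>)) / 2"
  using frechet_derivative_at[OF assms] by (simp_all add: wirtinger_def wirtinger_bar_def)

text \<open>The two kinds of summands form the complex-linear and the antilinear part of
  \<open>D\<close>; for a derivative their coefficients are the two Wirtinger operators.\<close>

lemma real_linear_wirtinger:
  fixes D :: "complex^'n \<Rightarrow> complex"
  assumes "linear D"
  shows "D v = (\<Sum>l\<in>UNIV. (D (axis l 1) - \<i> * D (axis l \<i>)) / 2 * v $ l
      + (D (axis l 1) + \<i> * D (axis l \<i>)) / 2 * cnj (v $ l))"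
proof -
  have v: "v = (\<Sum>l\<in>UNIV. Re (v $ l) *\<^sub>R axis l 1 + Im (v $ l) *\<^sub>R axis l \<i>)"
    by (simp add: vec_eq_iff axis_def if_distrib[of "\<lambda>x. _ *\<^sub>R x"] sum.distrib cong: if_cong)
       (simp add: complex_eq_iff)
  have "D v = (\<Sum>l\<in>UNIV. Re (v $ l) *\<^sub>R D (axis l 1) + Im (v $ l) *\<^sub>R D (axis l \<i>))"
    by (subst v) (simp add: linear_sum[OF assms] linear_add[OF assms] linear_scale[OF assms])
  also have "\<dots> = (\<Sum>l\<in>UNIV. (D (axis l 1) - \<i> * D (axis l \<i>)) / 2 * v $ l
      + (D (axis l 1) + \<i> * D (axis l \<i>)) / 2 * cnj (v $ l))"
  proof (rule sum.cong[OF refl])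
    fix l
    obtain x y where "v $ l = complex_of_real x + \<i> * complex_of_real y"
      by (metis complex_eq)
    then show "Re (v $ l) *\<^sub>R D (axis l 1) + Im (v $ l) *\<^sub>R D (axis l \<i>) =
      (D (axis l 1) - \<i> * D (axis l \<i>)) / 2 * v $ l + (D (axis l 1) + \<i> * D (axis l \<i>)) / 2 * cnj (v $ l)"
      by (simp add: scaleR_conv_of_real algebra_simps add_divide_distrib diff_divide_distrib)
  qed
  finally show ?thesis .
qed

lemma frechet_derivative_wirtinger:
  assumes "f differentiable (at z)"
  shows "frechet_derivative f (at z) v =
    (\<Sum>l\<in>UNIV. wirtinger l f z * v $ l + wirtinger_bar l f z * cnj (v $ l))"
  unfolding wirtinger_def wirtinger_bar_def
  using real_linear_wirtinger[of "frechet_derivative f (at z)" v] assms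
  by (simp add: frechet_derivative_works has_derivative_linear)

lemma wirtinger_add:
  assumes "f differentiable (at z)" "g differentiable (at z)"
  shows "wirtinger j (\<lambda>w. f w + g w) z = wirtinger j f z + wirtinger j g z"
    and "wirtinger_bar j (\<lambda>w. f w + g w) z = wirtinger_bar j f z + wirtinger_bar j g z"
  unfolding wirtinger_has_derivative[OF has_derivative_add[OF assms[unfolded frechet_derivative_works]]]
  by (simp_all add: algebra_simps add_divide_distrib diff_divide_distrib wirtinger_def wirtinger_bar_def)

lemma wirtinger_diff:
  assumes "f differentiable (at z)" "g differentiable (at z)"
  shows "wirtinger j (\<lambda>w. f w - g w) z = wirtinger j f z - wirtinger j g z"
    and "wirtinger_bar j (\<lambda>w. f w - g w) z = wirtinger_bar j f z - wirtinger_bar j g z"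
  unfolding wirtinger_has_derivative[OF has_derivative_diff[OF assms[unfolded frechet_derivative_works]]]
  by (simp_all add: algebra_simps add_divide_distrib diff_divide_distrib wirtinger_def wirtinger_bar_def)

lemma wirtinger_mult:
  assumes "f differentiable (at z)" "g differentiable (at z)"
  shows "wirtinger j (\<lambda>w. f w * g w) z = f z * wirtinger j g z + wirtinger j f z * g z"
    and "wirtinger_bar j (\<lambda>w. f w * g w) z = f z * wirtinger_bar j g z + wirtinger_bar j f z * g z"
  unfolding wirtinger_has_derivative[OF has_derivative_mult[OF assms[unfolded frechet_derivative_works]]]
  by (simp_all add: algebra_simps add_divide_distrib diff_divide_distrib wirtinger_def wirtinger_bar_def)

lemma wirtinger_const [simp]: "wirtinger j (\<lambda>w. c) z = 0" "wirtinger_bar j (\<lambda>w. c) z = 0"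
  by (simp_all add: wirtinger_has_derivative[OF has_derivative_const])

lemma wirtinger_sum:
  assumes "\<And>i. i \<in> A \<Longrightarrow> f i differentiable (at z)"
  shows "wirtinger j (\<lambda>w. \<Sum>i\<in>A. f i w) z = (\<Sum>i\<in>A. wirtinger j (f i) z)"
    and "wirtinger_bar j (\<lambda>w. \<Sum>i\<in>A. f i w) z = (\<Sum>i\<in>A. wirtinger_bar j (f i) z)"
  using assms
  by (induction A rule: infinite_finite_induct)
     (simp_all add: wirtinger_add differentiable_sum)

section \<open>Symmetry of second derivatives\<close>

lemma second_difference_mvt:
  fixes f :: "'a::real_normed_vector \<Rightarrow> real"
  assumes f: "Ck_on 2 S f" and t: "0 < t"
    and S: "\<And>s r. 0 \<le> s \<Longrightarrow> s \<le> t \<Longrightarrow> 0 \<le> r \<Longrightarrow> r \<le> t \<Longrightarrow> x + s *\<^sub>R v + r *\<^sub>R w \<in> S"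
  shows "\<exists>s r. 0 \<le> s \<and> s \<le> t \<and> 0 \<le> r \<and> r \<le> t \<and>
    f (x + t *\<^sub>R v + t *\<^sub>R w) - f (x + t *\<^sub>R v) - (f (x + t *\<^sub>R w) - f x) =
    t * t * frechet_derivative (\<lambda>y. frechet_derivative f (at y) v) (at (x + s *\<^sub>R v + r *\<^sub>R w)) w"
proof -
  let ?D = "\<lambda>y. frechet_derivative f (at y)"
  have D1: "(f has_derivative ?D y) (at y)" if "y \<in> S" for y
    using f that by (simp add: numeral_2_eq_2 frechet_derivative_works)
  have D2: "((\<lambda>y. ?D y v) has_derivative frechet_derivative (\<lambda>y. ?D y v) (at y)) (at y)" if "y \<in> S" for y
    using f that by (simp add: numeral_2_eq_2 frechet_derivative_works)
  have line: "((\<lambda>s. g (y + s *\<^sub>R u)) has_real_derivative G u) (at s)"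
    if "(g has_derivative G) (at (y + s *\<^sub>R u))" for g :: "'a \<Rightarrow> real" and y u s G
  proof -
    have "((\<lambda>s. y + s *\<^sub>R u) has_derivative (\<lambda>s. s *\<^sub>R u)) (at s)" by (auto intro!: derivative_eq_intros)
    from has_derivative_compose[OF this that]
    have "((\<lambda>s. g (y + s *\<^sub>R u)) has_derivative (\<lambda>s. G (s *\<^sub>R u))) (at s)" .
    moreover have "G (s *\<^sub>R u) = G u * s" for s
      using that by (simp add: has_derivative_linear linear_scale)
    ultimately show ?thesis by (simp add: has_field_derivative_def)
  qed
  \<comment> \<open>The increment in direction \<open>t w\<close> as a function of the position
    along \<open>v\<close>; its own increment over \<open>[0, t]\<close> is the second difference
    over the parallelogram. The mean value theorem is applied to it and then, along
    \<open>w\<close>, to the derivative that appears.\<close>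
  define \<phi> where "\<phi> s = f ((x + t *\<^sub>R w) + s *\<^sub>R v) - f (x + s *\<^sub>R v)" for s
  have "\<exists>s. 0 < s \<and> s < t \<and> \<phi> t - \<phi> 0 = (t - 0) * (?D ((x + t *\<^sub>R w) + s *\<^sub>R v) v - ?D (x + s *\<^sub>R v) v)"
  proof (rule MVT2[OF t])
    show "(\<phi> has_real_derivative (?D ((x + t *\<^sub>R w) + s *\<^sub>R v) v - ?D (x + s *\<^sub>R v) v)) (at s)"
      if "0 \<le> s" "s \<le> t" for s
      unfolding \<phi>_def using S[OF that, of t] S[OF that, of 0] t
      by (intro DERIV_diff line D1) (auto simp: algebra_simps)
  qed
  then obtain s where s: "0 < s" "s < t"
    "\<phi> t - \<phi> 0 = t * (?D ((x + t *\<^sub>R w) + s *\<^sub>R v) v - ?D (x + s *\<^sub>R v) v)" by auto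
  define \<psi> where "\<psi> r = ?D ((x + s *\<^sub>R v) + r *\<^sub>R w) v" for r
  have "\<exists>r. 0 < r \<and> r < t \<and> \<psi> t - \<psi> 0 = (t - 0) * frechet_derivative (\<lambda>y. ?D y v) (at ((x + s *\<^sub>R v) + r *\<^sub>R w)) w"
  proof (rule MVT2[OF t])
    show "(\<psi> has_real_derivative frechet_derivative (\<lambda>y. ?D y v) (at ((x + s *\<^sub>R v) + r *\<^sub>R w)) w) (at r)"
      if "0 \<le> r" "r \<le> t" for r
      unfolding \<psi>_def using S[of s, OF _ _ that] s by (intro line D2) auto
  qed
  then obtain r where r: "0 < r" "r < t"
    "\<psi> t - \<psi> 0 = t * frechet_derivative (\<lambda>y. ?D y v) (at ((x + s *\<^sub>R v) + r *\<^sub>R w)) w" by auto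
  have "f (x + t *\<^sub>R v + t *\<^sub>R w) - f (x + t *\<^sub>R v) - (f (x + t *\<^sub>R w) - f x) = \<phi> t - \<phi> 0"
    by (simp add: \<phi>_def algebra_simps)
  also have "\<dots> = t * (\<psi> t - \<psi> 0)" by (simp add: s(3) \<psi>_def algebra_simps)
  also have "\<dots> = t * t * frechet_derivative (\<lambda>y. ?D y v) (at ((x + s *\<^sub>R v) + r *\<^sub>R w)) w"
    by (simp add: r(3))
  finally show ?thesis using s r less_imp_le by blast
qed

text \<open>The second difference is symmetric in \<open>v\<close> and \<open>w\<close>. Hence one
  mixed derivative at some point of a small parallelogram equals the other one at another point of
  it, and continuity brings both points to \<open>x\<close>.\<close>

lemma second_derivative_commute_real:
  fixes f :: "'a::real_normed_vector \<Rightarrow> real"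
  assumes "open S" and f: "Ck_on 2 S f" and x: "x \<in> S"
  shows "frechet_derivative (\<lambda>y. frechet_derivative f (at y) v) (at x) w =
    frechet_derivative (\<lambda>y. frechet_derivative f (at y) w) (at x) v" (is "?A x = ?B x")
proof -
  have "\<bar>?A x - ?B x\<bar> \<le> e" if e: "e > 0" for e
  proof -
    have "continuous_on S ?A" "continuous_on S ?B" using f by (simp_all add: numeral_2_eq_2)
    then have "isCont ?A x" "isCont ?B x" using assms(1) x by (simp_all add: continuous_on_eq_continuous_at)
    then obtain d1 d2 where d: "d1 > 0" "\<And>y. dist y x < d1 \<Longrightarrow> dist (?A y) (?A x) < e/2"
      "d2 > 0" "\<And>y. dist y x < d2 \<Longrightarrow> dist (?B y) (?B x) < e/2"
      unfolding continuous_at_eps_delta using half_gt_zero[OF e] by (metis dist_commute)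
    obtain d3 where d3: "d3 > 0" "ball x d3 \<subseteq> S" using assms(1) x open_contains_ball by blast
    define d where "d = min d1 (min d2 d3)"
    \<comment> \<open>Keeps the parallelogram within \<open>d / 2\<close> of \<open>x\<close>; the
      summand 1 covers \<open>v = w = 0\<close>.\<close>
    define t where "t = d / (2 * (norm v + norm w + 1))"
    have pos: "norm v + norm w + 1 > 0" by (simp add: add_nonneg_pos)
    have dpos: "d > 0" using d d3 by (simp add: d_def)
    then have tpos: "t > 0" using pos by (simp add: t_def)
    have near: "dist (x + s *\<^sub>R v + r *\<^sub>R w) x < d" if "0 \<le> s" "s \<le> t" "0 \<le> r" "r \<le> t" for s r
    proof -
      have "dist (x + s *\<^sub>R v + r *\<^sub>R w) x \<le> norm (s *\<^sub>R v) + norm (r *\<^sub>R w)"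
        using norm_triangle_ineq[of "s *\<^sub>R v" "r *\<^sub>R w"] by (simp add: dist_norm add.assoc)
      also have "\<dots> \<le> t * norm v + t * norm w"
        using that by (simp add: add_mono mult_right_mono)
      also have "\<dots> \<le> t * (norm v + norm w + 1)" using tpos by (simp add: algebra_simps)
      also have "\<dots> = d / 2" using pos by (simp add: t_def field_simps)
      finally show ?thesis using dpos by simp
    qed
    have inS: "x + s *\<^sub>R v + r *\<^sub>R w \<in> S" if "0 \<le> s" "s \<le> t" "0 \<le> r" "r \<le> t" for s r
      using near[OF that] d3 by (auto simp: d_def dist_commute)
    have inS': "x + s *\<^sub>R w + r *\<^sub>R v \<in> S" if "0 \<le> s" "s \<le> t" "0 \<le> r" "r \<le> t" for s r
      using inS[OF that(3,4,1,2)] by (simp add: add_ac)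
    obtain s r where sr: "0 \<le> s" "s \<le> t" "0 \<le> r" "r \<le> t"
      "f (x + t *\<^sub>R v + t *\<^sub>R w) - f (x + t *\<^sub>R v) - (f (x + t *\<^sub>R w) - f x) = t * t * ?A (x + s *\<^sub>R v + r *\<^sub>R w)"
      using second_difference_mvt[OF f tpos, of x v w] inS by blast
    obtain s' r' where sr': "0 \<le> s'" "s' \<le> t" "0 \<le> r'" "r' \<le> t"
      "f (x + t *\<^sub>R w + t *\<^sub>R v) - f (x + t *\<^sub>R w) - (f (x + t *\<^sub>R v) - f x) = t * t * ?B (x + s' *\<^sub>R w + r' *\<^sub>R v)"
      using second_difference_mvt[OF f tpos, of x w v] inS' by blast
    have "x + t *\<^sub>R w + t *\<^sub>R v = x + t *\<^sub>R v + t *\<^sub>R w" "x + s' *\<^sub>R w + r' *\<^sub>R v = x + r' *\<^sub>R v + s' *\<^sub>R w"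
      by (simp_all add: algebra_simps)
    note sr'' = sr'(5)[unfolded this]
    have "t * t * ?A (x + s *\<^sub>R v + r *\<^sub>R w) = t * t * ?B (x + r' *\<^sub>R v + s' *\<^sub>R w)"
      unfolding sr(5)[symmetric] sr''[symmetric] by simp
    then have eq: "?A (x + s *\<^sub>R v + r *\<^sub>R w) = ?B (x + r' *\<^sub>R v + s' *\<^sub>R w)" using tpos by simp
    have "dist (x + s *\<^sub>R v + r *\<^sub>R w) x < d1" "dist (x + r' *\<^sub>R v + s' *\<^sub>R w) x < d2"
      using near[OF sr(1-4)] near[OF sr'(3,4,1,2)] by (auto simp: d_def)
    from d(2)[OF this(1)] d(4)[OF this(2)] show ?thesis
      unfolding dist_real_def eq by linarith
  qed
  then show ?thesis by (metis abs_le_zero_iff dense_ge eq_iff_diff_eq_0)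
qed

text \<open>The mean value theorem needs real values, so the claim is transferred from
  \<open>Re\<close> and \<open>Im\<close>, which commute with derivatives.\<close>

lemma second_derivative_commute:
  fixes f :: "'a::real_normed_vector \<Rightarrow> complex"
  assumes "open S" and f: "Ck_on 2 S f" and x: "x \<in> S"
  shows "frechet_derivative (\<lambda>y. frechet_derivative f (at y) v) (at x) w =
    frechet_derivative (\<lambda>y. frechet_derivative f (at y) w) (at x) v"
proof -
  have *: "L (frechet_derivative (\<lambda>y. frechet_derivative f (at y) v) (at x) w) =
    frechet_derivative (\<lambda>y. frechet_derivative (\<lambda>z. L (f z)) (at y) v) (at x) w"
    if L: "bounded_linear L" for L :: "complex \<Rightarrow> real" and v w
  proof -
    have "frechet_derivative (\<lambda>z. L (f z)) (at y) v = L (frechet_derivative f (at y) v)" if "y \<in> S" for y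
    proof -
      have "(f has_derivative frechet_derivative f (at y)) (at y)"
        using f that by (simp add: numeral_2_eq_2 frechet_derivative_works)
      from frechet_derivative_at[OF bounded_linear.has_derivative[OF L this]] show ?thesis by (simp add: fun_eq_iff)
    qed
    then have "frechet_derivative (\<lambda>y. frechet_derivative (\<lambda>z. L (f z)) (at y) v) (at x) =
       frechet_derivative (\<lambda>y. L (frechet_derivative f (at y) v)) (at x)"
      by (intro frechet_derivative_cong_open(1)[OF assms(1) x])
    moreover have "((\<lambda>y. frechet_derivative f (at y) v) has_derivative frechet_derivative (\<lambda>y. frechet_derivative f (at y) v) (at x)) (at x)"
      using f x by (simp add: numeral_2_eq_2 frechet_derivative_works)
    from frechet_derivative_at[OF bounded_linear.has_derivative[OF L this]]
    have "frechet_derivative (\<lambda>y. L (frechet_derivative f (at y) v)) (at x) w =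
        L (frechet_derivative (\<lambda>y. frechet_derivative f (at y) v) (at x) w)" by (simp add: fun_eq_iff)
    ultimately show ?thesis by simp
  qed
  have L: "Ck_on 2 S (\<lambda>z. L (f z))" if "bounded_linear L" for L :: "complex \<Rightarrow> real"
    using Ck_on_bounded_linear[OF that assms(1) f] .
  show ?thesis
    using *[OF bounded_linear_Re, of v w] *[OF bounded_linear_Re, of w v]
      *[OF bounded_linear_Im, of v w] *[OF bounded_linear_Im, of w v]
      second_derivative_commute_real[OF assms(1) L x, OF bounded_linear_Re, of v w]
      second_derivative_commute_real[OF assms(1) L x, OF bounded_linear_Im, of v w]
    by (simp add: complex_eq_iff)
qed

text \<open>The mixed rule identifies the matrix of \<open>dbar q\<close> with that of the Ricci
  form; the purely antiholomorphic rule is \<open>dbar (dbar q) = 0\<close>.\<close>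

lemma wirtinger_commute:
  assumes "open S" "Ck_on 2 S f" "z \<in> S"
  shows "wirtinger j (wirtinger_bar k f) z = wirtinger_bar k (wirtinger j f) z"
    and "wirtinger_bar j (wirtinger_bar k f) z = wirtinger_bar k (wirtinger_bar j f) z"
proof -
  have d: "((\<lambda>y. frechet_derivative f (at y) v) has_derivative frechet_derivative (\<lambda>y. frechet_derivative f (at y) v) (at z)) (at z)" for v
    using assms by (simp add: numeral_2_eq_2 frechet_derivative_works)
  have b: "(wirtinger_bar k f has_derivative (\<lambda>v. (frechet_derivative (\<lambda>y. frechet_derivative f (at y) (axis k 1)) (at z) v +
     \<i> * frechet_derivative (\<lambda>y. frechet_derivative f (at y) (axis k \<i>)) (at z) v) / 2)) (at z)" for k
    unfolding wirtinger_bar_def[abs_def] divide_inverse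
    by (intro has_derivative_mult_left has_derivative_add has_derivative_mult_right d)
  have h: "(wirtinger j f has_derivative (\<lambda>v. (frechet_derivative (\<lambda>y. frechet_derivative f (at y) (axis j 1)) (at z) v -
     \<i> * frechet_derivative (\<lambda>y. frechet_derivative f (at y) (axis j \<i>)) (at z) v) / 2)) (at z)" for j
    unfolding wirtinger_def[abs_def] divide_inverse
    by (intro has_derivative_mult_left has_derivative_diff has_derivative_mult_right d)
  note comm = second_derivative_commute[OF assms]
  show "wirtinger j (wirtinger_bar k f) z = wirtinger_bar k (wirtinger j f) z"
    unfolding wirtinger_has_derivative[OF b] wirtinger_has_derivative[OF h]
    by (simp add: comm[of "axis j _" "axis k _"] algebra_simps add_divide_distrib diff_divide_distrib)
  show "wirtinger_bar j (wirtinger_bar k f) z = wirtinger_bar k (wirtinger_bar j f) z"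
    unfolding wirtinger_has_derivative[OF b]
    by (simp add: comm[of "axis j _" "axis k _"] algebra_simps add_divide_distrib diff_divide_distrib)
qed

section \<open>Holomorphic functions of several variables\<close>

definition hol_on :: "(complex^'n \<Rightarrow> complex) \<Rightarrow> (complex^'n) set \<Rightarrow> bool" where
  "hol_on f S \<longleftrightarrow> (\<forall>z\<in>S. \<exists>D. (f has_derivative D) (at z) \<and> (\<forall>c v. D (c *s v) = c * D v))"

lemma hol_onD:
  assumes "hol_on f S" "z \<in> S"
  shows "(f has_derivative frechet_derivative f (at z)) (at z)"
    and "frechet_derivative f (at z) (c *s v) = c * frechet_derivative f (at z) v"
proof -
  obtain D where D: "(f has_derivative D) (at z)" "\<And>c v. D (c *s v) = c * D v"
    using assms unfolding hol_on_def by blast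
  then have "frechet_derivative f (at z) = D" using frechet_derivative_at by metis
  then show "(f has_derivative frechet_derivative f (at z)) (at z)"
    "frechet_derivative f (at z) (c *s v) = c * frechet_derivative f (at z) v" using D by auto
qed

lemma hol_onI:
  assumes "\<And>z. z \<in> S \<Longrightarrow> (f has_derivative D z) (at z)" "\<And>z c v. z \<in> S \<Longrightarrow> D z (c *s v) = c * D z v"
  shows "hol_on f S"
  using assms unfolding hol_on_def by blast

lemma hol_on_subset: "hol_on f S \<Longrightarrow> T \<subseteq> S \<Longrightarrow> hol_on f T"
  by (auto simp: hol_on_def)

lemma hol_on_cong:
  assumes "hol_on f S" "open S" "\<And>z. z \<in> S \<Longrightarrow> f z = g z"
  shows "hol_on g S"
  unfolding hol_on_def
proof
  fix z assume z: "z \<in> S"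
  obtain D where D: "(f has_derivative D) (at z)" "\<And>c v. D (c *s v) = c * D v"
    using assms(1) z unfolding hol_on_def by blast
  have "(g has_derivative D) (at z)"
    using has_derivative_transform_within_open[OF D(1) assms(2) z] assms(3) by auto
  then show "\<exists>D. (g has_derivative D) (at z) \<and> (\<forall>c v. D (c *s v) = c * D v)"
    using D(2) by blast
qed

lemma hol_on_continuous: "hol_on f S \<Longrightarrow> continuous_on S f"
  unfolding hol_on_def
  by (meson continuous_at_imp_continuous_on has_derivative_continuous)

section \<open>Restriction to complex lines, Cauchy estimates and locally uniform limits\<close>

lemma norm_vec_smult: "norm (c *s (v :: complex^'n)) = norm c * norm v"
  by (simp add: norm_vec_def L2_set_def norm_mult power_mult_distrib sum_distrib_left[symmetric] real_sqrt_mult)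

lemma bounded_linear_smult: "bounded_linear (\<lambda>c. c *s (v :: complex^'n))"
  by (rule bounded_linear_intro[of _ "norm v"])
     (simp_all add: vec_eq_iff distrib_right norm_vec_smult)

lemma hol_on_line:
  assumes "hol_on f S" "z + t *s v \<in> S"
  shows "((\<lambda>t. f (z + t *s v)) has_field_derivative frechet_derivative f (at (z + t *s v)) v) (at t)"
proof -
  have "((\<lambda>t. z + t *s v) has_derivative (\<lambda>t. t *s v)) (at t)"
    using bounded_linear.has_derivative[OF bounded_linear_smult, of "\<lambda>x. x" "\<lambda>x. x"]
    by (auto intro!: derivative_eq_intros)
  then have "((\<lambda>t. f (z + t *s v)) has_derivative
     (\<lambda>s. frechet_derivative f (at (z + t *s v)) (s *s v))) (at t)"
    using hol_onD(1)[OF assms] by (rule has_derivative_compose)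
  then show ?thesis
    unfolding has_field_derivative_def using hol_onD(2)[OF assms] by (simp add: mult_commute_abs)
qed

lemma hol_on_Cauchy:
  assumes "hol_on f (ball z r)" "0 < r" "\<And>w. w \<in> ball z r \<Longrightarrow> norm (f w) \<le> B"
  shows "norm (frechet_derivative f (at z) v) \<le> 2 * B / r * norm v"
proof (cases "v = 0")
  case True
  have "bounded_linear (frechet_derivative f (at z))"
    using hol_onD(1)[OF assms(1), of z] assms(2) by (simp add: has_derivative_bounded_linear)
  then show ?thesis using True by (simp add: linear_simps)
next
  case False
  \<comment> \<open>Half the parameter at which \<open>z + t *s v\<close> can leave the ball, so
    that the closed disc stays inside; this causes the factor 2 in the estimate.\<close>
  define \<rho> where "\<rho> = r / (2 * norm v)"
  have \<rho>: "\<rho> > 0" using False assms(2) by (simp add: \<rho>_def)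
  let ?g = "\<lambda>t. f (z + t *s v)"
  have inb: "z + t *s v \<in> ball z r" if "norm t \<le> \<rho>" for t
  proof -
    have "norm t * norm v \<le> \<rho> * norm v" using that by (intro mult_right_mono) auto
    also have "\<dots> < r" using False assms(2) by (simp add: \<rho>_def)
    finally show ?thesis by (simp add: dist_norm norm_vec_smult)
  qed
  have d: "(?g has_field_derivative frechet_derivative f (at (z + t *s v)) v) (at t)" if "norm t \<le> \<rho>" for t
    using hol_on_line[OF assms(1) inb[OF that]] .
  have "norm ((deriv ^^ 1) ?g 0) \<le> fact 1 * B / \<rho> ^ 1"
  proof (rule Cauchy_inequality)
    show "?g holomorphic_on ball 0 \<rho>"
      unfolding holomorphic_on_open[OF open_ball] by (intro ballI exI) (rule d, simp)
    show "continuous_on (cball 0 \<rho>) ?g"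
      by (intro continuous_at_imp_continuous_on ballI DERIV_isCont[OF d]) simp
  qed (use \<rho> inb assms(3) in auto)
  moreover have "deriv ?g 0 = frechet_derivative f (at z) v"
    using d[of 0] \<rho> by (simp add: DERIV_imp_deriv)
  ultimately show ?thesis using False assms(2) by (simp add: \<rho>_def field_simps)
qed

text \<open>Weierstrass' theorem. The Cauchy estimate for \<open>f m - f n\<close> makes the
  derivatives uniformly Cauchy on the ball of half the radius, so differentiation passes to the
  limit, and complex linearity survives pointwise limits.\<close>

lemma hol_on_limit:
  assumes "open S" "\<And>k. hol_on (f k) S"
    and lim: "\<And>z. z \<in> S \<Longrightarrow> \<exists>r>0. ball z r \<subseteq> S \<and> uniform_limit (ball z r) f g sequentially"
  shows "hol_on g S"
    and "z \<in> S \<Longrightarrow> (\<lambda>k. frechet_derivative (f k) (at z) v) \<longlonglongrightarrow> frechet_derivative g (at z) v"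
proof -
  have *: "\<exists>D. (g has_derivative D) (at z) \<and> (\<forall>c v. D (c *s v) = c * D v) \<and>
      (\<forall>v. (\<lambda>k. frechet_derivative (f k) (at z) v) \<longlonglongrightarrow> D v)" if z: "z \<in> S" for z
  proof -
    obtain r where r: "r > 0" "ball z r \<subseteq> S" "uniform_limit (ball z r) f g sequentially"
      using lim[OF z] by blast
    let ?d = "\<lambda>k x. frechet_derivative (f k) (at x)"
    let ?S = "ball z (r/2)"
    have xS: "x \<in> S" if "x \<in> ?S" for x using that r by auto
    have der: "(f k has_derivative ?d k x) (at x)" if "x \<in> ?S" for k x
      using hol_onD(1)[OF assms(2) xS[OF that]] .
    have cau: "\<exists>N. \<forall>m\<ge>N. \<forall>n\<ge>N. \<forall>x\<in>?S. \<forall>h. norm (?d m x h - ?d n x h) \<le> e * norm h" if e: "e > 0" for e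
    proof -
      \<comment> \<open>Then \<open>f m - f n\<close> is at most \<open>e * r / 4\<close> on the
        ball, and the Cauchy estimate at radius \<open>r / 2\<close> yields exactly
        \<open>e\<close>.\<close>
      have "e * r / 8 > 0" using e r by simp
      then obtain N where N: "\<And>n x. n \<ge> N \<Longrightarrow> x \<in> ball z r \<Longrightarrow> dist (f n x) (g x) < e * r / 8"
        using r(3) unfolding uniform_limit_iff eventually_sequentially by metis
      have "norm (?d m x h - ?d n x h) \<le> e * norm h" if mn: "m \<ge> N" "n \<ge> N" and x: "x \<in> ?S" for m n x h
      proof -
        let ?F = "\<lambda>x. f m x - f n x"
        have sub: "ball x (r/2) \<subseteq> ball z r"
        proof
          fix y assume "y \<in> ball x (r/2)"
          then show "y \<in> ball z r" using x dist_triangle[of z y x] by simp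
        qed
        have hF: "hol_on ?F (ball x (r/2))"
        proof (rule hol_onI)
          fix y assume "y \<in> ball x (r/2)"
          then have y: "y \<in> S" using sub r by blast
          show "(?F has_derivative (\<lambda>h. ?d m y h - ?d n y h)) (at y)"
            by (intro has_derivative_diff hol_onD(1)[OF assms(2) y])
          show "?d m y (c *s v) - ?d n y (c *s v) = c * (?d m y v - ?d n y v)" for c v
            by (simp add: hol_onD(2)[OF assms(2) y] algebra_simps)
        qed
        have "norm (?F y) \<le> e * r / 4" if "y \<in> ball x (r/2)" for y
        proof -
          have y: "y \<in> ball z r" using that sub by blast
          have "norm (?F y) \<le> dist (f m y) (g y) + dist (f n y) (g y)"
            by (metis dist_norm dist_triangle2)
          then show ?thesis using N[OF mn(1) y] N[OF mn(2) y] by simp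
        qed
        from hol_on_Cauchy[OF hF _ this, of h]
        have "norm (frechet_derivative ?F (at x) h) \<le> e * norm h" using r(1) by simp
        moreover have "frechet_derivative ?F (at x) = (\<lambda>h. ?d m x h - ?d n x h)"
          by (intro frechet_derivative_at[symmetric] has_derivative_diff der x)
        ultimately show ?thesis by simp
      qed
      then show ?thesis by blast
    qed
    have conv: "convergent (\<lambda>k. ?d k x h)" if x: "x \<in> ?S" for x h
    proof (rule Cauchy_convergent, rule metric_CauchyI)
      fix e :: real assume e: "e > 0"
      define e' where "e' = e / (2 * (norm h + 1))"
      have "e' > 0" using e by (simp add: e'_def add_nonneg_pos)
      then obtain N where N: "\<forall>m\<ge>N. \<forall>n\<ge>N. \<forall>x\<in>?S. \<forall>h. norm (?d m x h - ?d n x h) \<le> e' * norm h"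
        using cau by blast
      have "e' * norm h \<le> e' * (norm h + 1)" using \<open>e' > 0\<close> by simp
      also have "\<dots> = e / 2" unfolding e'_def using norm_ge_zero[of h]
        by (simp add: field_simps add_nonneg_eq_0_iff)
      also have "\<dots> < e" using e by simp
      finally have "e' * norm h < e" .
      then show "\<exists>M. \<forall>m\<ge>M. \<forall>n\<ge>M. dist (?d m x h) (?d n x h) < e"
      proof (intro exI[of _ N] allI impI)
        fix m n assume "N \<le> m" "N \<le> n"
        then have "norm (?d m x h - ?d n x h) \<le> e' * norm h" using N x by blast
        then show "dist (?d m x h) (?d n x h) < e" using \<open>e' * norm h < e\<close> by (simp add: dist_norm)
      qed
    qed
    define D where "D x h = lim (\<lambda>k. ?d k x h)" for x h
    have D: "(\<lambda>k. ?d k x h) \<longlonglongrightarrow> D x h" if "x \<in> ?S" for x h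
      using conv[OF that] by (simp add: D_def convergent_LIMSEQ_iff)
    have "\<exists>g'. \<forall>x\<in>?S. (\<lambda>n. f n x) \<longlonglongrightarrow> g' x \<and> (g' has_derivative D x) (at x within ?S)"
    proof (rule has_derivative_sequence)
      show "convex ?S" by simp
      show "(f n has_derivative ?d n x) (at x within ?S)" if "x \<in> ?S" for n x
        using der[OF that] by (rule has_derivative_at_withinI)
      show "\<forall>\<^sub>F n in sequentially. \<forall>x\<in>?S. \<forall>h. norm (?d n x h - D x h) \<le> e * norm h" if "e > 0" for e
      proof -
        obtain N where N: "\<forall>m\<ge>N. \<forall>n\<ge>N. \<forall>x\<in>?S. \<forall>h. norm (?d m x h - ?d n x h) \<le> e * norm h"
          using cau[OF \<open>e > 0\<close>] by blast
        have "norm (?d n x h - D x h) \<le> e * norm h" if "n \<ge> N" "x \<in> ?S" for n x h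
        proof (rule Lim_bounded)
          show "(\<lambda>m. norm (?d n x h - ?d m x h)) \<longlonglongrightarrow> norm (?d n x h - D x h)"
            by (intro tendsto_intros D that)
          show "\<forall>m\<ge>N. norm (?d n x h - ?d m x h) \<le> e * norm h" using N that by blast
        qed
        then show ?thesis unfolding eventually_sequentially by blast
      qed
      show "z \<in> ?S" using r by simp
      have "z \<in> ball z r" using r by simp
      then show "(\<lambda>n. f n z) \<longlonglongrightarrow> g z" by (rule tendsto_uniform_limitI[OF r(3)])
    qed
    then obtain g' where g': "\<And>x. x \<in> ?S \<Longrightarrow> (\<lambda>n. f n x) \<longlonglongrightarrow> g' x"
      "\<And>x. x \<in> ?S \<Longrightarrow> (g' has_derivative D x) (at x within ?S)" by blast
    have eq: "g' x = g x" if "x \<in> ?S" for x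
    proof (rule LIMSEQ_unique[OF g'(1)[OF that]])
      have "x \<in> ball z r" using that r by simp
      then show "(\<lambda>n. f n x) \<longlonglongrightarrow> g x" by (rule tendsto_uniform_limitI[OF r(3)])
    qed
    have zS: "z \<in> ?S" using r by simp
    have "(g' has_derivative D z) (at z)"
      using g'(2)[OF zS] at_within_open[OF zS] by simp
    then have "(g has_derivative D z) (at z)"
      by (rule has_derivative_transform_within_open[of _ _ _ _ ?S]) (use zS eq in auto)
    moreover have "D z (c *s v) = c * D z v" for c v
    proof (rule LIMSEQ_unique[OF D[OF zS]])
      have "(\<lambda>k. c * ?d k z v) \<longlonglongrightarrow> c * D z v" by (intro tendsto_intros D zS)
      then show "(\<lambda>k. ?d k z (c *s v)) \<longlonglongrightarrow> c * D z v"
        by (simp add: hol_onD(2)[OF assms(2) z])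
    qed
    ultimately show ?thesis using D[OF zS] by blast
  qed
  then show "hol_on g S" unfolding hol_on_def by blast
  show "(\<lambda>k. frechet_derivative (f k) (at z) v) \<longlonglongrightarrow> frechet_derivative g (at z) v" if "z \<in> S"
    using *[OF that] frechet_derivative_at by metis
qed

text \<open>Bootstraps bare complex differentiability to all orders, see
  \<open>hol_on_Ck\<close>.\<close>

lemma hol_on_derivative:
  assumes "open S" "hol_on f S"
  shows "hol_on (\<lambda>z. frechet_derivative f (at z) v) S"
proof (cases "v = 0")
  case True
  have "frechet_derivative f (at z) 0 = 0" if "z \<in> S" for z
    using hol_onD(2)[OF assms(2) that, of 0 0] by simp
  then show ?thesis using True
    by (intro hol_onI[where D = "\<lambda>_ _. 0"] has_derivative_transform_within_open[OF has_derivative_const \<open>open S\<close>]) auto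
next
  case False
  \<comment> \<open>The difference quotients are holomorphic and converge locally uniformly.\<close>
  have *: "\<exists>r>0. ball z r \<subseteq> S \<and> (\<exists>t0>0. \<exists>C. \<forall>x\<in>ball z r. \<forall>t. norm t \<le> t0 \<longrightarrow> x + t *s v \<in> S \<and>
     norm (f (x + t *s v) - f x - t * frechet_derivative f (at x) v) \<le> C * norm t ^ 2)" if z: "z \<in> S" for z
  proof -
    obtain R where R: "R > 0" "cball z R \<subseteq> S" using assms(1) z open_contains_cball by blast
    have "compact (f ` cball z R)"
      using hol_on_continuous[OF hol_on_subset[OF assms(2) R(2)]] by (intro compact_continuous_image) auto
    then obtain B where B: "\<And>w. w \<in> cball z R \<Longrightarrow> norm (f w) \<le> B"
      using compact_imp_bounded bounded_iff by (metis imageI)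
    \<comment> \<open>Parameters up to \<open>2 * \<rho>\<close> keep \<open>x + t *s v\<close> in
      the closed ball of radius \<open>R\<close>, which leaves room for a disc of radius
      \<open>\<rho>\<close> around every parameter up to \<open>\<rho>\<close>.\<close>
    define \<rho> where "\<rho> = R / (4 * norm v)"
    have \<rho>: "\<rho> > 0" using R False by (simp add: \<rho>_def)
    have inb: "x + t *s v \<in> cball z R" if "x \<in> ball z (R/2)" "norm t \<le> 2 * \<rho>" for x t
    proof -
      have "norm t * norm v \<le> 2 * \<rho> * norm v" using that by (intro mult_right_mono) auto
      also have "\<dots> = R / 2" using False by (simp add: \<rho>_def)
      finally have "norm (t *s v) \<le> R / 2" by (simp add: norm_vec_smult)
      then show ?thesis using that(1) norm_triangle_ineq[of "z - x" "- (t *s v)"]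
        by (simp add: dist_norm algebra_simps)
    qed
    have "norm (f (x + t *s v) - f x - t * frechet_derivative f (at x) v) \<le> (2 * B / \<rho>^2) * norm t ^ 2"
      if x: "x \<in> ball z (R/2)" and t: "norm t \<le> \<rho>" for x t
    proof -
      let ?g = "\<lambda>t. f (x + t *s v)"
      have d: "(?g has_field_derivative frechet_derivative f (at (x + t *s v)) v) (at t)" if "norm t \<le> 2*\<rho>" for t
        using hol_on_line[OF assms(2)] inb[OF x that] R by blast
      have hol: "?g holomorphic_on ball 0 (2*\<rho>)"
        unfolding holomorphic_on_open[OF open_ball] by (intro ballI exI) (rule d, simp)
      \<comment> \<open>First order Taylor expansion along the line. The constant is Cauchy's
        inequality for the second derivative on discs of radius \<open>\<rho>\<close>, with its
        factor \<open>fact 2\<close>.\<close>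
      have tay: "cmod (?g t - (\<Sum>i\<le>1. (deriv ^^ i) ?g 0 * (t - 0) ^ i / fact i))
          \<le> (2 * B / \<rho>^2) * norm (t - 0) ^ Suc 1 / fact 1"
      proof (rule complex_Taylor[of "cball 0 \<rho>" 1 "\<lambda>i. (deriv ^^ i) ?g" "2 * B / \<rho>^2" 0 t, simplified funpow_0])
        show "((deriv ^^ i) ?g has_field_derivative (deriv ^^ Suc i) ?g y) (at y within cball 0 \<rho>)"
          if "y \<in> cball 0 \<rho>" for i y
        proof -
          have "(deriv ^^ i) ?g holomorphic_on ball 0 (2*\<rho>)" by (intro holomorphic_higher_deriv hol) auto
          moreover have "y \<in> ball 0 (2*\<rho>)" using that \<rho> by simp
          ultimately have "((deriv ^^ i) ?g has_field_derivative deriv ((deriv ^^ i) ?g) y) (at y)"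
            using holomorphic_derivI open_ball by blast
          then show ?thesis unfolding funpow.simps(2) comp_def by (rule has_field_derivative_at_within)
        qed
        show "cmod ((deriv ^^ Suc 1) ?g y) \<le> 2 * B / \<rho>^2" if "y \<in> cball 0 \<rho>" for y
        proof -
          have sub: "cball y \<rho> \<subseteq> cball 0 (2*\<rho>)" 
          proof
            fix w assume "w \<in> cball y \<rho>"
            then show "w \<in> cball 0 (2*\<rho>)" using that dist_triangle[of 0 w y] by simp
          qed
          have "cmod ((deriv ^^ 2) ?g y) \<le> fact 2 * B / \<rho> ^ 2"
          proof (rule Cauchy_inequality)
            have "ball y \<rho> \<subseteq> ball 0 (2 * \<rho>)"
            proof
              fix w assume "w \<in> ball y \<rho>"
              then show "w \<in> ball 0 (2*\<rho>)" using that dist_triangle[of 0 w y] by simp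
            qed
            then show "?g holomorphic_on ball y \<rho>" using hol holomorphic_on_subset by blast
            show "continuous_on (cball y \<rho>) ?g"
              using sub by (intro continuous_at_imp_continuous_on ballI DERIV_isCont[OF d]) auto
            show "cmod (?g w) \<le> B" if "cmod (y - w) = \<rho>" for w
            proof -
              have "w \<in> cball y \<rho>" using that by (simp add: dist_norm)
              then have "w \<in> cball 0 (2*\<rho>)" using sub by blast
              then show ?thesis by (intro B inb x) simp
            qed
          qed (rule \<rho>)
          then show ?thesis by (simp add: numeral_2_eq_2)
        qed
        show "convex (cball (0::complex) \<rho>)" "0 \<in> cball (0::complex) \<rho>" "t \<in> cball 0 \<rho>"
          using \<rho> t by auto
      qed
      have "deriv ?g 0 = frechet_derivative f (at x) v"
        using d[of 0] \<rho> by (simp add: DERIV_imp_deriv)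
      with tay show ?thesis by (simp add: algebra_simps power2_eq_square diff_diff_eq)
    qed
    moreover have "x + t *s v \<in> S" if "x \<in> ball z (R/2)" "norm t \<le> \<rho>" for x t
      using inb[OF that(1), of t] that(2) \<rho> R(2) by auto
    moreover have "ball z (R/2) \<subseteq> S" using R by (auto simp: subset_eq)
    ultimately show ?thesis using \<rho> R(1)
      by (intro exI[of _ "R/2"] conjI exI[of _ \<rho>] exI[of _ "2 * B / \<rho>\<^sup>2"]) auto
  qed
  have loc: "\<exists>r>0. ball z r \<subseteq> S \<and> hol_on (\<lambda>z. frechet_derivative f (at z) v) (ball z r)" if z: "z \<in> S" for z
  proof -
    obtain r t0 C where r: "r > 0" "ball z r \<subseteq> S" "t0 > 0" and
      C: "\<And>x t. x \<in> ball z r \<Longrightarrow> norm t \<le> t0 \<Longrightarrow> x + t *s v \<in> S"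
       "\<And>x t. x \<in> ball z r \<Longrightarrow> norm t \<le> t0 \<Longrightarrow>
       norm (f (x + t *s v) - f x - t * frechet_derivative f (at x) v) \<le> C * norm t ^ 2"
      using *[OF z] by blast
    define t where "t k = complex_of_real (t0 / (real k + 1))" for k :: nat
    have t: "norm (t k) = t0 / (real k + 1)" "t k \<noteq> 0" "norm (t k) \<le> t0" for k
    proof -
      show n: "norm (t k) = t0 / (real k + 1)" using r(3) by (simp add: t_def norm_divide del: of_real_divide)
      show "t k \<noteq> 0" using n r(3) by (metis divide_eq_0_iff norm_zero of_nat_0_le_iff less_numeral_extra(3) add_nonneg_eq_0_iff zero_le_one zero_neq_one)
      have "t0 * 1 \<le> t0 * (real k + 1)" using r(3) by (intro mult_left_mono) auto
      then show "norm (t k) \<le> t0" unfolding n by (simp add: divide_le_eq)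
    qed
    define F where "F k x = (f (x + t k *s v) - f x) / t k" for k x
    have "hol_on (\<lambda>z. frechet_derivative f (at z) v) (ball z r)"
    proof (rule hol_on_limit(1)[where f = F])
      show "hol_on (F k) (ball z r)" for k
      proof (rule hol_onI)
        fix x assume x: "x \<in> ball z r"
        let ?x' = "x + t k *s v"
        have S: "?x' \<in> S" "x \<in> S" using C(1)[OF x t(3)] x r by auto
        have "((\<lambda>x. f (x + t k *s v)) has_derivative (\<lambda>h. frechet_derivative f (at ?x') h)) (at x)"
        proof (rule has_derivative_compose[where g = f])
          show "((\<lambda>x. x + t k *s v) has_derivative (\<lambda>h. h)) (at x)" by (auto intro!: derivative_eq_intros)
        qed (rule hol_onD(1)[OF assms(2) S(1)])
        then show "(F k has_derivative (\<lambda>h. (frechet_derivative f (at ?x') h - frechet_derivative f (at x) h) / t k)) (at x)"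
          unfolding F_def divide_inverse
          by (intro has_derivative_mult_left has_derivative_diff hol_onD(1)[OF assms(2) S(2)])
        show "(frechet_derivative f (at ?x') (c *s w) - frechet_derivative f (at x) (c *s w)) / t k =
          c * ((frechet_derivative f (at ?x') w - frechet_derivative f (at x) w) / t k)" for c w
          by (simp add: hol_onD(2)[OF assms(2) S(1)] hol_onD(2)[OF assms(2) S(2)] algebra_simps)
      qed
      have unif: "uniform_limit (ball z r) F (\<lambda>z. frechet_derivative f (at z) v) sequentially"
      proof (rule uniform_limitI)
        fix e :: real assume e: "e > 0"
        have "(\<lambda>k. \<bar>C\<bar> * (t0 * inverse (real (Suc k)))) \<longlonglongrightarrow> \<bar>C\<bar> * (t0 * 0)"
          by (intro tendsto_mult_left LIMSEQ_inverse_real_of_nat)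
        then have "(\<lambda>k. \<bar>C\<bar> * norm (t k)) \<longlonglongrightarrow> \<bar>C\<bar> * 0"
          unfolding t(1) by (simp add: divide_inverse add.commute)
        then have "\<forall>\<^sub>F k in sequentially. \<bar>C\<bar> * norm (t k) < e" using e order_tendstoD(2) by fastforce
        then show "\<forall>\<^sub>F k in sequentially. \<forall>x\<in>ball z r. dist (F k x) (frechet_derivative f (at x) v) < e"
        proof eventually_elim
          case (elim k)
          show ?case
          proof
            fix x assume x: "x \<in> ball z r"
            have "F k x * t k = f (x + t k *s v) - f x" using t(2)[of k] by (simp add: F_def)
            then have "dist (F k x) (frechet_derivative f (at x) v) * norm (t k) =
              norm (f (x + t k *s v) - f x - t k * frechet_derivative f (at x) v)"
              unfolding dist_norm norm_mult[symmetric] left_diff_distrib by (simp add: mult.commute)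
            also have "\<dots> \<le> C * norm (t k) ^ 2" by (rule C(2)[OF x t(3)])
            also have "\<dots> \<le> (\<bar>C\<bar> * norm (t k)) * norm (t k)"
              unfolding power2_eq_square mult.assoc[symmetric] by (intro mult_right_mono) auto
            finally have "dist (F k x) (frechet_derivative f (at x) v) \<le> \<bar>C\<bar> * norm (t k)"
              using t(2)[of k] by simp
            then show "dist (F k x) (frechet_derivative f (at x) v) < e" using elim by linarith
          qed
        qed
      qed
      show "\<exists>ra>0. ball x ra \<subseteq> ball z r \<and> uniform_limit (ball x ra) F (\<lambda>z. frechet_derivative f (at z) v) sequentially"
        if "x \<in> ball z r" for x
      proof -
        obtain ra where ra: "ra > 0" "ball x ra \<subseteq> ball z r"
          using openE[OF open_ball \<open>x \<in> ball z r\<close>] by metis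
        show ?thesis using ra uniform_limit_on_subset[OF unif ra(2)] by (intro exI[of _ ra]) simp
      qed
    qed simp
    then show ?thesis using r by blast
  qed
  show ?thesis unfolding hol_on_def
  proof
    fix z assume "z \<in> S"
    then obtain r where "r > 0" "hol_on (\<lambda>z. frechet_derivative f (at z) v) (ball z r)" using loc by blast
    then show "\<exists>D. ((\<lambda>z. frechet_derivative f (at z) v) has_derivative D) (at z) \<and> (\<forall>c v. D (c *s v) = c * D v)"
      unfolding hol_on_def by (meson centre_in_ball)
  qed
qed

section \<open>Closure properties of holomorphic functions, holomorphic maps and their
  Jacobians\<close>

lemma hol_on_const: "hol_on (\<lambda>z. c) S"
  by (rule hol_onI[where D = "\<lambda>_ _. 0"]) auto

lemma hol_on_add: "hol_on f S \<Longrightarrow> hol_on g S \<Longrightarrow> hol_on (\<lambda>z. f z + g z) S"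
  by (rule hol_onI[where D = "\<lambda>z v. frechet_derivative f (at z) v + frechet_derivative g (at z) v"])
     (auto intro!: has_derivative_add hol_onD(1)[of f] hol_onD(1)[of g] simp: hol_onD(2) algebra_simps)

lemma hol_on_mult: "hol_on f S \<Longrightarrow> hol_on g S \<Longrightarrow> hol_on (\<lambda>z. f z * g z) S"
  using has_derivative_mult[OF hol_onD(1) hol_onD(1), of f S _ g S]
  by (intro hol_onI[where D = "\<lambda>z v. f z * frechet_derivative g (at z) v + frechet_derivative f (at z) v * g z"])
     (auto simp: hol_onD(2)[of f] hol_onD(2)[of g] algebra_simps)

lemma hol_on_inverse:
  assumes "hol_on f S" "\<And>z. z \<in> S \<Longrightarrow> f z \<noteq> 0"
  shows "hol_on (\<lambda>z. inverse (f z)) S"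
proof (rule hol_onI)
  fix z assume z: "z \<in> S"
  show "((\<lambda>z. inverse (f z)) has_derivative
     (\<lambda>v. - (inverse (f z) * frechet_derivative f (at z) v * inverse (f z)))) (at z)"
    by (rule Deriv.has_derivative_inverse[OF assms(2)[OF z] hol_onD(1)[OF assms(1) z]])
  show "- (inverse (f z) * frechet_derivative f (at z) (c *s v) * inverse (f z)) =
    c * - (inverse (f z) * frechet_derivative f (at z) v * inverse (f z))" for c v
    by (simp add: hol_onD(2)[OF assms(1) z])
qed

lemma hol_on_divide:
  "hol_on f S \<Longrightarrow> hol_on g S \<Longrightarrow> (\<And>z. z \<in> S \<Longrightarrow> g z \<noteq> 0) \<Longrightarrow> hol_on (\<lambda>z. f z / g z) S"
  unfolding divide_inverse by (intro hol_on_mult hol_on_inverse)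

lemma hol_on_sum: "(\<And>i. i \<in> A \<Longrightarrow> hol_on (f i) S) \<Longrightarrow> hol_on (\<lambda>z. \<Sum>i\<in>A. f i z) S"
  by (induction A rule: infinite_finite_induct) (auto intro: hol_on_const hol_on_add)

lemma hol_on_prod: "(\<And>i. i \<in> A \<Longrightarrow> hol_on (f i) S) \<Longrightarrow> hol_on (\<lambda>z. \<Prod>i\<in>A. f i z) S"
  by (induction A rule: infinite_finite_induct) (auto intro: hol_on_const hol_on_mult)

lemma hol_on_det:
  "(\<And>i j. hol_on (\<lambda>z. A z $ i $ j) S) \<Longrightarrow> hol_on (\<lambda>z. det (A z :: complex^'m^'m)) S"
  unfolding det_def by (intro hol_on_sum hol_on_mult hol_on_prod hol_on_const)

lemma holomorphic_map_derivative:
  assumes "holomorphic_map_on F S" "z \<in> S"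
  shows "(F has_derivative frechet_derivative F (at z)) (at z)"
    and "frechet_derivative F (at z) (c *s v) = c *s frechet_derivative F (at z) v"
proof -
  obtain D where D: "(F has_derivative D) (at z)" "\<And>c v. D (c *s v) = c *s D v"
    using assms unfolding holomorphic_map_on_def by blast
  then have "frechet_derivative F (at z) = D" using frechet_derivative_at by metis
  then show "(F has_derivative frechet_derivative F (at z)) (at z)"
    "frechet_derivative F (at z) (c *s v) = c *s frechet_derivative F (at z) v" using D by auto
qed

lemma hol_on_component:
  assumes "holomorphic_map_on F S"
  shows "hol_on (\<lambda>z. F z $ i) S"
    and "z \<in> S \<Longrightarrow> frechet_derivative (\<lambda>z. F z $ i) (at z) v = frechet_derivative F (at z) v $ i"
proof -
  have *: "((\<lambda>z. F z $ i) has_derivative (\<lambda>v. frechet_derivative F (at z) v $ i)) (at z)" if "z \<in> S" for z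
    by (rule bounded_linear.has_derivative[OF bounded_linear_vec_nth holomorphic_map_derivative(1)[OF assms that]])
  show "hol_on (\<lambda>z. F z $ i) S"
    by (rule hol_onI[OF *]) (auto simp: holomorphic_map_derivative(2)[OF assms])
  show "frechet_derivative (\<lambda>z. F z $ i) (at z) v = frechet_derivative F (at z) v $ i" if "z \<in> S"
    using frechet_derivative_at[OF *[OF that]] by metis
qed

lemma hol_on_compose:
  assumes "hol_on f T" "holomorphic_map_on F S" "F ` S \<subseteq> T"
  shows "hol_on (\<lambda>z. f (F z)) S"
proof (rule hol_onI)
  fix z assume z: "z \<in> S"
  then have T: "F z \<in> T" using assms by blast
  show "((\<lambda>z. f (F z)) has_derivative (\<lambda>v. frechet_derivative f (at (F z)) (frechet_derivative F (at z) v))) (at z)"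
    by (rule has_derivative_compose[OF holomorphic_map_derivative(1)[OF assms(2) z] hol_onD(1)[OF assms(1) T]])
  show "frechet_derivative f (at (F z)) (frechet_derivative F (at z) (c *s v)) =
    c * frechet_derivative f (at (F z)) (frechet_derivative F (at z) v)" for c v
    by (simp add: holomorphic_map_derivative(2)[OF assms(2) z] hol_onD(2)[OF assms(1) T])
qed

lemma hol_on_wirtinger:
  fixes f :: "complex^'n \<Rightarrow> complex"
  assumes "hol_on f S" "z \<in> S"
  shows "wirtinger j f z = frechet_derivative f (at z) (axis j 1)" and "wirtinger_bar j f z = 0"
proof -
  have "axis j \<i> = \<i> *s (axis j 1 :: complex^'n)" by (simp add: vec_eq_iff axis_def)
  then have "frechet_derivative f (at z) (axis j \<i>) = \<i> * frechet_derivative f (at z) (axis j 1)"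
    using hol_onD(2)[OF assms] by simp
  then show "wirtinger j f z = frechet_derivative f (at z) (axis j 1)" and "wirtinger_bar j f z = 0"
    by (simp_all add: wirtinger_def wirtinger_bar_def)
qed

lemma hol_on_wirtinger_fun: "open S \<Longrightarrow> hol_on f S \<Longrightarrow> hol_on (wirtinger j f) S"
  by (rule hol_on_cong[OF hol_on_derivative[of S f "axis j 1"]]) (auto simp: hol_on_wirtinger)

lemma hol_on_differentiable: "hol_on f S \<Longrightarrow> z \<in> S \<Longrightarrow> f differentiable (at z)"
  using hol_onD(1) by (auto simp: differentiable_def)

lemma hol_on_Ck: "open S \<Longrightarrow> hol_on f S \<Longrightarrow> Ck_on k S f"
proof (induction k arbitrary: f)
  case 0
  then show ?case by (simp add: hol_on_continuous)
next
  case (Suc k)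
  then show ?case using hol_on_derivative hol_on_differentiable by auto
qed

lemma complex_jacobian_holomorphic:
  assumes "holomorphic_map_on F S" "z \<in> S"
  shows "frechet_derivative F (at z) v = complex_jacobian F z *v v"
proof -
  have v: "v = (\<Sum>l\<in>UNIV. v $ l *s axis l 1)"
    by (simp add: vec_eq_iff axis_def if_distrib[of "\<lambda>x. _ * x"] cong: if_cong)
  have "linear (frechet_derivative F (at z))"
    using holomorphic_map_derivative(1)[OF assms] by (rule has_derivative_linear)
  then have "frechet_derivative F (at z) v = (\<Sum>l\<in>UNIV. v $ l *s frechet_derivative F (at z) (axis l 1))"
    by (subst v) (simp add: linear_sum holomorphic_map_derivative(2)[OF assms])
  then show ?thesis
    by (simp add: vec_eq_iff matrix_vector_mult_def complex_jacobian_def hol_on_wirtinger(1)[OF hol_on_component(1)[OF assms(1)] assms(2)]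
        hol_on_component(2)[OF assms] mult.commute)
qed

lemma hol_on_jacobian:
  "open S \<Longrightarrow> holomorphic_map_on F S \<Longrightarrow> hol_on (\<lambda>z. complex_jacobian F z $ i $ j) S"
  unfolding complex_jacobian_def vec_lambda_beta by (intro hol_on_wirtinger_fun hol_on_component)

text \<open>Holomorphy of \<open>F\<close> keeps the types apart: its derivative is complex linear,
  so (1,0)- and (0,1)-parts are pulled back separately, the latter with the conjugate
  Jacobian.\<close>

lemma wirtinger_compose:
  assumes F: "holomorphic_map_on F S" "z \<in> S" and f: "f differentiable (at (F z))"
  shows "wirtinger j (\<lambda>w. f (F w)) z = (\<Sum>l\<in>UNIV. wirtinger l f (F z) * complex_jacobian F z $ l $ j)" (is ?A)
    and "wirtinger_bar j (\<lambda>w. f (F w)) z = (\<Sum>l\<in>UNIV. wirtinger_bar l f (F z) * cnj (complex_jacobian F z $ l $ j))" (is ?B)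
proof -
  let ?J = "complex_jacobian F z"
  have ax: "(?J *v axis j c) $ l = ?J $ l $ j * c" for l c j
    by (simp add: matrix_vector_mult_def axis_def if_distrib[of "\<lambda>x. _ * x"] cong: if_cong)
  have "((\<lambda>w. f (F w)) has_derivative (\<lambda>v. frechet_derivative f (at (F z)) (frechet_derivative F (at z) v))) (at z)"
    by (rule has_derivative_compose[OF holomorphic_map_derivative(1)[OF F] f[unfolded frechet_derivative_works]])
  from wirtinger_has_derivative[OF this] show ?A ?B
    unfolding complex_jacobian_holomorphic[OF F] frechet_derivative_wirtinger[OF f] ax
    by (simp_all add: sum_distrib_left sum_subtractf[symmetric] sum.distrib[symmetric] sum_divide_distrib algebra_simps)
qed

section \<open>Cofactors and rank-one perturbations of determinants\<close>

abbreviation replace_row :: "'a^'n^'n \<Rightarrow> 'n \<Rightarrow> 'a^'n \<Rightarrow> 'a^'n^'n" where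
  "replace_row A i v \<equiv> (\<chi> k. if k = i then v else A $ k)"

lemma det_replace_row_sum:
  "det (replace_row A i (\<Sum>k\<in>T. v k)) = (\<Sum>k\<in>T. det (replace_row A i (v k)))"
  for A :: "'a::comm_ring_1^'n^'n" and T :: "'m::finite set"
  using det_linear_row_sum[of T i "\<lambda>_. v" "\<lambda>k. A $ k"] by simp

lemma det_replace_row_mul:
  "det (replace_row A i (c *s v)) = c * det (replace_row A i v)"
  for A :: "'a::comm_ring_1^'n^'n"
  using det_row_mul[of i c "\<lambda>_. v" "\<lambda>k. A $ k"] by simp

lemma det_replace_row_row: "l \<noteq> i \<Longrightarrow> det (replace_row A i (A $ l)) = (0::'a::comm_ring_1)"
  by (rule det_identical_rows[of l i]) (auto simp: row_def)

lemma replace_row_same [simp]: "replace_row A i (A $ i) = A"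
  by (auto simp: vec_eq_iff)

text \<open>The \<open>(j, k)\<close> cofactor with its sign. Replacing a row by a unit vector keeps
  the index type, which deleting a row and a column would change.\<close>

definition cof :: "'a::comm_ring_1^'n^'n \<Rightarrow> 'n \<Rightarrow> 'n \<Rightarrow> 'a" where
  "cof A j k = det (replace_row A j (axis k 1))"

lemma vec_axis_sum: "(v :: 'a::comm_ring_1^'n) = (\<Sum>k\<in>UNIV. v $ k *s axis k 1)"
  by (simp add: vec_eq_iff axis_def if_distrib[of "\<lambda>x. _ * x"] cong: if_cong)

lemma det_replace_row: "det (replace_row A j v) = (\<Sum>k\<in>UNIV. v $ k * cof A j k)"
proof -
  have "det (replace_row A j v) = det (replace_row A j (\<Sum>k\<in>UNIV. v $ k *s axis k 1))"
    by (rule arg_cong[OF vec_axis_sum])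
  then show ?thesis by (simp only: det_replace_row_sum det_replace_row_mul cof_def)
qed

lemma cof_row: "(\<Sum>k\<in>UNIV. A $ l $ k * cof A j k) = (if l = j then det A else 0)"
proof (cases "l = j")
  case True
  show ?thesis unfolding det_replace_row[symmetric] True by simp
qed (simp add: det_replace_row[symmetric] det_replace_row_row)

lemma det_has_derivative:
  fixes A :: "'a::real_normed_vector \<Rightarrow> 'b::real_normed_field^'n^'n"
  assumes "\<And>i j. ((\<lambda>x. A x $ i $ j) has_derivative A' i j) (at z)"
  shows "((\<lambda>x. det (A x)) has_derivative (\<lambda>v. \<Sum>i\<in>UNIV. det (replace_row (A z) i (\<chi> j. A' i j v)))) (at z)"
proof -
  have "((\<lambda>x. det (A x)) has_derivative (\<lambda>v. \<Sum>p | p permutes UNIV. of_int (sign p) *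
      (\<Sum>i\<in>UNIV. A' i (p i) v * (\<Prod>k\<in>UNIV - {i}. A z $ k $ p k)))) (at z)"
    unfolding det_def by (intro has_derivative_sum has_derivative_mult_right has_derivative_prod assms)
  moreover have "(\<Prod>k\<in>UNIV. replace_row (A z) i (\<chi> j. A' i j v) $ k $ p k) =
      A' i (p i) v * (\<Prod>k\<in>UNIV - {i}. A z $ k $ p k)" for i p v
    by (subst prod.remove[of _ i]) (auto intro!: arg_cong2[of _ _ _ _ "(*)"] prod.cong)
  then have "(\<Sum>p | p permutes UNIV. of_int (sign p) *
      (\<Sum>i\<in>UNIV. A' i (p i) v * (\<Prod>k\<in>UNIV - {i}. A z $ k $ p k))) =
      (\<Sum>i\<in>UNIV. det (replace_row (A z) i (\<chi> j. A' i j v)))" for v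
    unfolding det_def by (subst sum.swap) (simp add: sum_distrib_left)
  ultimately show ?thesis by simp
qed

text \<open>Jacobi's formula in the direction \<open>B ** A\<close>: row \<open>i\<close> of
  \<open>B ** A\<close> is a combination of the rows of \<open>A\<close>, and only its multiple of
  row \<open>i\<close> itself survives in the determinant.\<close>

lemma sum_det_replace_row_mult:
  fixes A B :: "'a::comm_ring_1^'n^'n"
  shows "(\<Sum>i\<in>UNIV. det (replace_row A i ((B ** A) $ i))) = trace B * det A"
proof -
  have "(B ** A) $ i = (\<Sum>k\<in>UNIV. B $ i $ k *s A $ k)" for i
    by (simp add: vec_eq_iff matrix_matrix_mult_def)
  then have "det (replace_row A i ((B ** A) $ i)) = (\<Sum>k\<in>UNIV. B $ i $ k * det (replace_row A i (A $ k)))" for i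
    by (simp only: det_replace_row_sum det_replace_row_mul)
  also have "\<dots> i = (\<Sum>k\<in>UNIV. if k = i then B $ i $ i * det A else 0)" for i
    by (intro sum.cong) (auto simp: det_replace_row_row)
  finally show ?thesis by (simp add: trace_def sum_distrib_right)
qed

text \<open>The derivative of \<open>t \<mapsto> det (A + t q w\<^sup>T)\<close>, hence natural under \<open>A \<mapsto> P A Q\<close>.\<close>

definition rank_one_det :: "'a::comm_ring_1^'n^'n \<Rightarrow> 'a^'n \<Rightarrow> 'a^'n \<Rightarrow> 'a" where
  "rank_one_det A q w = (\<Sum>i\<in>UNIV. q $ i * det (replace_row A i w))"

lemma rank_one_det_derivative:
  fixes A :: "complex^'n^'n"
  shows "((\<lambda>t. det (\<chi> i j. A $ i $ j + t * (q $ i * w $ j))) has_field_derivative rank_one_det A q w) (at 0)"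
proof -
  let ?A = "\<lambda>t. \<chi> i j. A $ i $ j + t * (q $ i * w $ j)"
  have "((\<lambda>t. det (?A t)) has_derivative (\<lambda>v. \<Sum>i\<in>UNIV. det (replace_row (?A 0) i (\<chi> j. v * (q $ i * w $ j))))) (at 0)"
    by (rule det_has_derivative) (auto intro!: derivative_eq_intros)
  moreover have A0: "?A 0 = A" by (simp add: vec_eq_iff)
  moreover have vq: "(\<chi> j. v * (q $ i * w $ j)) = (v * q $ i) *s w" for i v
    by (simp add: vec_eq_iff)
  moreover have "(*) (rank_one_det A q w) = (\<lambda>v. \<Sum>i\<in>UNIV. v * q $ i * det (replace_row A i w))"
    by (simp add: fun_eq_iff rank_one_det_def sum_distrib_left mult_ac sum_distrib_right)
  ultimately show ?thesis unfolding A0 vq det_replace_row_mul has_field_derivative_def by simp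
qed

text \<open>Both sides are derivatives at 0 of the same function of \<open>t\<close>. Taken with the
  transposed and the conjugated Jacobian of \<open>\<gamma>\<close>, the factor is
  \<open>|J|^2\<close>, so boundary terms transform like densities.\<close>

lemma rank_one_det_congruence:
  fixes B P Q :: "complex^'n^'n"
  shows "rank_one_det (P ** B ** Q) (P *v q) (w v* Q) = det P * det Q * rank_one_det B q w"
proof -
  have "(\<chi> i j. (P ** B ** Q) $ i $ j + t * ((P *v q) $ i * (w v* Q) $ j)) =
    P ** (\<chi> i j. B $ i $ j + t * (q $ i * w $ j)) ** Q" for t
  proof -
    have "(\<chi> i j. (P ** B ** Q) $ i $ j + t * ((P *v q) $ i * (w v* Q) $ j)) =
        P ** B ** Q + P ** (\<chi> i j. t * (q $ i * w $ j)) ** Q"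
      by (simp add: vec_eq_iff matrix_matrix_mult_def matrix_vector_mult_def vector_matrix_mult_def
        sum_product sum_distrib_left sum_distrib_right mult_ac)
    also have "\<dots> = P ** (B + (\<chi> i j. t * (q $ i * w $ j))) ** Q"
      by (simp add: vec_eq_iff matrix_matrix_mult_def sum.distrib distrib_left distrib_right)
    also have "B + (\<chi> i j. t * (q $ i * w $ j)) = (\<chi> i j. B $ i $ j + t * (q $ i * w $ j))"
      by (simp add: vec_eq_iff)
    finally show ?thesis .
  qed
  then have "(\<lambda>t. det (\<chi> i j. (P ** B ** Q) $ i $ j + t * ((P *v q) $ i * (w v* Q) $ j))) =
    (\<lambda>t. (det P * det Q) * det (\<chi> i j. B $ i $ j + t * (q $ i * w $ j)))"
    by (simp add: det_mul fun_eq_iff)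
  with rank_one_det_derivative[of "P ** B ** Q" "P *v q" "w v* Q"]
  have "((\<lambda>t. (det P * det Q) * det (\<chi> i j. B $ i $ j + t * (q $ i * w $ j))) has_field_derivative
    rank_one_det (P ** B ** Q) (P *v q) (w v* Q)) (at 0)" by simp
  moreover have "((\<lambda>t. (det P * det Q) * det (\<chi> i j. B $ i $ j + t * (q $ i * w $ j))) has_field_derivative
    (det P * det Q) * rank_one_det B q w) (at 0)"
    by (intro DERIV_cmult rank_one_det_derivative)
  ultimately show ?thesis by (rule DERIV_unique)
qed

text \<open>With \<open>a + b\<close> in both rows the determinant vanishes, and expanding it leaves
  just the two mixed terms.\<close>

lemma det_replace_two_rows_antisym:
  fixes A :: "complex^'n^'n"
  assumes "i \<noteq> j"
  shows "det (replace_row (replace_row A j a) i b) = - det (replace_row (replace_row A j b) i a)"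
proof -
  let ?d = "\<lambda>a b. det (replace_row (replace_row A j a) i b)"
  have same: "?d c c = 0" for c
    using assms by (intro det_identical_rows[of i j]) (auto simp: row_def vec_eq_iff)
  have i: "?d c (a + b) = ?d c a + ?d c b" for c a b
    using det_row_add[of i "\<lambda>_. a" "\<lambda>_. b" "\<lambda>k. replace_row A j c $ k"] by simp
  have sw: "replace_row (replace_row A j a) i b = replace_row (replace_row A i b) j a" for a b
    using assms by (auto simp: vec_eq_iff)
  have j: "?d (a + b) c = ?d a c + ?d b c" for c a b
    unfolding sw using det_row_add[of j "\<lambda>_. a" "\<lambda>_. b" "\<lambda>k. replace_row A i c $ k"] by simp
  have "?d (a + b) (a + b) = ?d a b + ?d b a"
    by (simp only: i j same add_0_left add_0_right add.commute)
  then show ?thesis using same[of "a + b"] by (simp add: eq_neg_iff_add_eq_0)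
qed

lemma sum_sym_antisym:
  fixes S N :: "'n::finite \<Rightarrow> 'n \<Rightarrow> complex"
  assumes "\<And>k m. S k m = S m k" "\<And>k m. N k m = - N m k"
  shows "(\<Sum>k\<in>UNIV. \<Sum>m\<in>UNIV. S k m * N k m) = 0"
proof -
  have "(\<Sum>k\<in>UNIV. \<Sum>m\<in>UNIV. S k m * N k m) = (\<Sum>k\<in>UNIV. \<Sum>m\<in>UNIV. S m k * N m k)"
    by (rule sum.swap)
  also have "\<dots> = (\<Sum>k\<in>UNIV. \<Sum>m\<in>UNIV. - (S k m * N k m))"
    by (intro sum.cong refl) (metis assms mult_minus_right)
  finally show ?thesis by (simp add: sum_negf)
qed

text \<open>The coordinate form of the closedness of
  \<open>(dbar q)\<^sup>n\<^sup>-\<^sup>1\<close>. The derivative of a cofactor is a sum over the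
  rows \<open>i\<close> other than \<open>j\<close>, in which a second derivative symmetric in
  \<open>k\<close> and \<open>m\<close> meets a cofactor with two replaced rows, antisymmetric in
  \<open>k\<close> and \<open>m\<close>.\<close>

lemma cof_divergence_free:
  fixes M :: "complex^'n \<Rightarrow> complex^'n^'n"
  assumes d: "\<And>i m. (\<lambda>z. M z $ i $ m) differentiable (at z)"
    and sym: "\<And>i k m. wirtinger_bar k (\<lambda>z. M z $ i $ m) z = wirtinger_bar m (\<lambda>z. M z $ i $ k) z"
  shows "(\<Sum>k\<in>UNIV. wirtinger_bar k (\<lambda>z. cof (M z) j k) z) = 0"
proof -
  let ?R = "\<lambda>k z. replace_row (M z) j (axis k 1)"
  let ?D = "\<lambda>k i m. if i = j then (\<lambda>v. 0) else frechet_derivative (\<lambda>z. M z $ i $ m) (at z)"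
  have "((\<lambda>z. ?R k z $ i $ m) has_derivative ?D k i m) (at z)" for k i m
    using d[unfolded frechet_derivative_works] by simp
  then have D: "((\<lambda>z. cof (M z) j k) has_derivative (\<lambda>v. \<Sum>i\<in>UNIV. det (replace_row (?R k z) i (\<chi> m. ?D k i m v)))) (at z)" for k
    unfolding cof_def by (rule det_has_derivative)
  \<comment> \<open>Row \<open>j\<close> holds a constant unit vector, so it contributes no
    derivative.\<close>
  define W where "W i k m = (if i = j then 0 else wirtinger_bar k (\<lambda>z. M z $ i $ m) z)" for i k m
  have "wirtinger_bar k (\<lambda>z. cof (M z) j k) z =
     (\<Sum>i\<in>UNIV. (det (replace_row (?R k z) i (\<chi> m. ?D k i m (axis k 1)))
        + \<i> * det (replace_row (?R k z) i (\<chi> m. ?D k i m (axis k \<i>)))) / 2)" for k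
    unfolding wirtinger_has_derivative(2)[OF D] by (simp add: sum.distrib sum_distrib_left sum_divide_distrib add_divide_distrib)
  also have "\<dots> k = (\<Sum>i\<in>UNIV. \<Sum>m\<in>UNIV. W i k m * cof (?R k z) i m)" for k
  proof (intro sum.cong refl)
    fix i
    show "(det (replace_row (?R k z) i (\<chi> m. ?D k i m (axis k 1)))
        + \<i> * det (replace_row (?R k z) i (\<chi> m. ?D k i m (axis k \<i>)))) / 2 = (\<Sum>m\<in>UNIV. W i k m * cof (?R k z) i m)"
      unfolding det_replace_row
      by (cases "i = j")
         (simp_all add: W_def wirtinger_bar_def sum.distrib sum_distrib_left sum_divide_distrib add_divide_distrib algebra_simps)
  qed
  finally have e: "wirtinger_bar k (\<lambda>z. cof (M z) j k) z = (\<Sum>i\<in>UNIV. \<Sum>m\<in>UNIV. W i k m * cof (?R k z) i m)" for k .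
  have "(\<Sum>k\<in>UNIV. wirtinger_bar k (\<lambda>z. cof (M z) j k) z) =
     (\<Sum>i\<in>UNIV. \<Sum>k\<in>UNIV. \<Sum>m\<in>UNIV. W i k m * cof (?R k z) i m)"
    unfolding e by (rule sum.swap)
  also have "\<dots> = 0"
  proof (rule sum.neutral, rule ballI)
    fix i
    show "(\<Sum>k\<in>UNIV. \<Sum>m\<in>UNIV. W i k m * cof (?R k z) i m) = 0"
    proof (cases "i = j")
      case True
      then show ?thesis by (simp add: W_def)
    next
      case False
      show ?thesis
      proof (rule sum_sym_antisym)
        show "W i k m = W i m k" for k m using sym by (simp add: W_def)
        show "cof (?R k z) i m = - cof (?R m z) i k" for k m
          unfolding cof_def using False by (rule det_replace_two_rows_antisym)
      qed
    qed
  qed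
  finally show ?thesis .
qed

section \<open>Integrals of derivatives\<close>

lemma lborel_integral_translate:
  fixes f :: "'a::euclidean_space \<Rightarrow> 'b::{banach, second_countable_topology}"
  shows "integral\<^sup>L lborel (\<lambda>x. f (c + x)) = integral\<^sup>L lborel f"
    and "integrable lborel (\<lambda>x. f (c + x)) \<longleftrightarrow> integrable lborel f"
proof -
  have inj: "inj ((+) c)" by simp
  show "integral\<^sup>L lborel (\<lambda>x. f (c + x)) = integral\<^sup>L lborel f"
  proof (cases "f \<in> borel_measurable borel")
    case True
    then show ?thesis using integral_distr[of "(+) c" lborel borel f] by (simp add: lborel_distr_plus)
  next
    case False
    \<comment> \<open>If \<open>f\<close> is not measurable, neither is its translate, and both
      integrals have the default value 0.\<close>
    have "(\<lambda>x. f (c + x)) \<notin> borel_measurable borel"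
    proof
      assume m: "(\<lambda>x. f (c + x)) \<in> borel_measurable borel"
      have "(\<lambda>x. f (c + (- c + x))) \<in> borel_measurable borel"
        by (rule measurable_compose[OF _ m]) simp
      then show False using False by simp
    qed
    then have "\<not> integrable lborel (\<lambda>x. f (c + x))" "\<not> integrable lborel f"
      using False borel_measurable_integrable by fastforce+
    then show ?thesis by (simp add: not_integrable_integral_eq)
  qed
  have *: "integrable lborel (\<lambda>x. f (c + x))" if "integrable lborel f" for f :: "'a \<Rightarrow> 'b" and c
    using that integrable_distr[of "(+) c" lborel borel f] by (simp add: lborel_distr_plus)
  show "integrable lborel (\<lambda>x. f (c + x)) \<longleftrightarrow> integrable lborel f"
    using *[of f c] *[of "\<lambda>x. f (c + x)" "-c"] by auto
qed

lemma integrable_compact_support: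
  fixes f :: "'a::euclidean_space \<Rightarrow> 'b::{banach, second_countable_topology}"
  assumes "continuous_on UNIV f" "compact K" "\<And>x. x \<notin> K \<Longrightarrow> f x = 0"
  shows "integrable lborel f"
proof -
  have "integrable lborel (\<lambda>x. indicator K x *\<^sub>R f x)"
    using borel_integrable_compact[OF assms(2) continuous_on_subset[OF assms(1)]] by simp
  moreover have "(\<lambda>x. indicator K x *\<^sub>R f x) = f" using assms(3) by (auto simp: fun_eq_iff indicator_def)
  ultimately show ?thesis by simp
qed

text \<open>Difference quotients of \<open>h\<close> have integral 0 because Lebesgue measure is
  translation invariant; they converge to the derivative, dominated by a constant on one compact
  set. Stokes' theorem below reduces to this.\<close>

lemma integral_directional_derivative_eq_0:
  fixes h :: "'a::euclidean_space \<Rightarrow> complex"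
  assumes h: "Ck_on 1 UNIV h" and K: "compact K" "\<And>x. x \<notin> K \<Longrightarrow> h x = 0"
  shows "integral\<^sup>L lborel (\<lambda>x. frechet_derivative h (at x) v) = 0"
    and "integrable lborel (\<lambda>x. frechet_derivative h (at x) v)"
proof -
  let ?D = "\<lambda>x. frechet_derivative h (at x)"
  have D: "(h has_derivative ?D x) (at x)" for x
    using h by (simp add: frechet_derivative_works)
  have contD: "continuous_on UNIV (\<lambda>x. ?D x v)" using h by simp
  have conth: "continuous_on UNIV h"
    using D by (meson has_derivative_continuous continuous_at_imp_continuous_on)
  have D0: "?D x v = 0" if "x \<notin> K" for x
  proof -
    have "open (- K)" using K by (simp add: compact_imp_closed open_Compl)
    then have "?D x = frechet_derivative (\<lambda>_. 0 :: complex) (at x)"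
      by (rule frechet_derivative_cong_open) (use that K in auto)
    then show ?thesis by simp
  qed
  obtain C where C: "\<And>x. norm (?D x v) \<le> C"
  proof -
    have "bounded ((\<lambda>x. ?D x v) ` K)"
      using K(1) contD by (intro compact_imp_bounded compact_continuous_image) (auto intro: continuous_on_subset)
    then obtain C where "\<And>x. x \<in> K \<Longrightarrow> norm (?D x v) \<le> C" unfolding bounded_iff by blast
    then have "norm (?D x v) \<le> max C 0" for x using D0[of x] by (cases "x \<in> K") (auto simp: le_max_iff_disj)
    then show ?thesis using that by blast
  qed
  then have C0: "C \<ge> 0" using norm_ge_zero order_trans by blast
  define t where "t n = inverse (real (Suc n))" for n
  have t: "0 < t n" "t n \<le> 1" for n by (auto simp: t_def inverse_le_1_iff)
  define F where "F n x = (h (t n *\<^sub>R v + x) - h x) /\<^sub>R t n" for n x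
  have Fbound: "norm (F n x) \<le> C" for n x
  proof -
    have "norm (h (x + t n *\<^sub>R v) - h (x + 0 *\<^sub>R v)) \<le> C * norm (t n - 0)"
    proof (rule differentiable_bound[of "{0..t n}" "\<lambda>s. h (x + s *\<^sub>R v)" "\<lambda>s r. ?D (x + s *\<^sub>R v) (r *\<^sub>R v)" C])
      fix s assume "s \<in> {0..t n}"
      have "((\<lambda>s. x + s *\<^sub>R v) has_derivative (\<lambda>r. r *\<^sub>R v)) (at s within {0..t n})" by (auto intro!: derivative_eq_intros)
      from has_derivative_compose[OF this D]
      show "((\<lambda>s. h (x + s *\<^sub>R v)) has_derivative (\<lambda>r. ?D (x + s *\<^sub>R v) (r *\<^sub>R v))) (at s within {0..t n})" .
      have "linear (?D (x + s *\<^sub>R v))" using D has_derivative_linear by blast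
      then show "onorm (\<lambda>r. ?D (x + s *\<^sub>R v) (r *\<^sub>R v)) \<le> C"
        using C[of "x + s *\<^sub>R v"] by (intro onorm_le) (simp add: linear_scale mult.commute[of C] mult_left_mono)
    qed (use t[of n] in auto)
    then have "norm (h (t n *\<^sub>R v + x) - h x) \<le> C * t n" using t[of n] by (simp add: add.commute)
    then show ?thesis using t(1)[of n] by (simp add: F_def) (simp add: field_simps)
  qed
  \<comment> \<open>The set swept out by \<open>K\<close> under the translations by
    \<open>- s v\<close> with \<open>s\<close> between 0 and 1. Since \<open>t n \<le> 1\<close>, it
    contains the supports of all difference quotients.\<close>
  define K' where "K' = (\<lambda>(s, x). x - s *\<^sub>R v) ` ({0..1} \<times> K)"
  have K': "compact K'" unfolding K'_def
    by (intro compact_continuous_image compact_Times K) (auto intro!: continuous_intros simp: case_prod_unfold)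
  have KK': "K \<subseteq> K'" unfolding K'_def by (auto intro!: rev_image_eqI[of "(0, _)"])
  have F0: "F n x = 0" if x: "x \<notin> K'" for n x
  proof -
    have "t n *\<^sub>R v + x \<notin> K"
    proof
      assume "t n *\<^sub>R v + x \<in> K"
      then have "x \<in> K'" unfolding K'_def using t[of n] by (intro rev_image_eqI[of "(t n, t n *\<^sub>R v + x)"]) auto
      then show False using x by simp
    qed
    then show ?thesis using K(2) KK' x by (auto simp: F_def)
  qed
  have hint: "integrable lborel h" by (rule integrable_compact_support[OF conth K])
  have Fint: "integral\<^sup>L lborel (F n) = 0" for n
    unfolding F_def using hint
    by (simp add: lborel_integral_translate)
  have Dn: "(\<lambda>n. F n x) \<longlonglongrightarrow> ?D x v" for x
  proof -
    have "((\<lambda>s. x + s *\<^sub>R v) has_derivative (\<lambda>r. r *\<^sub>R v)) (at 0)" by (auto intro!: derivative_eq_intros)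
    from has_derivative_compose[OF this, of h "?D x"] D
    have "((\<lambda>s. h (x + s *\<^sub>R v)) has_derivative (\<lambda>r. ?D x (r *\<^sub>R v))) (at 0)" by simp
    then have "((\<lambda>s. norm (h (x + s *\<^sub>R v) - h x - ?D x (s *\<^sub>R v)) / norm s) \<longlongrightarrow> 0) (at 0)"
      by (simp add: has_derivative_at)
    moreover have "filterlim t (at 0) sequentially"
      using t(1) LIMSEQ_inverse_real_of_nat unfolding t_def filterlim_at
      by (auto intro!: always_eventually)
    ultimately have "(\<lambda>n. norm (h (x + t n *\<^sub>R v) - h x - ?D x (t n *\<^sub>R v)) / norm (t n)) \<longlonglongrightarrow> 0"
      by (rule filterlim_compose)
    moreover have "norm (h (x + t n *\<^sub>R v) - h x - ?D x (t n *\<^sub>R v)) / norm (t n) = norm (F n x - ?D x v)" for n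
    proof -
      have "linear (?D x)" using D has_derivative_linear by blast
      then have "h (x + t n *\<^sub>R v) - h x - ?D x (t n *\<^sub>R v) = t n *\<^sub>R (F n x - ?D x v)"
        using t(1)[of n] by (simp add: linear_scale F_def scaleR_diff_right add.commute)
      then show ?thesis using t(1)[of n] by simp
    qed
    ultimately have "(\<lambda>n. norm (F n x - ?D x v)) \<longlonglongrightarrow> 0" by simp
    then show ?thesis by (rule LIM_zero_cancel[OF tendsto_norm_zero_cancel])
  qed
  have "(\<lambda>n. integral\<^sup>L lborel (F n)) \<longlonglongrightarrow> integral\<^sup>L lborel (\<lambda>x. ?D x v)"
  proof (rule integral_dominated_convergence[where w = "\<lambda>x. C * indicator K' x"])
    show "(\<lambda>x. ?D x v) \<in> borel_measurable lborel" using borel_measurable_continuous_onI[OF contD] by simp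
    have cF: "continuous_on UNIV (F n)" for n unfolding F_def
      by (intro continuous_intros continuous_on_compose2[OF conth]) auto
    then show "F n \<in> borel_measurable lborel" for n using borel_measurable_continuous_onI[OF cF] by simp
    show "integrable lborel (\<lambda>x. C * indicator K' x)"
      using K' emeasure_compact_finite[OF K'] by (intro integrable_mult_right integrable_real_indicator) (auto simp: borel_compact)
    show "AE x in lborel. norm (F n x) \<le> C * indicator K' x" for n
      using Fbound F0 by (auto simp: indicator_def)
    show "AE x in lborel. (\<lambda>n. F n x) \<longlonglongrightarrow> ?D x v" using Dn by simp
  qed
  then show "integral\<^sup>L lborel (\<lambda>x. ?D x v) = 0" unfolding Fint by (simp add: LIMSEQ_const_iff)
  show "integrable lborel (\<lambda>x. ?D x v)" by (rule integrable_compact_support[OF contD K(1) D0])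
qed

lemma integral_wirtinger_bar_eq_0:
  fixes h :: "complex^'n \<Rightarrow> complex"
  assumes "Ck_on 1 UNIV h" "compact K" "\<And>x. x \<notin> K \<Longrightarrow> h x = 0"
  shows "integral\<^sup>L lborel (wirtinger_bar k h) = 0" "integrable lborel (wirtinger_bar k h)"
  using integral_directional_derivative_eq_0[OF assms]
  by (simp_all add: wirtinger_bar_def[abs_def])

section \<open>Top powers of (1,1)-forms\<close>

lemma sum_permutes_reindex:
  assumes f: "bij_betw f A B" and "finite A"
  shows "(\<Sum>p | p permutes B. G p) = (\<Sum>p | p permutes A. G (map_permutation A f p))"
proof (rule sum.reindex_bij_witness[of _ "map_permutation A f" "map_permutation B (inv_into A f)"])
  have inj: "inj_on f A" using f by (rule bij_betw_imp_inj_on)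
  have g: "bij_betw (inv_into A f) B A" using f by (rule bij_betw_inv_into)
  fix p assume "p \<in> {p. p permutes B}"
  then have p: "p permutes B" by simp
  have "f (inv_into A f x) = x" if "x \<in> B" for x
    using f that by (metis bij_betw_def f_inv_into_f)
  from map_permutation_compose_inv[OF g p this]
  show e: "map_permutation A f (map_permutation B (inv_into A f) p) = p" .
  show "map_permutation B (inv_into A f) p \<in> {p. p permutes A}"
    using map_permutation_permutes[OF g p] by simp
  show "G (map_permutation A f (map_permutation B (inv_into A f) p)) = G p" using e by simp
next
  fix p assume "p \<in> {p. p permutes A}"
  then have p: "p permutes A" by simp
  have "inv_into A f (f x) = x" if "x \<in> A" for x
    using f that by (simp add: bij_betw_imp_inj_on)
  from map_permutation_compose_inv[OF f p this]
  show "map_permutation B (inv_into A f) (map_permutation A f p) = p" .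
  show "map_permutation A f p \<in> {p. p permutes B}" using map_permutation_permutes[OF f p] by simp
qed

lemma sum_sign_prod_reindex:
  fixes X :: "'b \<Rightarrow> 'b \<Rightarrow> 'c::comm_ring_1"
  assumes f: "bij_betw f A B" and "finite A"
  shows "(\<Sum>p | p permutes B. of_int (sign p) * (\<Prod>i\<in>B. X i (p i))) =
    (\<Sum>p | p permutes A. of_int (sign p) * (\<Prod>i\<in>A. X (f i) (f (p i))))"
  unfolding sum_permutes_reindex[OF assms]
proof (rule sum.cong[OF refl])
  fix p assume "p \<in> {p. p permutes A}"
  then have p: "p permutes A" by simp
  have "(\<Prod>i\<in>B. X i (map_permutation A f p i)) = (\<Prod>i\<in>A. X (f i) (map_permutation A f p (f i)))"
    using prod.reindex_bij_betw[OF f, of "\<lambda>i. X i (map_permutation A f p i)"] by simp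
  also have "\<dots> = (\<Prod>i\<in>A. X (f i) (f (p i)))"
    using f by (intro prod.cong refl) (simp add: map_permutation_apply bij_betw_imp_inj_on)
  finally show "of_int (sign (map_permutation A f p)) * (\<Prod>i\<in>B. X i (map_permutation A f p i)) =
      of_int (sign p) * (\<Prod>i\<in>A. X (f i) (f (p i)))"
    using sign_map_permutation[OF bij_betw_imp_inj_on[OF f] p \<open>finite A\<close>] by simp
qed

lemma det_reindex:
  fixes A :: "'c::comm_ring_1^'b^'b" and f :: "'a::finite \<Rightarrow> 'b::finite"
  assumes "bij f"
  shows "det (\<chi> i j. A $ f i $ f j) = det A"
  unfolding det_def using sum_sign_prod_reindex[OF assms, of "\<lambda>i j. A $ i $ j"] by simp

definition block_at :: "'b::finite \<Rightarrow> 'a::comm_ring_1^'n^'n \<Rightarrow> 'a^('n \<times> 'b)^('n \<times> 'b)" where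
  "block_at b Y = (\<chi> r s. if snd r = b \<and> snd s = b then Y $ fst r $ fst s else if r = s then 1 else 0)"

text \<open>A permutation that moves an index outside the block meets an off-diagonal zero, so only
  the permutations of the block contribute.\<close>

lemma det_block_at: "det (block_at b Y) = det (Y :: 'a::comm_ring_1^'n^'n)"
proof -
  define B where "B = (UNIV :: 'n set) \<times> {b}"
  let ?X = "\<lambda>r s. block_at b Y $ r $ s"
  have f: "bij_betw (\<lambda>j. (j, b)) UNIV B" by (auto simp: bij_betw_def inj_on_def B_def)
  have zero: "(\<Prod>r\<in>UNIV. ?X r (p r)) = 0" if "p permutes UNIV" "\<not> p permutes B" for p
  proof -
    have "\<exists>r. r \<notin> B \<and> p r \<noteq> r"
      using that(2) permutes_superset[OF that(1), of B] by blast
    then obtain r where r: "r \<notin> B" "p r \<noteq> r" by blast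
    then have "?X r (p r) = 0" by (cases r) (auto simp: block_at_def B_def)
    then show ?thesis by (meson UNIV_I finite prod_zero)
  qed
  have "det (block_at b Y) = (\<Sum>p | p permutes B. of_int (sign p) * (\<Prod>r\<in>UNIV. ?X r (p r)))"
    unfolding det_def
    by (rule sum.mono_neutral_right) (auto simp: zero intro: permutes_subset)
  also have "\<dots> = (\<Sum>p | p permutes B. of_int (sign p) * (\<Prod>r\<in>B. ?X r (p r)))"
  proof (rule sum.cong[OF refl])
    fix p assume "p \<in> {p. p permutes B}"
    then have "?X r (p r) = 1" if "r \<in> UNIV - B" for r
      using that by (cases r) (auto simp: block_at_def B_def permutes_not_in)
    then have "(\<Prod>r\<in>UNIV. ?X r (p r)) = (\<Prod>r\<in>B. ?X r (p r))"
      by (intro prod.mono_neutral_right) auto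
    then show "of_int (sign p) * (\<Prod>r\<in>UNIV. ?X r (p r)) = of_int (sign p) * (\<Prod>r\<in>B. ?X r (p r))" by simp
  qed
  also have "\<dots> = det Y"
    unfolding sum_sign_prod_reindex[OF f finite, of ?X] det_def by (simp add: block_at_def)
  finally show ?thesis .
qed

lemma block_at_mult_row:
  fixes Z :: "'a::comm_ring_1^'k^('n::finite \<times> 'b::finite)"
  shows "(block_at b Y ** Z) $ r $ s =
    (if snd r = b then \<Sum>k\<in>UNIV. Y $ fst r $ k * Z $ (k, b) $ s else Z $ r $ s)"
proof (cases "snd r = b")
  case True
  have "(block_at b Y ** Z) $ r $ s = (\<Sum>t\<in>UNIV. block_at b Y $ r $ t * Z $ t $ s)"
    by (simp add: matrix_matrix_mult_def)
  also have "\<dots> = (\<Sum>t\<in>(\<lambda>k. (k, b)) ` UNIV. block_at b Y $ r $ t * Z $ t $ s)"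
    by (rule sum.mono_neutral_right) (use True in \<open>auto simp: block_at_def\<close>)
  also have "\<dots> = (\<Sum>k\<in>UNIV. Y $ fst r $ k * Z $ (k, b) $ s)"
    by (subst sum.reindex) (auto simp: inj_on_def block_at_def True)
  finally show ?thesis using True by simp
next
  case False
  then show ?thesis
    by (simp add: matrix_matrix_mult_def block_at_def if_distrib[of "\<lambda>x. x * _"] cong: if_cong)
qed

text \<open>The vectors of \<open>complex_frame\<close> indexed by a finite type instead of numbers,
  so that they can label the rows and columns of matrices.\<close>

definition real_frame :: "'n \<times> bool \<Rightarrow> complex^'n" where
  "real_frame r = axis (fst r) (if snd r then \<i> else 1)"

text \<open>The matrix of the coframe \<open>dz\<^sub>j\<close>, \<open>d\<zeta>\<^sub>j\<close> in the real frame.\<close>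

definition coframe :: "complex^('n::finite \<times> bool)^('n \<times> bool)" where
  "coframe = (\<chi> r s. if snd r then cnj (real_frame s $ fst r) else real_frame s $ fst r)"

text \<open>Passing from the rows of conjugate differentials to the forms \<open>\<theta>\<close> is
  left multiplication by \<open>H\<close> on one block of rows.\<close>

lemma alternating_sum_det:
  fixes H :: "complex^'n^'n"
  defines "\<theta> \<equiv> \<lambda>a v. \<Sum>k\<in>UNIV. H $ a $ k * cnj (v $ k)"
  defines "Y \<equiv> (\<chi> r s. if snd r then \<theta> (fst r) (real_frame s) else real_frame s $ fst r) :: complex^('n \<times> bool)^('n \<times> bool)"
  shows "det Y = det H * det (coframe :: complex^('n \<times> bool)^('n \<times> bool))"
proof -
  have "Y = block_at True H ** coframe"
    by (simp add: vec_eq_iff block_at_mult_row Y_def \<theta>_def coframe_def)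
  then show ?thesis by (simp add: det_mul det_block_at)
qed

lemma sum_UNIV_prod: "(\<Sum>r\<in>UNIV. g r) = (\<Sum>a\<in>UNIV. \<Sum>b\<in>UNIV. g (a, b))"
  for g :: "'a::finite \<times> 'b::finite \<Rightarrow> 'c::comm_monoid_add"
  by (simp add: sum.cartesian_product UNIV_Times_UNIV[symmetric] del: UNIV_Times_UNIV)

text \<open>Expanding the 2-form as \<open>\<Sum>j. dz\<^sub>j \<and> \<theta>\<^sub>j\<close> writes the top power as a sum over the choices
  \<open>\<Phi>\<close> of an index and an order for each of the factors. The summand of \<open>\<Phi>\<close> is a determinant that
  vanishes if an index repeats, and otherwise arises from a fixed one by permuting the rows. Only the
  existence of the factor \<open>C\<close> matters.\<close>

lemma wedge_power_eq_det:
  obtains C where "\<And>H :: complex^'n^'n. wedge_power CARD('n) (\<lambda>u v. - \<i> * (\<Sum>j\<in>UNIV. \<Sum>k\<in>UNIV.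
    H $ j $ k * (u $ j * cnj (v $ k) - v $ j * cnj (u $ k)))) complex_frame = C * det H"
proof -
  let ?n = "CARD('n)"
  define q :: "nat \<Rightarrow> 'n" where "q = from_nat_into UNIV"
  have q: "bij_betw q {..<?n} UNIV" unfolding q_def by (rule bij_betw_from_nat_into_finite) simp
  \<comment> \<open>The order of \<open>complex_frame\<close>: even numbers stand for the directions
    \<open>\<partial>/\<partial>x\<close>, odd ones for
    \<open>\<partial>/\<partial>y\<close>.\<close>
  define e where "e k = (q (k div 2), odd k)" for k
  have e: "bij_betw e {..<2 * ?n} UNIV"
  proof (rule bij_betw_imageI)
    show "inj_on e {..<2 * ?n}"
    proof (rule inj_onI)
      fix x y assume xy: "x \<in> {..<2 * ?n}" "y \<in> {..<2 * ?n}" "e x = e y"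
      then have "x div 2 \<in> {..<?n}" "y div 2 \<in> {..<?n}" by auto
      then have "x div 2 = y div 2"
        using xy(3) q by (auto simp: e_def bij_betw_def dest: inj_onD)
      moreover have "odd x = odd y" using xy(3) by (simp add: e_def)
      ultimately show "x = y" by (metis dvd_mult_div_cancel odd_two_times_div_two_succ)
    qed
    have "(a, b) \<in> e ` {..<2 * ?n}" for a b
    proof -
      obtain i where i: "i < ?n" "q i = a" using q unfolding bij_betw_def by (metis UNIV_I imageE lessThan_iff)
      have "e (2 * i + of_bool b) = (a, b)" using i by (cases b) (auto simp: e_def)
      moreover have "2 * i + of_bool b < 2 * ?n" using i by (cases b) auto
      ultimately show ?thesis by (metis imageI lessThan_iff)
    qed
    then show "e ` {..<2 * ?n} = UNIV" by auto
  qed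
  have frame: "complex_frame k = real_frame (e k)" for k
    by (simp add: complex_frame_def real_frame_def e_def q_def)
  \<comment> \<open>A choice \<open>\<Phi> j = (a, s)\<close> selects the index \<open>a\<close> in
    the \<open>j\<close>-th factor, and \<open>s\<close> tells whether its two vectors enter
    \<open>dz\<^sub>a\<close> and \<open>\<theta>\<^sub>a\<close> in exchanged order, which turns
    the coefficient \<open>-\<i>\<close> into \<open>\<i>\<close>.\<close>
  define c where "c s = (if s then \<i> else - \<i>)" for s
  \<comment> \<open>Row \<open>(j, b)\<close> belongs to the first or second vector of the
    \<open>j\<close>-th factor as \<open>b\<close> is \<open>False\<close> or \<open>True\<close>;
    it receives \<open>dz\<close> or \<open>\<theta>\<close> with index
    \<open>fst (\<Phi> j)\<close>, according to the chosen order.\<close>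
  define \<rho> :: "('n \<Rightarrow> 'n \<times> bool) \<Rightarrow> 'n \<times> bool \<Rightarrow> 'n \<times> bool"
    where "\<rho> \<Phi> r = (fst (\<Phi> (fst r)), snd r \<noteq> snd (\<Phi> (fst r)))" for \<Phi> r
  define \<kappa> :: "('n \<Rightarrow> 'n \<times> bool) \<Rightarrow> complex" where
    "\<kappa> \<Phi> = (if inj (\<lambda>j. fst (\<Phi> j)) then (\<Prod>j\<in>UNIV. c (snd (\<Phi> j))) * of_int (sign (\<rho> \<Phi>)) else 0)" for \<Phi>
  define C where "C = (\<Sum>\<Phi>\<in>UNIV. \<kappa> \<Phi>) * det (coframe :: complex^('n \<times> bool)^('n \<times> bool)) / 2 ^ ?n"
  show ?thesis
  proof (rule that[of C])
    fix H :: "complex^'n^'n"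
    define \<omega> where "\<omega> u v = - \<i> * (\<Sum>j\<in>UNIV. \<Sum>k\<in>UNIV. H $ j $ k * (u $ j * cnj (v $ k) - v $ j * cnj (u $ k)))" for u v
    define \<theta> where "\<theta> a v = (\<Sum>k\<in>UNIV. H $ a $ k * cnj (v $ k))" for a v
    define Y :: "complex^('n \<times> bool)^('n \<times> bool)" where
      "Y = (\<chi> r s. if snd r then \<theta> (fst r) (real_frame s) else real_frame s $ fst r)"
    have \<omega>: "\<omega> u v = (\<Sum>as\<in>UNIV. c (snd as) * (if snd as then v else u) $ fst as * \<theta> (fst as) (if snd as then u else v))" for u v
      by (simp add: \<omega>_def \<theta>_def sum_UNIV_prod UNIV_bool c_def sum_distrib_left right_diff_distrib
          sum_subtractf sum_negf sum.distrib mult_ac)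
    have frames: "(\<Prod>i<?n. \<omega> (complex_frame (\<sigma> (2 * i))) (complex_frame (\<sigma> (2 * i + 1)))) =
      (\<Prod>j\<in>UNIV. \<omega> (real_frame (map_permutation {..<2 * ?n} e \<sigma> (j, False))) (real_frame (map_permutation {..<2 * ?n} e \<sigma> (j, True))))" for \<sigma>
    proof -
      let ?m = "map_permutation {..<2 * ?n} e \<sigma>"
      have "e (\<sigma> (2 * i)) = ?m (q i, False)" "e (\<sigma> (2 * i + 1)) = ?m (q i, True)" if "i < ?n" for i
      proof -
        have "e (2 * i) = (q i, False)" "e (2 * i + 1) = (q i, True)" by (auto simp: e_def)
        moreover have "2 * i \<in> {..<2 * ?n}" "2 * i + 1 \<in> {..<2 * ?n}" using that by auto
        ultimately show "e (\<sigma> (2 * i)) = ?m (q i, False)" "e (\<sigma> (2 * i + 1)) = ?m (q i, True)"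
          using map_permutation_apply[OF bij_betw_imp_inj_on[OF e]] by metis+
      qed
      then have "(\<Prod>i<?n. \<omega> (complex_frame (\<sigma> (2 * i))) (complex_frame (\<sigma> (2 * i + 1)))) =
        (\<Prod>i<?n. \<omega> (real_frame (?m (q i, False))) (real_frame (?m (q i, True))))"
        unfolding frame by (intro prod.cong refl) simp
      also have "\<dots> = (\<Prod>j\<in>UNIV. \<omega> (real_frame (?m (j, False))) (real_frame (?m (j, True))))"
        by (rule prod.reindex_bij_betw[OF q])
      finally show ?thesis .
    qed
    define X :: "('n \<Rightarrow> 'n \<times> bool) \<Rightarrow> complex^('n \<times> bool)^('n \<times> bool)" where
      "X \<Phi> = (\<chi> r. Y $ \<rho> \<Phi> r)" for \<Phi>
    have expand: "(\<Prod>j\<in>UNIV. \<omega> (real_frame (p (j, False))) (real_frame (p (j, True)))) =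
       (\<Sum>\<Phi>\<in>UNIV. (\<Prod>j\<in>UNIV. c (snd (\<Phi> j))) * (\<Prod>r\<in>UNIV. X \<Phi> $ r $ p r))" for p
    proof -
      have "(\<Prod>j\<in>UNIV. \<omega> (real_frame (p (j, False))) (real_frame (p (j, True)))) =
        (\<Sum>\<Phi>\<in>UNIV. \<Prod>j\<in>UNIV. c (snd (\<Phi> j)) * (if snd (\<Phi> j) then real_frame (p (j, True)) else real_frame (p (j, False))) $ fst (\<Phi> j)
          * \<theta> (fst (\<Phi> j)) (if snd (\<Phi> j) then real_frame (p (j, False)) else real_frame (p (j, True))))"
        unfolding \<omega> by (subst prod_sum_PiE) (auto simp: PiE_UNIV_domain)
      also have "\<dots> = (\<Sum>\<Phi>\<in>UNIV. (\<Prod>j\<in>UNIV. c (snd (\<Phi> j))) * (\<Prod>r\<in>UNIV. X \<Phi> $ r $ p r))"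
      proof (rule sum.cong[OF refl])
        fix \<Phi> :: "'n \<Rightarrow> 'n \<times> bool"
        have "(\<Prod>r\<in>UNIV. X \<Phi> $ r $ p r) = (\<Prod>j\<in>UNIV. \<Prod>b\<in>UNIV. X \<Phi> $ (j, b) $ p (j, b))"
          by (simp add: prod.cartesian_product UNIV_Times_UNIV[symmetric] del: UNIV_Times_UNIV)
        also have "\<dots> = (\<Prod>j\<in>UNIV. (if snd (\<Phi> j) then real_frame (p (j, True)) else real_frame (p (j, False))) $ fst (\<Phi> j)
          * \<theta> (fst (\<Phi> j)) (if snd (\<Phi> j) then real_frame (p (j, False)) else real_frame (p (j, True))))"
          by (rule prod.cong[OF refl]) (auto simp: UNIV_bool X_def Y_def \<rho>_def)
        finally show "(\<Prod>j\<in>UNIV. c (snd (\<Phi> j)) * (if snd (\<Phi> j) then real_frame (p (j, True)) else real_frame (p (j, False))) $ fst (\<Phi> j)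
          * \<theta> (fst (\<Phi> j)) (if snd (\<Phi> j) then real_frame (p (j, False)) else real_frame (p (j, True)))) =
          (\<Prod>j\<in>UNIV. c (snd (\<Phi> j))) * (\<Prod>r\<in>UNIV. X \<Phi> $ r $ p r)"
          by (simp add: prod.distrib mult.assoc)
      qed
      finally show ?thesis .
    qed
    have detX: "(\<Prod>j\<in>UNIV. c (snd (\<Phi> j))) * det (X \<Phi>) = \<kappa> \<Phi> * det Y" for \<Phi>
    proof (cases "inj (\<lambda>j. fst (\<Phi> j))")
      case True
      have "inj (\<rho> \<Phi>)"
      proof (rule injI)
        fix r s assume "\<rho> \<Phi> r = \<rho> \<Phi> s"
        then have 1: "fst (\<Phi> (fst r)) = fst (\<Phi> (fst s))" "(snd r \<noteq> snd (\<Phi> (fst r))) = (snd s \<noteq> snd (\<Phi> (fst s)))"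
          by (auto simp: \<rho>_def)
        then have "fst r = fst s" using True by (auto dest: injD)
        then show "r = s" using 1(2) by (cases r; cases s) auto
      qed
      then have "bij (\<rho> \<Phi>)" using finite_UNIV_inj_surj[OF finite] by (simp add: bij_def)
      then have "\<rho> \<Phi> permutes UNIV" by (rule bij_imp_permutes) simp
      from det_permute_rows[OF this, of Y] show ?thesis using True by (simp add: X_def \<kappa>_def)
    next
      case False
      then obtain i j where ij: "fst (\<Phi> i) = fst (\<Phi> j)" "i \<noteq> j" by (auto simp: inj_def)
      have "det (X \<Phi>) = 0"
      proof (rule det_identical_rows)
        show "(i, snd (\<Phi> i)) \<noteq> (j, snd (\<Phi> j))" using ij by simp
        show "row (i, snd (\<Phi> i)) (X \<Phi>) = row (j, snd (\<Phi> j)) (X \<Phi>)"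
          using ij by (simp add: row_def X_def \<rho>_def)
      qed
      then show ?thesis using False by (simp add: \<kappa>_def)
    qed
    have "(\<Sum>\<sigma> | \<sigma> permutes {..<2 * ?n}. of_int (sign \<sigma>) *
        (\<Prod>i<?n. \<omega> (complex_frame (\<sigma> (2 * i))) (complex_frame (\<sigma> (2 * i + 1))))) =
      (\<Sum>\<sigma> | \<sigma> permutes {..<2 * ?n}. of_int (sign (map_permutation {..<2 * ?n} e \<sigma>)) *
      (\<Prod>j\<in>UNIV. \<omega> (real_frame (map_permutation {..<2 * ?n} e \<sigma> (j, False))) (real_frame (map_permutation {..<2 * ?n} e \<sigma> (j, True)))))"
      unfolding frames by (intro sum.cong refl) (simp add: sign_map_permutation[OF bij_betw_imp_inj_on[OF e]])
    also have "\<dots> = (\<Sum>p | p permutes UNIV. of_int (sign p) *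
        (\<Prod>j\<in>UNIV. \<omega> (real_frame (p (j, False))) (real_frame (p (j, True)))))"
      by (rule sum_permutes_reindex[OF e, symmetric]) simp
    also have "\<dots> = (\<Sum>\<Phi>\<in>UNIV. (\<Prod>j\<in>UNIV. c (snd (\<Phi> j))) * det (X \<Phi>))"
      unfolding expand det_def sum_distrib_left
      by (subst sum.swap) (simp add: mult_ac)
    also have "\<dots> = (\<Sum>\<Phi>\<in>UNIV. \<kappa> \<Phi>) * det Y" by (simp add: detX sum_distrib_right)
    also have "det Y = det H * det (coframe :: complex^('n \<times> bool)^('n \<times> bool))"
      unfolding Y_def \<theta>_def by (rule alternating_sum_det)
    finally show "wedge_power CARD('n) (\<lambda>u v. - \<i> * (\<Sum>j\<in>UNIV. \<Sum>k\<in>UNIV.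
      H $ j $ k * (u $ j * cnj (v $ k) - v $ j * cnj (u $ k)))) complex_frame = C * det H"
      unfolding wedge_power_def \<omega>_def[symmetric] by (simp add: C_def)
  qed
qed

section \<open>The real determinant of a complex-linear map\<close>

definition real_matrix :: "complex^'n^'n \<Rightarrow> real^('n \<times> bool)^('n \<times> bool)" where
  "real_matrix A = (\<chi> r s. (if snd r then Im else Re) ((A *v real_frame s) $ fst r))"

lemma det_coframe_nonzero: "det (coframe :: complex^('n::finite \<times> bool)^('n \<times> bool)) \<noteq> 0"
proof -
  \<comment> \<open>The inverse of \<open>coframe\<close>: it expresses
    \<open>x = (z + \<zeta>) / 2\<close> and
    \<open>y = (- \<i> z + \<i> \<zeta>) / 2\<close>.\<close>
  define U' :: "complex^('n \<times> bool)^('n \<times> bool)" where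
    "U' = (\<chi> r s. if fst r = fst s then (if snd r then (if snd s then \<i>/2 else -\<i>/2) else 1/2) else 0)"
  have "coframe ** U' = mat 1"
    by (auto simp: vec_eq_iff matrix_matrix_mult_def coframe_def real_frame_def U'_def sum_UNIV_prod
      UNIV_bool mat_def axis_def sum.distrib if_distrib[of "\<lambda>x. x * _"] if_distrib[of "\<lambda>x. _ * x"] if_distrib[of cnj] cong: if_cong)
  from arg_cong[OF this, of det]
  have "det (coframe :: complex^('n \<times> bool)^('n \<times> bool)) * det U' = 1" by (simp add: det_mul)
  then show ?thesis by auto
qed

lemma det_of_real: "det (\<chi> i j. complex_of_real (A $ i $ j)) = complex_of_real (det A)"
  by (simp add: det_def)

lemma det_cnj: "det (\<chi> i j. cnj (A $ i $ j)) = cnj (det A)"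
  by (simp add: det_def)

text \<open>In the coframe of \<open>dz\<close> and its conjugates the real map becomes block
  diagonal with blocks \<open>A\<close> and its conjugate; the invertible factor
  \<open>coframe\<close> cancels.\<close>

lemma det_real_matrix: "det (real_matrix (A :: complex^'n^'n)) = (cmod (det A))\<^sup>2"
proof -
  let ?R = "(\<chi> i j. complex_of_real (real_matrix A $ i $ j))"
  let ?cA = "\<chi> i j. cnj (A $ i $ j)"
  have axis: "(\<Sum>k\<in>UNIV. (\<Sum>b\<in>UNIV. coframe $ r $ (k, b) * complex_of_real (g k b))) =
      (if snd r then cnj (Complex (g (fst r) False) (g (fst r) True)) else Complex (g (fst r) False) (g (fst r) True))" for r :: "'n \<times> bool" and g
    by (auto simp: UNIV_bool coframe_def real_frame_def axis_def sum.distrib if_distrib[of "\<lambda>x. x * _"] if_distrib[of cnj] Complex_eq cong: if_cong)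
  have L: "(coframe ** ?R) $ r $ s = (if snd r then cnj ((A *v real_frame s) $ fst r) else (A *v real_frame s) $ fst r)" for r s
  proof -
    have "(coframe ** ?R) $ r $ s = (\<Sum>k\<in>UNIV. (\<Sum>b\<in>UNIV. coframe $ r $ (k, b) * complex_of_real (real_matrix A $ (k, b) $ s)))"
      by (simp add: matrix_matrix_mult_def sum_UNIV_prod)
    then show ?thesis unfolding axis by (simp add: real_matrix_def)
  qed
  have "coframe ** ?R = block_at False A ** (block_at True ?cA ** coframe)"
    unfolding vec_eq_iff L
    by (auto simp: block_at_mult_row coframe_def matrix_vector_mult_def)
  from arg_cong[OF this, of det]
  have "det (coframe :: complex^('n \<times> bool)^('n \<times> bool)) * det ?R = det A * (det ?cA * det (coframe :: complex^('n \<times> bool)^('n \<times> bool)))"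
    by (simp only: det_mul det_block_at)
  then have "complex_of_real (det (real_matrix A)) = det A * cnj (det A)"
    using det_coframe_nonzero[where 'n = 'n] by (simp add: det_of_real det_cnj)
  also have "\<dots> = complex_of_real ((cmod (det A))\<^sup>2)" by (rule complex_norm_square[symmetric])
  finally show ?thesis by (simp only: of_real_eq_iff)
qed

section \<open>Change of variables for biholomorphic maps\<close>

text \<open>\<open>real_frame\<close> enumerates the standard basis, so boxes correspond to boxes
  with the same side lengths, and the volumes of boxes determine Lebesgue measure.\<close>

lemma lborel_distr_real_coordinates:
  fixes b :: "'m::finite \<Rightarrow> 'n::finite \<times> bool"
  assumes b: "bij b"
  defines "\<Lambda> \<equiv> \<lambda>x :: real^'m. (\<Sum>i\<in>UNIV. x $ i *\<^sub>R real_frame (b i) :: complex^'n)"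
  shows "distr lborel borel \<Lambda> = lborel"
proof (rule lborel_eqI[symmetric])
  have [measurable]: "\<Lambda> \<in> borel \<rightarrow>\<^sub>M borel"
    unfolding \<Lambda>_def by (intro borel_measurable_continuous_onI continuous_intros)
  have Basis: "(Basis :: (complex^'n) set) = real_frame ` UNIV"
  proof
    have "axis i 1 = (real_frame (i, False) :: complex^'n)" "axis i \<i> = (real_frame (i, True) :: complex^'n)" for i
      by (simp_all add: real_frame_def)
    then show "(Basis :: (complex^'n) set) \<subseteq> real_frame ` UNIV"
      by (auto simp: Basis_vec_def Basis_complex_def)
    show "real_frame ` UNIV \<subseteq> (Basis :: (complex^'n) set)"
      by (auto simp: real_frame_def Basis_vec_def Basis_complex_def)
  qed
  have inj: "inj (real_frame :: 'n \<times> bool \<Rightarrow> complex^'n)"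
    by (rule injI) (auto simp: real_frame_def axis_eq_axis split: if_splits)
  have inner: "real_frame r \<bullet> (real_frame s :: complex^'n) = (if r = s then 1 else 0)" for r s
    using inj by (auto simp: inner_Basis Basis dest: injD)
  have inner\<Lambda>: "\<Lambda> x \<bullet> real_frame (b i) = x $ i" for x i
    using b by (simp add: \<Lambda>_def inner_sum_left inner inj_eq[OF bij_is_inj] if_distrib[of "\<lambda>x. _ * x"] cong: if_cong)
  have surj: "\<exists>i. r = b i" for r using b by (metis bij_pointE)
  fix l u :: "complex^'n" assume le: "\<And>b. b \<in> Basis \<Longrightarrow> l \<bullet> b \<le> u \<bullet> b"
  define l' u' :: "real^'m" where "l' = (\<chi> i. l \<bullet> real_frame (b i))" and "u' = (\<chi> i. u \<bullet> real_frame (b i))"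
  have "\<Lambda> -` box l u = box l' u'"
  proof (rule set_eqI)
    fix x
    have "x \<in> \<Lambda> -` box l u \<longleftrightarrow> (\<forall>r. l \<bullet> real_frame r < \<Lambda> x \<bullet> real_frame r \<and> \<Lambda> x \<bullet> real_frame r < u \<bullet> real_frame r)"
      by (auto simp: mem_box Basis)
    also have "\<dots> \<longleftrightarrow> (\<forall>i. l' $ i < x $ i \<and> x $ i < u' $ i)"
      unfolding l'_def u'_def vec_lambda_beta using inner\<Lambda> surj by metis
    also have "\<dots> \<longleftrightarrow> x \<in> box l' u'" by (simp add: mem_box_cart)
    finally show "x \<in> \<Lambda> -` box l u \<longleftrightarrow> x \<in> box l' u'" .
  qed
  then have "emeasure (distr lborel borel \<Lambda>) (box l u) = emeasure lborel (box l' u')"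
    by (subst emeasure_distr) auto
  also have "\<dots> = (\<Prod>b\<in>Basis. (u' - l') \<bullet> b)"
  proof (rule emeasure_lborel_box)
    have le': "l \<bullet> real_frame r \<le> u \<bullet> real_frame r" for r using le Basis by blast
    fix c :: "real^'m" assume "c \<in> Basis"
    then obtain i where "c = axis i 1" by (auto simp: Basis_vec_def)
    then show "l' \<bullet> c \<le> u' \<bullet> c" using le'[of "b i"] by (simp add: inner_axis l'_def u'_def)
  qed
  also have "(\<Prod>b\<in>Basis. (u' - l') \<bullet> b) = (\<Prod>i\<in>UNIV. (u - l) \<bullet> real_frame (b i))"
  proof -
    have Basis': "(Basis :: (real^'m) set) = (\<lambda>i. axis i 1) ` UNIV" by (auto simp: Basis_vec_def)
    have inj': "inj (\<lambda>i. axis i 1 :: real^'m)" by (rule injI) (simp add: axis_eq_axis)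
    show ?thesis
      unfolding Basis' prod.reindex[OF inj'] by (simp add: inner_axis l'_def u'_def inner_diff_left)
  qed
  also have "\<dots> = (\<Prod>r\<in>UNIV. (u - l) \<bullet> real_frame r)"
    by (rule prod.reindex_bij_betw[OF b])
  also have "\<dots> = (\<Prod>b\<in>Basis. (u - l) \<bullet> b)"
    using inj by (simp add: Basis prod.reindex)
  finally show "emeasure (distr lborel borel \<Lambda>) (box l u) = (\<Prod>b\<in>Basis. (u - l) \<bullet> b)" .
qed simp

text \<open>The type \<open>'n bit0\<close> has twice the cardinality of \<open>'n\<close> and is well-ordered, as the change of
  variables theorem of the library demands.\<close>

lemma lborel_distr_biholomorphic:
  fixes \<gamma> :: "complex^'n \<Rightarrow> complex^'n"
  assumes bij: "bij \<gamma>" and hol: "holomorphic_map_on \<gamma> UNIV"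
  shows "distr (density lborel (\<lambda>z. ennreal ((cmod (det (complex_jacobian \<gamma> z)))\<^sup>2))) borel \<gamma> = lborel"
proof (rule lborel_eqI[symmetric])
  let ?J = "\<lambda>z. (cmod (det (complex_jacobian \<gamma> z)))\<^sup>2"
  have "\<exists>b :: 'n bit0 \<Rightarrow> 'n \<times> bool. bij b"
    by (rule finite_same_card_bij[of UNIV UNIV, simplified]) (simp_all add: card_cartesian_product[of UNIV UNIV, simplified])
  then obtain b :: "'n bit0 \<Rightarrow> 'n \<times> bool" where b: "bij b" ..
  define \<Lambda> :: "real^'n bit0 \<Rightarrow> complex^'n" where "\<Lambda> x = (\<Sum>i\<in>UNIV. x $ i *\<^sub>R real_frame (b i))" for x
  define \<Lambda>' :: "complex^'n \<Rightarrow> real^'n bit0" where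
    "\<Lambda>' v = (\<chi> i. (if snd (b i) then Im else Re) (v $ fst (b i)))" for v
  have distr: "distr lborel borel \<Lambda> = lborel" unfolding \<Lambda>_def[abs_def] by (rule lborel_distr_real_coordinates[OF b])
  have lin: "bounded_linear \<Lambda>" unfolding \<Lambda>_def[abs_def]
    by (intro bounded_linear_sum bounded_linear_compose[OF bounded_linear_scaleR_left] bounded_linear_vec_nth)
  have lin': "linear \<Lambda>'" by (rule linearI) (auto simp: \<Lambda>'_def vec_eq_iff)
  then have blin': "bounded_linear \<Lambda>'" by (simp add: linear_conv_bounded_linear)
  have \<Lambda>_nth: "\<Lambda> x $ j = Complex (x $ inv b (j, False)) (x $ inv b (j, True))" for x j
  proof -
    have "\<Lambda> x = (\<Sum>r\<in>UNIV. x $ inv b r *\<^sub>R real_frame r)"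
      unfolding \<Lambda>_def using sum.reindex_bij_betw[OF b, of "\<lambda>r. x $ inv b r *\<^sub>R real_frame r"] b
      by (simp add: bij_is_inj inv_f_f)
    then show ?thesis
      by (simp add: sum_UNIV_prod UNIV_bool real_frame_def axis_def complex_eq_iff sum.distrib
          if_distrib[of "\<lambda>x. _ *\<^sub>R x"] if_distrib[of Re] if_distrib[of Im] cong: if_cong)
  qed
  have inv1: "\<Lambda>' (\<Lambda> x) = x" for x
  proof -
    have "\<Lambda>' (\<Lambda> x) $ i = x $ i" for i
    proof -
      have "inv b (b i) = i" using b by (simp add: bij_is_inj)
      then show ?thesis by (cases "b i") (auto simp: \<Lambda>'_def \<Lambda>_nth)
    qed
    then show ?thesis by (simp add: vec_eq_iff)
  qed
  have inv2: "\<Lambda> (\<Lambda>' v) = v" for v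
    using b by (simp add: vec_eq_iff \<Lambda>_nth \<Lambda>'_def bij_is_surj surj_f_inv_f)
  have [measurable]: "\<Lambda> \<in> borel \<rightarrow>\<^sub>M borel" "\<Lambda>' \<in> borel \<rightarrow>\<^sub>M borel"
    using lin blin' by (auto intro!: borel_measurable_continuous_onI linear_continuous_on)
  have cont: "continuous_on UNIV \<gamma>" using hol holomorphic_map_on_continuous by blast
  then have [measurable]: "\<gamma> \<in> borel \<rightarrow>\<^sub>M borel" by (rule borel_measurable_continuous_onI)
  have "continuous_on UNIV (\<lambda>z. det (complex_jacobian \<gamma> z))"
    by (intro hol_on_continuous hol_on_det hol_on_jacobian hol) simp
  then have "continuous_on UNIV ?J" by (intro continuous_intros)
  then have [measurable]: "?J \<in> borel_measurable borel" by (rule borel_measurable_continuous_onI)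
  define g where "g x = \<Lambda>' (\<gamma> (\<Lambda> x))" for x
  define g' where "g' x v = \<Lambda>' (complex_jacobian \<gamma> (\<Lambda> x) *v \<Lambda> v)" for x v
  have g': "(g has_derivative g' x) (at x)" for x
  proof -
    have "(\<gamma> has_derivative (*v) (complex_jacobian \<gamma> (\<Lambda> x))) (at (\<Lambda> x))"
      using holomorphic_map_derivative(1)[OF hol, of "\<Lambda> x"]
      unfolding ext[OF complex_jacobian_holomorphic[OF hol, of "\<Lambda> x"], simplified] by simp
    from has_derivative_compose[OF bounded_linear_imp_has_derivative[OF lin] this]
    show ?thesis unfolding g_def[abs_def] g'_def[abs_def]
      by (rule bounded_linear.has_derivative[OF blin'])
  qed
  have det: "\<bar>det (matrix (g' x))\<bar> = ?J (\<Lambda> x)" for x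
  proof -
    have "matrix (g' x) = (\<chi> i k. real_matrix (complex_jacobian \<gamma> (\<Lambda> x)) $ b i $ b k)"
    proof -
      have LA: "\<Lambda> (axis k 1) = real_frame (b k)" for k
        by (simp add: \<Lambda>_def axis_def if_distrib[of "\<lambda>x. x *\<^sub>R _"] cong: if_cong)
      show ?thesis unfolding matrix_def g'_def LA by (simp add: vec_eq_iff \<Lambda>'_def real_matrix_def)
    qed
    then have "det (matrix (g' x)) = ?J (\<Lambda> x)" by (simp add: det_reindex[OF b] det_real_matrix)
    then show ?thesis by simp
  qed
  fix l u :: "complex^'n" assume le: "\<And>b. b \<in> Basis \<Longrightarrow> l \<bullet> b \<le> u \<bullet> b"
  define B where "B = \<Lambda> -` box l u"
  have B: "open B" unfolding B_def using lin by (intro open_vimage linear_continuous_on) auto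
  have emB: "emeasure lborel B = (\<Prod>b\<in>Basis. (u - l) \<bullet> b)"
  proof -
    have "emeasure lborel B = emeasure (distr lborel borel \<Lambda>) (box l u)"
      unfolding B_def by (subst emeasure_distr) auto
    also have "\<dots> = (\<Prod>b\<in>Basis. (u - l) \<bullet> b)" using le by (simp add: distr)
    finally show ?thesis .
  qed
  define S where "S = g -` B"
  have contg: "continuous_on UNIV g" using g' by (meson has_derivative_continuous continuous_at_imp_continuous_on)
  have S: "open S" unfolding S_def using B contg by (rule open_vimage)
  have surjg: "surj g" "inj g"
  proof -
    show "surj g" unfolding surj_def g_def using bij inv1 inv2 by (metis bij_pointE)
    show "inj g" unfolding inj_def g_def using bij inv1 inv2 by (metis bij_is_inj injD)
  qed
  have gS: "g ` S = B" unfolding S_def using surjg(1) by (rule surj_image_vimage_eq)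
  have memb: "\<gamma> (\<Lambda> x) \<in> box l u \<longleftrightarrow> x \<in> S" for x
    by (simp add: S_def B_def g_def inv2)
  have fin: "emeasure lborel B < \<infinity>" unfolding emB by simp
  have "B \<in> lmeasurable" using B fin by (simp add: fmeasurable_def)
  \<comment> \<open>The image of \<open>S\<close> under \<open>g\<close> is \<open>B\<close>, of
    finite measure, so the change of variables theorem yields integrability of the Jacobian over
    \<open>S\<close> along with its integral.\<close>
  have "((\<lambda>x. \<bar>det (matrix (g' x))\<bar>) has_integral measure lebesgue B) S"
  proof (subst has_measure_differentiable_image[symmetric])
    show "S \<in> sets lebesgue" using S by simp
    show "(g has_derivative g' x) (at x within S)" for x using g' by (rule has_derivative_at_withinI)
    show "inj_on g S" using surjg(2) by (rule inj_on_subset) simp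
    show "g ` S \<in> lmeasurable \<and> measure lebesgue (g ` S) = measure lebesgue B"
      using \<open>B \<in> lmeasurable\<close> gS by simp
  qed
  from nn_integral_has_integral_lebesgue'[OF _ this]
  have int: "(\<integral>\<^sup>+ x. ennreal (?J (\<Lambda> x)) * indicator S x \<partial>lborel) = ennreal (measure lebesgue B)"
    by (simp add: det)
  have "emeasure (distr (density lborel (\<lambda>z. ennreal (?J z))) borel \<gamma>) (box l u) =
      (\<integral>\<^sup>+ z. ennreal (?J z) * indicator (\<gamma> -` box l u) z \<partial>lborel)"
    using measurable_sets_borel[OF \<open>\<gamma> \<in> borel \<rightarrow>\<^sub>M borel\<close>, of "box l u"]
    by (subst emeasure_distr) (auto simp: emeasure_density)
  also have "\<dots> = (\<integral>\<^sup>+ z. ennreal (?J z) * indicator (\<gamma> -` box l u) z \<partial>(distr lborel borel \<Lambda>))"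
    by (simp only: distr)
  also have "\<dots> = (\<integral>\<^sup>+ x. ennreal (?J (\<Lambda> x)) * indicator (\<gamma> -` box l u) (\<Lambda> x) \<partial>lborel)"
    by (subst nn_integral_distr) auto
  also have "\<dots> = (\<integral>\<^sup>+ x. ennreal (?J (\<Lambda> x)) * indicator S x \<partial>lborel)"
    by (intro nn_integral_cong) (simp add: indicator_def memb)
  also have "\<dots> = emeasure lborel B"
    unfolding int using B fin by (simp add: emeasure_eq_ennreal_measure)
  finally show "emeasure (distr (density lborel (\<lambda>z. ennreal (?J z))) borel \<gamma>) (box l u) = (\<Prod>b\<in>Basis. (u - l) \<bullet> b)"
    unfolding emB .
qed simp

section \<open>Integrals over fundamental domains of a contraction\<close>

context
  fixes \<gamma> :: "complex^'n \<Rightarrow> complex^'n"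
  assumes \<gamma>: "biholomorphic_contraction \<gamma>"
begin

private abbreviation "pw \<equiv> int_iterate \<gamma>"
private abbreviation "pr \<equiv> hopf_proj \<gamma>"
private abbreviation "\<kappa> z \<equiv> (cmod (det (complex_jacobian \<gamma> z)))\<^sup>2"

lemma jacobian_measurable [measurable]: "\<kappa> \<in> borel_measurable borel"
  and contraction_measurable [measurable]: "\<gamma> \<in> borel \<rightarrow>\<^sub>M borel"
proof -
  have hol: "holomorphic_map_on \<gamma> UNIV" using \<gamma> by (simp add: biholomorphic_contraction_def)
  have "continuous_on UNIV (\<lambda>z. det (complex_jacobian \<gamma> z))"
    by (intro hol_on_continuous hol_on_det hol_on_jacobian hol) simp
  then have "continuous_on UNIV \<kappa>" by (intro continuous_intros)
  then show "\<kappa> \<in> borel_measurable borel" by (rule borel_measurable_continuous_onI)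
  show "\<gamma> \<in> borel \<rightarrow>\<^sub>M borel"
    using hol holomorphic_map_on_continuous by (blast intro: borel_measurable_continuous_onI)
qed

lemma lborel_contraction: "distr (density lborel (\<lambda>z. ennreal (\<kappa> z))) borel \<gamma> = lborel"
  using \<gamma> by (intro lborel_distr_biholomorphic) (auto simp: biholomorphic_contraction_def)

lemma integral_contraction:
  fixes f :: "complex^'n \<Rightarrow> complex"
  assumes [measurable]: "f \<in> borel_measurable borel"
  shows "integral\<^sup>L lborel (\<lambda>z. \<kappa> z *\<^sub>R f (\<gamma> z)) = integral\<^sup>L lborel f"
    and "integrable lborel (\<lambda>z. \<kappa> z *\<^sub>R f (\<gamma> z)) \<longleftrightarrow> integrable lborel f"
proof -
  have "integral\<^sup>L lborel f = integral\<^sup>L (distr (density lborel (\<lambda>z. ennreal (\<kappa> z))) borel \<gamma>) f"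
    by (simp only: lborel_contraction)
  also have "\<dots> = integral\<^sup>L lborel (\<lambda>z. \<kappa> z *\<^sub>R f (\<gamma> z))"
    by (simp add: integral_distr integral_density)
  finally show "integral\<^sup>L lborel (\<lambda>z. \<kappa> z *\<^sub>R f (\<gamma> z)) = integral\<^sup>L lborel f" ..
  have "integrable lborel f \<longleftrightarrow> integrable (distr (density lborel (\<lambda>z. ennreal (\<kappa> z))) borel \<gamma>) f"
    by (simp only: lborel_contraction)
  also have "\<dots> \<longleftrightarrow> integrable lborel (\<lambda>z. \<kappa> z *\<^sub>R f (\<gamma> z))"
    by (simp add: integrable_distr_eq integrable_density)
  finally show "integrable lborel (\<lambda>z. \<kappa> z *\<^sub>R f (\<gamma> z)) \<longleftrightarrow> integrable lborel f" ..
qed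

lemma iterate_image_borel: "A \<in> sets borel \<Longrightarrow> pw k ` A \<in> sets borel"
  unfolding hopf_iterate_image[OF \<gamma>]
  using measurable_sets_borel[OF borel_measurable_continuous_onI[OF continuous_int_iterate[OF \<gamma>]]] by simp

lemma pw_succ: "pw (k + 1) z = \<gamma> (pw k z)" "pw (1 + k) z = \<gamma> (pw k z)" "pw k (\<gamma> z) = \<gamma> (pw k z)"
proof -
  show 1: "pw (k + 1) z = \<gamma> (pw k z)" using int_iterate_succ[OF contraction_bij[OF \<gamma>], of k] by simp
  then show "pw (1 + k) z = \<gamma> (pw k z)" by (simp add: add.commute)
  show "pw k (\<gamma> z) = \<gamma> (pw k z)"
    using hopf_iterate_add[OF \<gamma>, of k 1 z] 1 by simp
qed

lemma iterate_image_succ: "pw (k + 1) ` A = \<gamma> ` (pw k ` A)"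
  by (auto simp: pw_succ image_image)

section \<open>Densities of invariant forms of top degree\<close>

context
  fixes \<Psi> :: "complex^'n \<Rightarrow> complex"
  assumes meas [measurable]: "\<Psi> \<in> borel_measurable borel"
    and inv: "\<And>z. \<Psi> z = \<kappa> z *\<^sub>R \<Psi> (\<gamma> z)"
begin

text \<open>The measure with density \<open>norm (\<Psi> z)\<close> is invariant. This nonnegative
  version serves to establish integrability over a fundamental domain.\<close>

lemma nn_integral_invariant:
  assumes A: "A \<in> sets borel"
  shows "(\<integral>\<^sup>+ z. ennreal (norm (\<Psi> z)) * indicator (pw k ` A) z \<partial>lborel) =
    (\<integral>\<^sup>+ z. ennreal (norm (\<Psi> z)) * indicator A z \<partial>lborel)"
proof -
  have step: "(\<integral>\<^sup>+ z. ennreal (norm (\<Psi> z)) * indicator (\<gamma> ` A) z \<partial>lborel) =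
    (\<integral>\<^sup>+ z. ennreal (norm (\<Psi> z)) * indicator A z \<partial>lborel)" if [measurable]: "A \<in> sets borel" for A
  proof -
    have [measurable]: "\<gamma> ` A \<in> sets borel" using iterate_image_borel[OF that, of 1] by simp
    have ind: "indicator (\<gamma> ` A) (\<gamma> z) = (indicator A z :: ennreal)" for z
      using contraction_bij[OF \<gamma>] by (auto simp: indicator_def bij_is_inj inj_image_mem_iff)
    have "(\<integral>\<^sup>+ z. ennreal (norm (\<Psi> z)) * indicator (\<gamma> ` A) z \<partial>lborel) =
      (\<integral>\<^sup>+ z. ennreal (norm (\<Psi> z)) * indicator (\<gamma> ` A) z \<partial>(distr (density lborel (\<lambda>z. ennreal (\<kappa> z))) borel \<gamma>))"
      by (simp only: lborel_contraction)
    also have "\<dots> = (\<integral>\<^sup>+ z. ennreal (\<kappa> z) * (ennreal (norm (\<Psi> (\<gamma> z))) * indicator A z) \<partial>lborel)"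
      by (simp add: nn_integral_distr nn_integral_density ind)
    also have "\<dots> = (\<integral>\<^sup>+ z. ennreal (norm (\<Psi> z)) * indicator A z \<partial>lborel)"
      by (subst inv) (simp add: ennreal_mult mult.assoc)
    finally show ?thesis .
  qed
  show ?thesis
  proof (induction k rule: int_induct[where k = 0])
    case base
    then show ?case by simp
  next
    case (step1 i)
    then show ?case unfolding iterate_image_succ using step[OF iterate_image_borel[OF A, of i]] by simp
  next
    case (step2 i)
    then show ?case using step[OF iterate_image_borel[OF A, of "i - 1"]] iterate_image_succ[of "i - 1" A] by simp
  qed
qed

lemma integral_invariant:
  fixes g :: "complex^'n \<Rightarrow> real"
  assumes A: "A \<in> sets borel" and g: "g \<in> borel_measurable borel"
  shows "integral\<^sup>L lborel (\<lambda>z. indicator (pw k ` A) z *\<^sub>R (g z *\<^sub>R \<Psi> z)) =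
    integral\<^sup>L lborel (\<lambda>z. indicator A z *\<^sub>R (g (pw k z) *\<^sub>R \<Psi> z))"
proof -
  have step: "integral\<^sup>L lborel (\<lambda>z. indicator (\<gamma> ` A) z *\<^sub>R (g z *\<^sub>R \<Psi> z)) =
    integral\<^sup>L lborel (\<lambda>z. indicator A z *\<^sub>R (g (\<gamma> z) *\<^sub>R \<Psi> z))"
    if [measurable]: "A \<in> sets borel" "g \<in> borel_measurable borel" for A and g :: "complex^'n \<Rightarrow> real"
  proof -
    have [measurable]: "\<gamma> ` A \<in> sets borel" using iterate_image_borel[OF that(1), of 1] by simp
    have ind: "indicator (\<gamma> ` A) (\<gamma> z) = (indicator A z :: real)" for z
      using contraction_bij[OF \<gamma>] by (auto simp: indicator_def bij_is_inj inj_image_mem_iff)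
    have "integral\<^sup>L lborel (\<lambda>z. indicator (\<gamma> ` A) z *\<^sub>R (g z *\<^sub>R \<Psi> z)) =
       integral\<^sup>L lborel (\<lambda>z. \<kappa> z *\<^sub>R (indicator (\<gamma> ` A) (\<gamma> z) *\<^sub>R (g (\<gamma> z) *\<^sub>R \<Psi> (\<gamma> z))))"
      by (rule integral_contraction(1)[symmetric]) measurable
    also have "\<dots> = integral\<^sup>L lborel (\<lambda>z. indicator A z *\<^sub>R (g (\<gamma> z) *\<^sub>R \<Psi> z))"
      by (subst inv) (simp add: ind mult_ac)
    finally show ?thesis .
  qed
  have [measurable]: "pw k \<in> borel \<rightarrow>\<^sub>M borel" for k
    using borel_measurable_continuous_onI[OF continuous_int_iterate[OF \<gamma>]] .
  show ?thesis using g
  proof (induction k arbitrary: g rule: int_induct[where k = 0])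
    case base
    then show ?case by simp
  next
    case (step1 i)
    have [measurable]: "g \<in> borel_measurable borel" by fact
    have "(\<lambda>z. g (\<gamma> z)) \<in> borel_measurable borel" by measurable
    from step1.IH[OF this] show ?case
      unfolding iterate_image_succ step[OF iterate_image_borel[OF A] step1.prems] by (simp add: pw_succ)
  next
    case (step2 i)
    have [measurable]: "g \<in> borel_measurable borel" by fact
    \<comment> \<open>Shifting the weight back by one step turns the claim for \<open>i\<close> and
      \<open>g'\<close> into the claim for \<open>i - 1\<close> and \<open>g\<close>.\<close>
    define g' where "g' z = g (pw (-1) z)" for z
    have g': "g' \<in> borel_measurable borel" unfolding g'_def by measurable
    have 1: "g' (\<gamma> z) = g z" for z
      using hopf_iterate_cancel(1)[OF \<gamma>, of 1 z] by (simp add: g'_def)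
    have 2: "g' (pw i z) = g (pw (i - 1) z)" for z
      using hopf_iterate_add[OF \<gamma>, of "-1" i z] by (simp add: g'_def)
    show ?case
      using step2.IH[OF g'] step[OF iterate_image_borel[OF A, of "i - 1"] g'] iterate_image_succ[of "i - 1" A]
      by (simp add: 1 2)
  qed
qed

section \<open>Borel fundamental domains and the telescoping cutoff\<close>

context
  fixes D :: "(complex^'n) set"
  assumes D: "D \<in> sets borel" "0 \<notin> D" "inj_on pr D" "pr ` D = pr ` (- {0})"
    and loc: "\<And>K. compact K \<Longrightarrow> 0 \<notin> K \<Longrightarrow> set_integrable lborel K \<Psi>"
begin

lemma tiles_disjoint:
  assumes "j \<noteq> k" shows "pw j ` D \<inter> pw k ` D = {}"
proof (rule ccontr)
  assume "\<not> ?thesis"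
  then obtain x y where xy: "x \<in> D" "y \<in> D" "pw j x = pw k y" by blast
  then have nz: "x \<noteq> 0" "y \<noteq> 0" using D(2) by auto
  have "y = pw (j - k) x"
    using hopf_iterate_cancel(1)[OF \<gamma>, of k y] xy(3) hopf_iterate_add[OF \<gamma>, of "-k" j x]
    by simp
  then have "pr x = pr y" using hopf_proj_eq_iff[OF \<gamma> nz] by blast
  then have "x = y" using D(3) xy(1,2) by (auto dest: inj_onD)
  then have "j - k = 0" using hopf_iterate_free[OF \<gamma> nz(1)] \<open>y = pw (j - k) x\<close> by metis
  then show False using assms by simp
qed

lemma tiles_cover:
  assumes "z \<noteq> 0" shows "\<exists>k. z \<in> pw k ` D"
proof -
  have "pr z \<in> pr ` D" using D(4) assms by blast
  then obtain x where x: "x \<in> D" "pr x = pr z" by auto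
  then have "x \<noteq> 0" using D(2) by auto
  then show ?thesis using hopf_proj_eq_iff[OF \<gamma> _ assms] x by blast
qed

text \<open>\<open>D\<close> may be unbounded and accumulate at 0. By invariance, countably many
  pieces of \<open>D\<close> can be moved into a compact set \<open>K\<close> of representatives,
  where their images lie in disjoint tiles, so the total is at most the finite integral over
  \<open>K\<close>.\<close>

lemma fundamental_domain_integrable: "set_integrable lborel D \<Psi>"
proof -
  obtain K where K: "compact K" "0 \<notin> K" "pr ` K = pr ` (- {0})" by (rule hopf_fundamental_compact[OF \<gamma>])
  have Kb: "K \<in> sets borel" using K(1) by (simp add: borel_compact)
  define \<mu> where "\<mu> = density lborel (\<lambda>z. ennreal (norm (\<Psi> z)))"
  have \<mu>: "emeasure \<mu> A = (\<integral>\<^sup>+ z. ennreal (norm (\<Psi> z)) * indicator A z \<partial>lborel)" if "A \<in> sets borel" for A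
    unfolding \<mu>_def using that by (subst emeasure_density) auto
  have sets\<mu>: "sets \<mu> = sets borel" by (simp add: \<mu>_def)
  have \<mu>inv: "emeasure \<mu> (pw k ` A) = emeasure \<mu> A" if "A \<in> sets borel" for A k
    using nn_integral_invariant[OF that] by (simp add: \<mu> that iterate_image_borel)
  \<comment> \<open>\<open>int_decode\<close> enumerates the integers; the \<open>n\<close>-th piece
    is the part of \<open>D\<close> that \<open>pw (int_decode n)\<close> carries into
    \<open>K\<close>.\<close>
  define A where "A n = D \<inter> pw (- int_decode n) ` K" for n
  have Ab: "A n \<in> sets borel" for n using D(1) iterate_image_borel[OF Kb] by (simp add: A_def)
  have Dsub: "D \<subseteq> (\<Union>n. A n)"
  proof
    fix z assume z: "z \<in> D"
    then have nz: "z \<noteq> 0" using D(2) by auto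
    then have "pr z \<in> pr ` K" using K(3) by blast
    then obtain w where w: "w \<in> K" "pr w = pr z" by auto
    then have "w \<noteq> 0" using K(2) by auto
    then obtain k where "z = pw k w" using hopf_proj_eq_iff[OF \<gamma> _ nz] w by blast
    then have "z \<in> A (int_encode (- k))" using z w by (simp add: A_def)
    then show "z \<in> (\<Union>n. A n)" by blast
  qed
  have img: "pw (int_decode n) ` A n = pw (int_decode n) ` D \<inter> K" for n
  proof -
    have "inj (pw k)" for k using hopf_iterate_cancel(1)[OF \<gamma>] by (metis injI)
    then show ?thesis
      unfolding A_def image_Int[OF \<open>inj (pw (int_decode n))\<close>] image_image
      by (simp add: hopf_iterate_cancel(2)[OF \<gamma>])
  qed
  have "emeasure \<mu> D \<le> emeasure \<mu> (\<Union>n. A n)"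
    using Ab Dsub by (intro emeasure_mono) (auto simp: sets\<mu>)
  also have "\<dots> \<le> (\<Sum>n. emeasure \<mu> (A n))"
    using Ab by (intro emeasure_subadditive_countably) (auto simp: sets\<mu>)
  also have "\<dots> = (\<Sum>n. emeasure \<mu> (pw (int_decode n) ` D \<inter> K))"
    by (intro suminf_cong) (metis \<mu>inv[OF Ab] img)
  also have "\<dots> = emeasure \<mu> (\<Union>n. pw (int_decode n) ` D \<inter> K)"
  proof (rule suminf_emeasure)
    show "range (\<lambda>n. pw (int_decode n) ` D \<inter> K) \<subseteq> sets \<mu>"
      using iterate_image_borel[OF D(1)] Kb by (auto simp: sets\<mu>)
    show "disjoint_family (\<lambda>n. pw (int_decode n) ` D \<inter> K)"
      unfolding disjoint_family_on_def
    proof (intro ballI impI)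
      fix m n :: nat assume "m \<noteq> n"
      then have "int_decode m \<noteq> int_decode n" by (simp add: int_decode_eq)
      from tiles_disjoint[OF this] show "pw (int_decode m) ` D \<inter> K \<inter> (pw (int_decode n) ` D \<inter> K) = {}" by blast
    qed
  qed
  also have "\<dots> \<le> emeasure \<mu> K" using Kb by (intro emeasure_mono) (auto simp: sets\<mu>)
  also have "emeasure \<mu> K = (\<integral>\<^sup>+ z. ennreal (norm (indicator K z *\<^sub>R \<Psi> z)) \<partial>lborel)"
    unfolding \<mu>[OF Kb] by (intro nn_integral_cong) (simp add: indicator_def)
  also have "\<dots> < \<infinity>"
    using loc[OF K(1,2)] unfolding set_integrable_def integrable_iff_bounded by blast
  finally have "emeasure \<mu> D < \<infinity>" .
  moreover have "(\<integral>\<^sup>+ z. ennreal (norm (indicator D z *\<^sub>R \<Psi> z)) \<partial>lborel) = emeasure \<mu> D"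
    unfolding \<mu>[OF D(1)] by (intro nn_integral_cong) (simp add: indicator_def)
  ultimately show ?thesis
    using D(1) by (simp add: set_integrable_def integrable_iff_bounded)
qed

text \<open>Both sides are limits of the same sequence, the integrals of
  \<open>(\<psi> \<circ> \<gamma> - \<psi>) \<Psi>\<close> over the union of the tiles with
  \<open>- N \<le> k < N\<close>. The tiles exhaust the integral on the right; moved back to
  \<open>D\<close>, their weights telescope.\<close>

lemma fundamental_domain_integral:
  fixes \<psi> :: "complex^'n \<Rightarrow> real"
  assumes cont: "continuous_on UNIV \<psi>" and bd: "\<And>z. 0 \<le> \<psi> z" "\<And>z. \<psi> z \<le> 1"
    and supp: "compact S" "\<And>z. z \<notin> S \<Longrightarrow> \<psi> z = 0"
    and one: "open T" "0 \<in> T" "\<And>z. z \<in> T \<Longrightarrow> \<psi> z = 1"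
    and int: "integrable lborel (\<lambda>z. (\<psi> (\<gamma> z) - \<psi> z) *\<^sub>R \<Psi> z)"
  shows "set_lebesgue_integral lborel D \<Psi> = integral\<^sup>L lborel (\<lambda>z. (\<psi> (\<gamma> z) - \<psi> z) *\<^sub>R \<Psi> z)"
proof -
  have [measurable]: "\<psi> \<in> borel_measurable borel" by (rule borel_measurable_continuous_onI[OF cont])
  have [measurable]: "pw k \<in> borel \<rightarrow>\<^sub>M borel" for k
    using borel_measurable_continuous_onI[OF continuous_int_iterate[OF \<gamma>]] .
  have [measurable]: "D \<in> sets borel" by (rule D(1))
  let ?\<chi> = "\<lambda>z. \<psi> (\<gamma> z) - \<psi> z"
  have m\<chi>: "?\<chi> \<in> borel_measurable borel" by measurable
  have tele: "(\<Sum>k\<in>{- int N..<int N}. ?\<chi> (pw k z)) = \<psi> (pw (int N) z) - \<psi> (pw (- int N) z)" for N z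
  proof (induction N)
    case (Suc N)
    have "{- int (Suc N)..<int (Suc N)} = insert (- int N - 1) (insert (int N) {- int N..<int N})" by auto
    then have "(\<Sum>k\<in>{- int (Suc N)..<int (Suc N)}. ?\<chi> (pw k z)) =
      ?\<chi> (pw (- int N - 1) z) + (?\<chi> (pw (int N) z) + (\<Sum>k\<in>{- int N..<int N}. ?\<chi> (pw k z)))" by simp
    moreover have "\<gamma> (pw (- int N - 1) z) = pw (- int N) z" using pw_succ(1)[of "- int N - 1" z] by simp
    moreover have "\<gamma> (pw (int N) z) = pw (int (Suc N)) z" using pw_succ(1)[of "int N" z] by (simp add: add.commute)
    moreover have "- int N - 1 = - int (Suc N)" by simp
    ultimately show ?case using Suc by (simp del: of_nat_Suc)
  qed simp
  \<comment> \<open>Forward iterates of \<open>z\<close> enter \<open>T\<close>, where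
    \<open>\<psi>\<close> is 1. Backward iterates leave \<open>S\<close>, because
    \<open>\<gamma> ^^ N\<close> eventually pushes the compact set \<open>S\<close> off the point
    \<open>z\<close>.\<close>
  have lim1: "(\<lambda>N. \<psi> (pw (int N) z) - \<psi> (pw (- int N) z)) \<longlonglongrightarrow> 1" if z: "z \<noteq> 0" for z
  proof -
    have "\<forall>\<^sub>F N in sequentially. (\<gamma> ^^ N) ` {z} \<subseteq> T"
      by (intro contraction_eventually[OF \<gamma>] one) auto
    moreover have "\<forall>\<^sub>F N in sequentially. (\<gamma> ^^ N) ` S \<subseteq> - {z}"
      using z by (intro contraction_eventually[OF \<gamma>] supp) auto
    ultimately have "\<forall>\<^sub>F N in sequentially. \<psi> (pw (int N) z) - \<psi> (pw (- int N) z) = 1"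
    proof eventually_elim
      case (elim N)
      have "\<psi> (pw (int N) z) = 1" using elim(1) one(3) by (simp add: int_iterate_of_nat)
      moreover have "pw (- int N) z \<notin> S"
      proof
        assume "pw (- int N) z \<in> S"
        then have "pw (int N) (pw (- int N) z) \<in> pw (int N) ` S" by (rule imageI)
        then have "z \<in> (\<gamma> ^^ N) ` S"
          unfolding hopf_iterate_cancel(2)[OF \<gamma>] by (simp only: int_iterate_of_nat)
        then show False using elim(2) by blast
      qed
      ultimately show ?case using supp(2) by simp
    qed
    then show ?thesis by (rule tendsto_eventually)
  qed
  have intD: "integrable lborel (\<lambda>z. indicator D z *\<^sub>R \<Psi> z)"
    using fundamental_domain_integrable by (simp add: set_integrable_def)
  have L: "(\<lambda>N. integral\<^sup>L lborel (\<lambda>z. indicator D z *\<^sub>R ((\<psi> (pw (int N) z) - \<psi> (pw (- int N) z)) *\<^sub>R \<Psi> z)))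
     \<longlonglongrightarrow> integral\<^sup>L lborel (\<lambda>z. indicator D z *\<^sub>R \<Psi> z)"
  proof (rule integral_dominated_convergence[where w = "\<lambda>z. norm (indicator D z *\<^sub>R \<Psi> z)"])
    show "AE z in lborel. (\<lambda>N. indicator D z *\<^sub>R ((\<psi> (pw (int N) z) - \<psi> (pw (- int N) z)) *\<^sub>R \<Psi> z)) \<longlonglongrightarrow> indicator D z *\<^sub>R \<Psi> z"
    proof (rule AE_I2)
      fix z
      show "(\<lambda>N. indicator D z *\<^sub>R ((\<psi> (pw (int N) z) - \<psi> (pw (- int N) z)) *\<^sub>R \<Psi> z)) \<longlonglongrightarrow> indicator D z *\<^sub>R \<Psi> z"
      proof (cases "z \<in> D")
        case True
        then have "z \<noteq> 0" using D(2) by auto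
        from tendsto_scaleR[OF lim1[OF this] tendsto_const[of "\<Psi> z"]] True show ?thesis by simp
      qed simp
    qed
    show "AE z in lborel. norm (indicator D z *\<^sub>R ((\<psi> (pw (int N) z) - \<psi> (pw (- int N) z)) *\<^sub>R \<Psi> z)) \<le> norm (indicator D z *\<^sub>R \<Psi> z)" for N
    proof (rule AE_I2)
      fix z
      have "\<bar>\<psi> (pw (int N) z) - \<psi> (pw (- int N) z)\<bar> \<le> 1"
        using bd(1)[of "pw (int N) z"] bd(2)[of "pw (int N) z"] bd(1)[of "pw (- int N) z"] bd(2)[of "pw (- int N) z"] by linarith
      then show "norm (indicator D z *\<^sub>R ((\<psi> (pw (int N) z) - \<psi> (pw (- int N) z)) *\<^sub>R \<Psi> z)) \<le> norm (indicator D z *\<^sub>R \<Psi> z)"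
        by (auto simp: indicator_def intro: mult_left_le_one_le)
    qed
    show "integrable lborel (\<lambda>z. norm (indicator D z *\<^sub>R \<Psi> z))" using intD by (rule integrable_norm)
  qed measurable
  have Dk: "pw k ` D \<in> sets borel" for k by (rule iterate_image_borel[OF D(1)])
  have R: "(\<lambda>N. integral\<^sup>L lborel (\<lambda>z. \<Sum>k\<in>{- int N..<int N}. indicator (pw k ` D) z *\<^sub>R (?\<chi> z *\<^sub>R \<Psi> z)))
     \<longlonglongrightarrow> integral\<^sup>L lborel (\<lambda>z. ?\<chi> z *\<^sub>R \<Psi> z)"
  proof (rule integral_dominated_convergence[where w = "\<lambda>z. norm (?\<chi> z *\<^sub>R \<Psi> z)"])
    have sum: "(\<Sum>k\<in>{- int N..<int N}. indicator (pw k ` D) z *\<^sub>R (?\<chi> z *\<^sub>R \<Psi> z)) =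
       indicator (\<Union>k\<in>{- int N..<int N}. pw k ` D) z *\<^sub>R (?\<chi> z *\<^sub>R \<Psi> z)" for N z
    proof -
      have "disjoint_family_on (\<lambda>k. pw k ` D) {- int N..<int N}"
        unfolding disjoint_family_on_def using tiles_disjoint by blast
      from indicator_UN_disjoint[OF _ this, of z, where 'c = real] show ?thesis
        by (simp only: scaleR_sum_left finite_atLeastLessThan_int)
    qed
    show "AE z in lborel. (\<lambda>N. \<Sum>k\<in>{- int N..<int N}. indicator (pw k ` D) z *\<^sub>R (?\<chi> z *\<^sub>R \<Psi> z)) \<longlonglongrightarrow> ?\<chi> z *\<^sub>R \<Psi> z"
    proof (rule AE_I2)
      fix z
      show "(\<lambda>N. \<Sum>k\<in>{- int N..<int N}. indicator (pw k ` D) z *\<^sub>R (?\<chi> z *\<^sub>R \<Psi> z)) \<longlonglongrightarrow> ?\<chi> z *\<^sub>R \<Psi> z"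
      proof (cases "z = 0")
        case True
        then show ?thesis by (simp add: contraction_0[OF \<gamma>])
      next
        case False
        then obtain k where k: "z \<in> pw k ` D" using tiles_cover by blast
        have "\<forall>\<^sub>F N in sequentially. nat \<bar>k\<bar> + 1 \<le> N" by (rule eventually_ge_at_top)
        then have "\<forall>\<^sub>F N in sequentially. (\<Sum>k\<in>{- int N..<int N}. indicator (pw k ` D) z *\<^sub>R (?\<chi> z *\<^sub>R \<Psi> z)) = ?\<chi> z *\<^sub>R \<Psi> z"
        proof eventually_elim
          case (elim N)
          then have "k \<in> {- int N..<int N}" by auto
          then have "z \<in> (\<Union>k\<in>{- int N..<int N}. pw k ` D)" using k by blast
          then show ?case unfolding sum by simp
        qed
        then show ?thesis by (rule tendsto_eventually)
      qed
    qed
    show "AE z in lborel. norm (\<Sum>k\<in>{- int N..<int N}. indicator (pw k ` D) z *\<^sub>R (?\<chi> z *\<^sub>R \<Psi> z)) \<le> norm (?\<chi> z *\<^sub>R \<Psi> z)" for N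
      unfolding sum by (rule AE_I2) (simp add: indicator_def)
    show "(\<lambda>z. \<Sum>k\<in>{- int N..<int N}. indicator (pw k ` D) z *\<^sub>R (?\<chi> z *\<^sub>R \<Psi> z)) \<in> borel_measurable lborel" for N
      using Dk by (intro borel_measurable_sum borel_measurable_scaleR borel_measurable_indicator) auto
    show "integrable lborel (\<lambda>z. norm (?\<chi> z *\<^sub>R \<Psi> z))" using int by (rule integrable_norm)
  qed (use int in auto)
  have eq: "integral\<^sup>L lborel (\<lambda>z. \<Sum>k\<in>{- int N..<int N}. indicator (pw k ` D) z *\<^sub>R (?\<chi> z *\<^sub>R \<Psi> z)) =
    integral\<^sup>L lborel (\<lambda>z. indicator D z *\<^sub>R ((\<psi> (pw (int N) z) - \<psi> (pw (- int N) z)) *\<^sub>R \<Psi> z))" for N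
  proof -
    have ik: "integrable lborel (\<lambda>z. indicator (pw k ` D) z *\<^sub>R (?\<chi> z *\<^sub>R \<Psi> z))" for k
      using Dk int by (intro integrable_mult_indicator) auto
    have iD: "integrable lborel (\<lambda>z. indicator D z *\<^sub>R (?\<chi> (pw k z) *\<^sub>R \<Psi> z))" for k
    proof (rule Bochner_Integration.integrable_bound[OF intD])
      show "AE z in lborel. norm (indicator D z *\<^sub>R (?\<chi> (pw k z) *\<^sub>R \<Psi> z)) \<le> norm (indicator D z *\<^sub>R \<Psi> z)"
      proof (rule AE_I2)
        fix z
        have "\<bar>?\<chi> (pw k z)\<bar> \<le> 1"
          using bd(1)[of "pw k z"] bd(2)[of "pw k z"] bd(1)[of "\<gamma> (pw k z)"] bd(2)[of "\<gamma> (pw k z)"] by linarith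
        then show "norm (indicator D z *\<^sub>R (?\<chi> (pw k z) *\<^sub>R \<Psi> z)) \<le> norm (indicator D z *\<^sub>R \<Psi> z)"
          by (auto simp: indicator_def intro: mult_left_le_one_le)
      qed
    qed measurable
    have "integral\<^sup>L lborel (\<lambda>z. \<Sum>k\<in>{- int N..<int N}. indicator (pw k ` D) z *\<^sub>R (?\<chi> z *\<^sub>R \<Psi> z)) =
      (\<Sum>k\<in>{- int N..<int N}. integral\<^sup>L lborel (\<lambda>z. indicator D z *\<^sub>R (?\<chi> (pw k z) *\<^sub>R \<Psi> z)))"
      by (subst Bochner_Integration.integral_sum[OF ik]) (simp only: integral_invariant[OF D(1) m\<chi>])
    also have "\<dots> = integral\<^sup>L lborel (\<lambda>z. \<Sum>k\<in>{- int N..<int N}. indicator D z *\<^sub>R (?\<chi> (pw k z) *\<^sub>R \<Psi> z))"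
      by (rule Bochner_Integration.integral_sum[OF iD, symmetric])
    also have "\<dots> = integral\<^sup>L lborel (\<lambda>z. indicator D z *\<^sub>R ((\<psi> (pw (int N) z) - \<psi> (pw (- int N) z)) *\<^sub>R \<Psi> z))"
      unfolding tele[symmetric] by (simp add: scaleR_sum_left scaleR_sum_right)
    finally show ?thesis .
  qed
  from LIMSEQ_unique[OF L R[unfolded eq]] show ?thesis by (simp add: set_lebesgue_integral_def)
qed

end
end
end

section \<open>The logarithmic derivative of the Jacobian determinant\<close>

lemma complex_jacobian_compose:
  assumes "holomorphic_map_on F UNIV" "holomorphic_map_on G UNIV"
  shows "complex_jacobian (\<lambda>z. F (G z)) z = complex_jacobian F (G z) ** complex_jacobian G z"
  using wirtinger_compose(1)[OF assms(2), of z "\<lambda>w. F w $ _"]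
    hol_on_differentiable[OF hol_on_component(1)[OF assms(1)]]
  by (simp add: vec_eq_iff complex_jacobian_def matrix_matrix_mult_def)

lemma complex_jacobian_id: "complex_jacobian (\<lambda>z. z) z = mat 1"
proof -
  have "((\<lambda>z. z $ i) has_derivative (\<lambda>v. v $ i)) (at z)" for i
    by (intro bounded_linear_imp_has_derivative bounded_linear_vec_nth)
  then have "wirtinger j (\<lambda>z. z $ i) z = (if i = j then 1 else 0)" for i j
    by (subst wirtinger_has_derivative(1)) (assumption, simp add: axis_def)
  then show ?thesis by (simp add: vec_eq_iff complex_jacobian_def mat_def)
qed

lemma norm_le_sum_components: "norm (v :: complex^'n) \<le> (\<Sum>i\<in>UNIV. norm (v $ i))"
  unfolding norm_vec_def by (rule L2_set_le_sum) simp

context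
  fixes \<gamma> :: "complex^'n \<Rightarrow> complex^'n"
  assumes \<gamma>: "biholomorphic_contraction \<gamma>"
begin

lemma contraction_hol: "holomorphic_map_on \<gamma> UNIV" "holomorphic_map_on (inv \<gamma>) UNIV"
  using \<gamma> by (auto simp: biholomorphic_contraction_def)

lemma det_jacobian_nonzero: "det (complex_jacobian \<gamma> z) \<noteq> 0"
proof -
  have "(\<lambda>z. inv \<gamma> (\<gamma> z)) = (\<lambda>z. z)" using contraction_bij[OF \<gamma>] by (simp add: bij_is_inj)
  then have "complex_jacobian (inv \<gamma>) (\<gamma> z) ** complex_jacobian \<gamma> z = mat 1"
    by (metis complex_jacobian_compose[OF contraction_hol(2,1)] complex_jacobian_id)
  from arg_cong[OF this, of det] show ?thesis by (auto simp: det_mul)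
qed

text \<open>A high iterate is uniformly small on the unit ball, so by the Cauchy estimates its
  derivative has norm at most 1/2 on the ball of radius 1/2, and the mean value inequality starts at
  the fixed point 0.\<close>

lemma contraction_half:
  obtains m where "0 < m" "\<And>z. norm z < 1/2 \<Longrightarrow> norm ((\<gamma> ^^ m) z) \<le> norm z / 2"
proof -
  \<comment> \<open>The Cauchy estimate at radius 1/2 bounds each component of the derivative by
    \<open>4 * \<epsilon>\<close>, and the \<open>n\<close> components together are to stay below
    1/2.\<close>
  define \<epsilon> where "\<epsilon> = 1 / (8 * real CARD('n))"
  have \<epsilon>: "\<epsilon> > 0" by (simp add: \<epsilon>_def)
  have "\<forall>\<^sub>F N in sequentially. (\<gamma> ^^ N) ` cball 0 1 \<subseteq> ball 0 \<epsilon>"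
    using \<epsilon> by (intro contraction_eventually[OF \<gamma>]) auto
  then obtain N where N: "\<And>M. M \<ge> N \<Longrightarrow> (\<gamma> ^^ M) ` cball 0 1 \<subseteq> ball 0 \<epsilon>"
    unfolding eventually_sequentially by blast
  \<comment> \<open>Positive by construction, so that an \<open>m\<close>-th root can be taken
    afterwards.\<close>
  define m where "m = Suc N"
  let ?F = "\<gamma> ^^ m"
  have small: "norm (?F z) < \<epsilon>" if "norm z \<le> 1" for z
    using N[of m] that unfolding image_subset_iff by (simp add: m_def)
  have hol: "holomorphic_map_on ?F UNIV" by (rule holomorphic_map_funpow[OF contraction_hol(1)])
  have F0: "?F 0 = 0" by (induction m) (auto simp: contraction_0[OF \<gamma>])
  have D: "norm (frechet_derivative ?F (at z) v) \<le> 1/2 * norm v" if z: "norm z < 1/2" for z v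
  proof -
    have "norm (frechet_derivative ?F (at z) v $ i) \<le> 4 * \<epsilon> * norm v" for i
    proof -
      have "norm (frechet_derivative (\<lambda>z. ?F z $ i) (at z) v) \<le> 2 * \<epsilon> / (1/2) * norm v"
      proof (rule hol_on_Cauchy)
        show "hol_on (\<lambda>z. ?F z $ i) (ball z (1/2))"
          by (rule hol_on_subset[OF hol_on_component(1)[OF hol]]) simp
        fix w assume "w \<in> ball z (1/2)"
        then have "norm w \<le> 1" using z norm_triangle_ineq[of z "w - z"] by (simp add: dist_norm norm_minus_commute)
        then show "norm (?F w $ i) \<le> \<epsilon>" using small[of w] Finite_Cartesian_Product.norm_nth_le[of "?F w" i] by simp
      qed simp
      then show ?thesis by (simp add: hol_on_component(2)[OF hol])
    qed
    then have "(\<Sum>i\<in>UNIV. norm (frechet_derivative ?F (at z) v $ i)) \<le> of_nat (CARD('n)) * (4 * \<epsilon> * norm v)"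
      by (intro sum_bounded_above)
    then show ?thesis using norm_le_sum_components[of "frechet_derivative ?F (at z) v"] by (simp add: \<epsilon>_def)
  qed
  have "norm (?F z) \<le> norm z / 2" if z: "norm z < 1/2" for z
  proof -
    have "norm (?F z - ?F 0) \<le> 1/2 * norm (z - 0)"
    proof (rule differentiable_bound[of "ball 0 (1/2)" ?F "\<lambda>z. frechet_derivative ?F (at z)" "1/2"])
      show "(?F has_derivative frechet_derivative ?F (at x)) (at x within ball 0 (1/2))" for x
        using holomorphic_map_derivative(1)[OF hol] by (simp add: has_derivative_at_withinI)
      show "onorm (frechet_derivative ?F (at x)) \<le> 1/2" if "x \<in> ball 0 (1/2)" for x
        using D[of x] that by (intro onorm_le) simp
    qed (use z in auto)
    then show ?thesis by (simp add: F0)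
  qed
  then show ?thesis by (intro that[of m]) (auto simp: m_def)
qed

text \<open>From time \<open>N0\<close> on, every \<open>m\<close> further iterations halve the
  norm, so the rate is the \<open>m\<close>-th root of 1/2; \<open>C\<close> absorbs the finitely
  many iterates before \<open>N0 + m\<close>.\<close>

lemma contraction_geometric:
  assumes "compact K"
  obtains C r where "0 < r" "r < 1" "\<And>z k. z \<in> K \<Longrightarrow> norm ((\<gamma> ^^ k) z) \<le> C * r ^ k"
proof -
  obtain m where m: "0 < m" "\<And>z. norm z < 1/2 \<Longrightarrow> norm ((\<gamma> ^^ m) z) \<le> norm z / 2"
    by (rule contraction_half) blast
  have "\<forall>\<^sub>F N in sequentially. (\<gamma> ^^ N) ` K \<subseteq> ball 0 (1/2)"
    by (intro contraction_eventually[OF \<gamma>] assms) auto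
  then obtain N0 where N0: "\<And>N. N \<ge> N0 \<Longrightarrow> (\<gamma> ^^ N) ` K \<subseteq> ball 0 (1/2)"
    unfolding eventually_sequentially by blast
  have "\<exists>B. \<forall>z\<in>K. norm ((\<gamma> ^^ k) z) \<le> B" for k
  proof -
    have "continuous_on K (\<gamma> ^^ k)"
      using holomorphic_map_on_continuous[OF holomorphic_map_funpow[OF contraction_hol(1)]] continuous_on_subset by blast
    then have "bounded ((\<gamma> ^^ k) ` K)" using assms by (intro compact_imp_bounded compact_continuous_image)
    then show ?thesis by (auto simp: bounded_iff)
  qed
  then obtain b where b: "\<And>k z. z \<in> K \<Longrightarrow> norm ((\<gamma> ^^ k) z) \<le> b k" by metis
  define B where "B = (\<Sum>k<N0+m. \<bar>b k\<bar>)"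
  have B: "norm ((\<gamma> ^^ k) z) \<le> B" if "k < N0 + m" "z \<in> K" for k z
  proof -
    have "\<bar>b k\<bar> \<le> B" unfolding B_def using that by (intro member_le_sum) auto
    then show ?thesis using b[OF that(2), of k] by linarith
  qed
  have B0: "B \<ge> 0" unfolding B_def by (simp add: sum_nonneg)
  define r where "r = root m (1/2)"
  have r: "0 < r" "r < 1" "r ^ m = 1/2" using m(1) by (auto simp: r_def)
  define C where "C = B / r ^ (N0 + m)"
  have C: "B \<le> C * r ^ k" if "k < N0 + m" for k
  proof -
    have "r ^ (N0 + m) \<le> r ^ k" using r that by (intro power_decreasing) auto
    then have "B * r ^ (N0 + m) \<le> B * r ^ k" using B0 by (rule mult_left_mono)
    then show ?thesis using r by (simp add: C_def field_simps)
  qed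
  have "norm ((\<gamma> ^^ k) z) \<le> C * r ^ k" if z: "z \<in> K" for k z
  proof (induction k rule: less_induct)
    case (less k)
    show ?case
    proof (cases "k < N0 + m")
      case True
      then show ?thesis using B[OF True z] C[OF True] by linarith
    next
      case False
      define j where "j = k - m"
      have j: "k = m + j" "j \<ge> N0" "j < k" using False m(1) by (auto simp: j_def)
      have "norm ((\<gamma> ^^ j) z) < 1/2" using N0[OF j(2)] z by auto
      then have "norm ((\<gamma> ^^ k) z) \<le> norm ((\<gamma> ^^ j) z) / 2"
        using m(2) unfolding j(1) funpow_add by simp
      also have "\<dots> \<le> C * r ^ j / 2" using less[OF j(3)] by simp
      also have "\<dots> = C * r ^ k" unfolding j(1) power_add r(3) by simp
      finally show ?thesis .
    qed
  qed
  then show ?thesis using that r by blast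
qed

text \<open>The solution is \<open>p = \<Sum>k. \<partial> log (J \<circ> \<gamma>\<^sup>k)\<close>. The Cauchy estimates turn the geometric
  convergence of \<open>J \<circ> \<gamma>\<^sup>k\<close> into convergence of the series.\<close>

lemma jacobian_cocycle_solution:
  obtains p where "\<And>j. hol_on (p j) UNIV"
    "\<And>j z. p j z = wirtinger j (\<lambda>z. det (complex_jacobian \<gamma> z)) z / det (complex_jacobian \<gamma> z)
      + (\<Sum>l\<in>UNIV. p l (\<gamma> z) * complex_jacobian \<gamma> z $ l $ j)"
proof -
  let ?J = "\<lambda>z. det (complex_jacobian \<gamma> z)"
  define T where "T k z = ?J ((\<gamma> ^^ k) z)" for k z
  define t where "t k j z = wirtinger j (T k) z / T k z" for k j z
  have holJ: "hol_on ?J UNIV" by (intro hol_on_det hol_on_jacobian contraction_hol) simp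
  have holT: "hol_on (T k) UNIV" for k
    unfolding T_def[abs_def] by (intro hol_on_compose[OF holJ] holomorphic_map_funpow contraction_hol) simp
  have Tnz: "T k z \<noteq> 0" for k z by (simp add: T_def det_jacobian_nonzero)
  have holt: "hol_on (t k j) UNIV" for k j
    unfolding t_def[abs_def] by (intro hol_on_divide hol_on_wirtinger_fun holT open_UNIV Tnz)
  have loc: "\<exists>r>0. ball z0 r \<subseteq> UNIV \<and> uniform_limit (ball z0 r) (\<lambda>n z. \<Sum>k<n. t k j z) (\<lambda>z. \<Sum>k. t k j z) sequentially" for z0 j
  proof -
    obtain C r where r: "0 < r" "r < 1" and C: "\<And>z k. z \<in> cball z0 2 \<Longrightarrow> norm ((\<gamma> ^^ k) z) \<le> C * r ^ k"
      by (rule contraction_geometric[OF compact_cball[of z0 2]]) blast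
    have "(?J has_derivative frechet_derivative ?J (at 0)) (at 0)" using hol_onD(1)[OF holJ] by simp
    \<comment> \<open>A Lipschitz bound for \<open>J\<close> at the fixed point 0 carries the
      geometric rate from \<open>\<gamma> ^^ k\<close> over to
      \<open>J \<circ> \<gamma> ^^ k\<close>.\<close>
    then obtain L where L: "\<forall>\<^sub>F z in at 0. norm (?J z - ?J 0) \<le> L * norm (z - 0)"
    proof -
      assume D: "(?J has_derivative frechet_derivative ?J (at 0)) (at 0)"
      obtain K where K: "\<And>v. norm (frechet_derivative ?J (at 0) v) \<le> norm v * K"
        using bounded_linear.bounded[OF has_derivative_bounded_linear[OF D]] by blast
      have "\<exists>d>0. \<forall>z. norm (z - 0) < d \<longrightarrow> norm (?J z - ?J 0 - frechet_derivative ?J (at 0) (z - 0)) \<le> 1 * norm (z - 0)"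
        using D unfolding has_derivative_at_alt by (metis zero_less_one)
      then obtain d where d: "d > 0" "\<And>z. norm z < d \<Longrightarrow> norm (?J z - ?J 0 - frechet_derivative ?J (at 0) z) \<le> norm z"
        by auto
      have "norm (?J z - ?J 0) \<le> (1 + K) * norm (z - 0)" if "norm z < d" for z
        using d(2)[OF that] K[of z] norm_triangle_sub[of "?J z - ?J 0" "frechet_derivative ?J (at 0) z"]
        by (simp add: algebra_simps)
      then have "\<forall>\<^sub>F z in at 0. norm (?J z - ?J 0) \<le> (1 + K) * norm (z - 0)"
        unfolding eventually_at using d(1) by auto
      then show ?thesis using that by blast
    qed
    then obtain d where d: "d > 0" "\<And>z. norm z < d \<Longrightarrow> norm (?J z - ?J 0) \<le> \<bar>L\<bar> * norm z"
    proof -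
      obtain d where d: "d > 0" "\<And>z. z \<noteq> 0 \<Longrightarrow> norm z < d \<Longrightarrow> norm (?J z - ?J 0) \<le> L * norm z"
        using L unfolding eventually_at by auto
      have "norm (?J z - ?J 0) \<le> \<bar>L\<bar> * norm z" if "norm z < d" for z
      proof (cases "z = 0")
        case False
        have "L * norm z \<le> \<bar>L\<bar> * norm z" by (intro mult_right_mono) auto
        then show ?thesis using d(2)[OF False that] by linarith
      qed simp
      then show ?thesis using that d(1) by blast
    qed
    \<comment> \<open>Bounds \<open>T k - J 0\<close> on \<open>cball z0 2\<close> once
      \<open>\<gamma> ^^ k\<close> has brought that ball into the range of the Lipschitz
      bound.\<close>
    define c where "c k = \<bar>L\<bar> * (\<bar>C\<bar> * r ^ k)" for k
    have "(\<lambda>k. \<bar>C\<bar> * r ^ k) \<longlonglongrightarrow> \<bar>C\<bar> * 0"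
      using r by (intro tendsto_mult_left LIMSEQ_power_zero) auto
    then have ev1: "\<forall>\<^sub>F k in sequentially. \<bar>C\<bar> * r ^ k < d" using d(1) by (simp add: order_tendstoD(2))
    have "c \<longlonglongrightarrow> \<bar>L\<bar> * (\<bar>C\<bar> * 0)"
      unfolding c_def using r by (intro tendsto_mult_left LIMSEQ_power_zero) auto
    moreover have "norm (?J 0) / 2 > 0" using det_jacobian_nonzero by simp
    ultimately have ev2: "\<forall>\<^sub>F k in sequentially. c k < norm (?J 0) / 2"
      using order_tendstoD(2)[of c 0 sequentially "norm (?J 0) / 2"] by simp
    \<comment> \<open>Unit balls around points of \<open>ball z0 1\<close> lie in
      \<open>cball z0 2\<close>. Hence the Cauchy estimate for \<open>T k - J 0\<close> bounds the
      numerator by \<open>2 * c k\<close>, while the denominator stays above half of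
      \<open>norm (J 0)\<close>.\<close>
    have "\<forall>\<^sub>F k in sequentially. \<forall>z\<in>ball z0 1. norm (t k j z) \<le> 2 * c k / (norm (?J 0) / 2)"
      using ev1 ev2
    proof eventually_elim
      case (elim k)
      have close: "norm (T k w - ?J 0) \<le> c k" if "w \<in> cball z0 2" for w
      proof -
        have "C * r ^ k \<le> \<bar>C\<bar> * r ^ k" using r by (intro mult_right_mono) auto
        then have 1: "norm ((\<gamma> ^^ k) w) \<le> \<bar>C\<bar> * r ^ k" using C[OF that, of k] by linarith
        then have "norm (?J ((\<gamma> ^^ k) w) - ?J 0) \<le> \<bar>L\<bar> * norm ((\<gamma> ^^ k) w)" using elim(1) by (intro d(2)) linarith
        also have "\<dots> \<le> c k" unfolding c_def using 1 by (intro mult_left_mono) auto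
        finally show ?thesis by (simp add: T_def)
      qed
      show ?case
      proof
        fix z assume z: "z \<in> ball z0 1"
        have sub: "w \<in> cball z0 2" if "w \<in> ball z 1" for w
          using that z dist_triangle[of z0 w z] by simp
        let ?f = "\<lambda>w. T k w + - ?J 0"
        have "norm (frechet_derivative ?f (at z) (axis j 1)) \<le> 2 * c k / 1 * norm (axis j (1::complex))"
        proof (rule hol_on_Cauchy)
          show "hol_on ?f (ball z 1)" by (intro hol_on_add hol_on_const hol_on_subset[OF holT]) simp
          show "norm (?f w) \<le> c k" if "w \<in> ball z 1" for w using close[OF sub[OF that]] by simp
        qed simp
        moreover have "frechet_derivative ?f (at z) = frechet_derivative (T k) (at z)"
          using has_derivative_add[OF hol_onD(1)[OF holT, of z k] has_derivative_const[of "- ?J 0"]]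
          by (intro frechet_derivative_at[symmetric]) simp
        ultimately have num: "norm (wirtinger j (T k) z) \<le> 2 * c k"
          using hol_on_wirtinger(1)[OF holT] by simp
        have "norm (?J 0) \<le> norm (T k z) + norm (T k z - ?J 0)"
          by (metis norm_minus_commute norm_triangle_sub)
        then have "norm (?J 0) / 2 \<le> norm (T k z)" using close[OF sub[of z]] elim(2) by simp
        then show "norm (t k j z) \<le> 2 * c k / (norm (?J 0) / 2)"
          unfolding t_def norm_divide using num det_jacobian_nonzero r
          by (intro frac_le) (auto simp: c_def)
      qed
    qed
    moreover have "summable (\<lambda>k. 2 * c k / (norm (?J 0) / 2))"
      unfolding c_def using r by (intro summable_divide summable_mult summable_geometric) auto
    ultimately have "uniform_limit (ball z0 1) (\<lambda>n z. \<Sum>k<n. t k j z) (\<lambda>z. \<Sum>k. t k j z) sequentially"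
      by (rule Weierstrass_m_test_ev)
    then show ?thesis by (intro exI[of _ 1]) simp
  qed
  define p where "p j z = (\<Sum>k. t k j z)" for j z
  have "hol_on (p j) UNIV" for j
    unfolding p_def[abs_def] by (rule hol_on_limit(1)[OF open_UNIV _ loc]) (intro hol_on_sum holt)
  moreover have sums: "(\<lambda>k. t k j z) sums p j z" for j z
  proof -
    obtain r where r: "r > 0" "uniform_limit (ball z r) (\<lambda>n z. \<Sum>k<n. t k j z) (\<lambda>z. \<Sum>k. t k j z) sequentially"
      using loc[of z j] by blast
    have "z \<in> ball z r" using r by simp
    from tendsto_uniform_limitI[OF r(2) this] show ?thesis by (simp add: sums_def p_def)
  qed
  \<comment> \<open>Pulling back by \<open>\<gamma>\<close> shifts the series by one, so
    \<open>p\<close> and its pullback differ by the first term,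
    \<open>\<partial> log J\<close>.\<close>
  have step: "t (Suc k) j z = (\<Sum>l\<in>UNIV. t k l (\<gamma> z) * complex_jacobian \<gamma> z $ l $ j)" for k j z
  proof -
    have "T (Suc k) = (\<lambda>z. T k (\<gamma> z))" by (simp add: T_def fun_eq_iff funpow_swap1)
    then have "wirtinger j (T (Suc k)) z = (\<Sum>l\<in>UNIV. wirtinger l (T k) (\<gamma> z) * complex_jacobian \<gamma> z $ l $ j)"
      using wirtinger_compose(1)[OF contraction_hol(1), of z "T k"] hol_on_differentiable[OF holT] by simp
    then show ?thesis using \<open>T (Suc k) = _\<close> by (simp add: t_def sum_divide_distrib)
  qed
  have "p j z = wirtinger j ?J z / ?J z + (\<Sum>l\<in>UNIV. p l (\<gamma> z) * complex_jacobian \<gamma> z $ l $ j)" for j z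
  proof -
    have "(\<lambda>k. t (Suc k) j z) sums (\<Sum>l\<in>UNIV. p l (\<gamma> z) * complex_jacobian \<gamma> z $ l $ j)"
      unfolding step by (intro sums_sum sums_mult2 sums)
    then have "(\<lambda>k. t k j z) sums ((\<Sum>l\<in>UNIV. p l (\<gamma> z) * complex_jacobian \<gamma> z $ l $ j) + t 0 j z)"
      by (rule sums_Suc)
    moreover have "T 0 = ?J" by (simp add: T_def fun_eq_iff)
    ultimately show ?thesis using sums_unique2[OF sums[of j z]] by (fastforce simp: t_def add.commute)
  qed
  ultimately show ?thesis by (rule that)
qed

end

section \<open>Integration by parts\<close>

lemma Ck_on_subset: "Ck_on k S f \<Longrightarrow> T \<subseteq> S \<Longrightarrow> Ck_on k T f"
  by (induction k arbitrary: f) (auto intro: continuous_on_subset)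

lemma Ck_on_local:
  assumes "\<And>x. x \<in> S \<Longrightarrow> \<exists>T. open T \<and> x \<in> T \<and> Ck_on k T f"
  shows "Ck_on k S f"
  using assms
proof (induction k arbitrary: f)
  case 0
  have "isCont f x" if x: "x \<in> S" for x
  proof -
    obtain T where "open T" "x \<in> T" "continuous_on T f" using 0[OF x] by auto
    then show ?thesis by (simp add: continuous_on_eq_continuous_at)
  qed
  then show ?case by (simp add: continuous_at_imp_continuous_on)
next
  case (Suc k)
  have "Ck_on k S (\<lambda>x. frechet_derivative f (at x) v)" for v
    using Suc.prems by (intro Suc.IH) (metis Ck_on.simps(2))
  moreover have "f differentiable (at x)" if "x \<in> S" for x
    using Suc.prems[OF that] by auto
  ultimately show ?case by simp
qed

text \<open>Extension by 0: \<open>U\<close> and the complement of \<open>K\<close> are open, cover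
  the space, and carry \<open>C\<^sup>k\<close> restrictions of \<open>f\<close>.\<close>

lemma Ck_on_compact_support:
  assumes "open U" "Ck_on k U f" "compact K" "K \<subseteq> U" "\<And>x. x \<notin> K \<Longrightarrow> f x = 0"
  shows "Ck_on k UNIV f"
proof (rule Ck_on_local)
  fix x
  show "\<exists>T. open T \<and> x \<in> T \<and> Ck_on k T f"
  proof (cases "x \<in> K")
    case True
    then show ?thesis using assms by blast
  next
    case False
    have o: "open (- K)" using assms(3) by (simp add: compact_imp_closed open_Compl)
    have "Ck_on k (- K) f" using Ck_on_const[OF o, of k 0] by (subst Ck_on_cong[OF o, of f "\<lambda>_. 0"]) (use assms in auto)
    then show ?thesis using False o by blast
  qed
qed

section \<open>Stokes' theorem in terms of cofactors\<close>

lemma rank_one_det_cof: "rank_one_det A q w = (\<Sum>j\<in>UNIV. \<Sum>k\<in>UNIV. q $ j * w $ k * cof A j k)"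
  by (simp add: rank_one_det_def det_replace_row sum_distrib_left mult.assoc)

text \<open>In row \<open>j\<close>, all but the \<open>j\<close>-th term of the combination repeat
  another row. It is applied to \<open>dbar (q V)\<close>, whose coefficients are the combination of
  the rows of \<open>M\<close> given by \<open>V\<close>.\<close>

lemma rank_one_det_row_combination:
  "rank_one_det A q (v v* A) = (\<Sum>j\<in>UNIV. q $ j * v $ j) * det (A :: complex^'n^'n)"
proof -
  have "(\<Sum>k\<in>UNIV. (v v* A) $ k * cof A j k) = v $ j * det A" for j
  proof -
    have "(\<Sum>k\<in>UNIV. (v v* A) $ k * cof A j k) = (\<Sum>k\<in>UNIV. \<Sum>l\<in>UNIV. v $ l * (A $ l $ k * cof A j k))"
      by (simp add: vector_matrix_mult_def sum_distrib_left sum_distrib_right mult_ac)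
    also have "\<dots> = (\<Sum>l\<in>UNIV. v $ l * (\<Sum>k\<in>UNIV. A $ l $ k * cof A j k))"
      by (subst sum.swap) (simp add: sum_distrib_left)
    also have "\<dots> = v $ j * det A" by (simp add: cof_row if_distrib[of "\<lambda>x. _ * x"] cong: if_cong)
    finally show ?thesis .
  qed
  then have "rank_one_det A q (v v* A) = (\<Sum>j\<in>UNIV. q $ j * (v $ j * det A))"
    by (simp add: rank_one_det_def det_replace_row)
  then show ?thesis by (simp add: sum_distrib_right mult.assoc)
qed

lemma rank_one_det_zero [simp]: "rank_one_det A q 0 = 0"
  by (simp add: rank_one_det_cof)

definition dbar :: "(complex^'n \<Rightarrow> complex) \<Rightarrow> complex^'n \<Rightarrow> complex^'n" where
  "dbar f z = (\<chi> k. wirtinger_bar k f z)"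

lemma dbar_nth [simp]: "dbar f z $ k = wirtinger_bar k f z"
  by (simp add: dbar_def)

lemma continuous_on_rank_one_det:
  fixes M :: "complex^'n \<Rightarrow> complex^'n^'n"
  assumes "\<And>i j. continuous_on S (\<lambda>z. M z $ i $ j)" "\<And>j. continuous_on S (\<lambda>z. q z $ j)" "\<And>j. continuous_on S (\<lambda>z. w z $ j)"
  shows "continuous_on S (\<lambda>z. rank_one_det (M z) (q z) (w z))"
proof -
  have r: "continuous_on S (\<lambda>z. replace_row (M z) i (w z) $ k $ l)" for i k l
    using assms by (cases "k = i") auto
  show ?thesis unfolding rank_one_det_def det_def
    by (intro continuous_on_sum continuous_on_mult continuous_on_prod continuous_on_const assms r)
qed

lemma continuous_on_compact_support:
  fixes f :: "'a::euclidean_space \<Rightarrow> 'b::real_normed_vector"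
  assumes "open U" "continuous_on U f" "compact K" "K \<subseteq> U" "\<And>x. x \<notin> K \<Longrightarrow> f x = 0"
  shows "continuous_on UNIV f"
  using Ck_on_compact_support[of U 0 f K] assms by simp

text \<open>Stokes' theorem for \<open>\<eta> u q \<and> (dbar q)\<^sup>n\<^sup>-\<^sup>1\<close>, with \<open>q\<close> a (1,0)-form.\<close>

lemma integral_rank_one_det:
  fixes q :: "complex^'n \<Rightarrow> complex^'n" and u \<eta> :: "complex^'n \<Rightarrow> complex"
  defines "M \<equiv> \<lambda>z. \<chi> j k. wirtinger_bar k (\<lambda>w. q w $ j) z"
  assumes U: "open U" and q: "\<And>j. Ck_on 2 U (\<lambda>z. q z $ j)" and u: "Ck_on 1 U u"
    and \<eta>: "Ck_on 1 UNIV \<eta>" and K: "compact K" "K \<subseteq> U" "\<And>z. z \<notin> K \<Longrightarrow> \<eta> z = 0"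
  shows "integral\<^sup>L lborel (\<lambda>z. \<eta> z * (rank_one_det (M z) (q z) (dbar u z) + of_nat CARD('n) * (u z * det (M z)))) +
     integral\<^sup>L lborel (\<lambda>z. u z * rank_one_det (M z) (q z) (dbar \<eta> z)) = 0"
proof -
  let ?R = "\<lambda>z. rank_one_det (M z) (q z)"
  define E1 where "E1 z = \<eta> z * (?R z (dbar u z) + of_nat CARD('n) * (u z * det (M z)))" for z
  define E2 where "E2 z = u z * ?R z (dbar \<eta> z)" for z
  \<comment> \<open>The form to be differentiated, written as a vector field: contracting
    \<open>q\<close> with the cofactors of \<open>M\<close> stands for multiplication by
    \<open>(dbar q)\<^sup>n\<^sup>-\<^sup>1\<close>. The factor \<open>\<eta>\<close> lets it extend
    by 0 beyond \<open>U\<close>.\<close>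
  define h where "h k z = \<eta> z * (u z * (\<Sum>j\<in>UNIV. q z $ j * cof (M z) j k))" for k z
  have M1: "Ck_on 1 U (\<lambda>z. M z $ j $ k)" for j k
    unfolding M_def vec_lambda_beta using Ck_on_wirtinger(2)[OF U, of 1] q by (simp add: numeral_2_eq_2)
  have "Ck_on (Suc 1) U (\<lambda>z. q z $ j)" for j using q[of j] by (simp only: numeral_2_eq_2 One_nat_def)
  then have q1: "Ck_on 1 U (\<lambda>z. q z $ j)" for j by (rule Ck_on_Suc_imp)
  have \<eta>U: "Ck_on 1 U \<eta>" using \<eta> by (rule Ck_on_subset) simp
  have cof1: "Ck_on 1 U (\<lambda>z. cof (M z) j k)" for j k
    unfolding cof_def
  proof (rule Ck_on_det[OF U])
    fix i l
    show "Ck_on 1 U (\<lambda>x. replace_row (M x) j (axis k 1) $ i $ l)"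
      using M1[of i l] Ck_on_const[OF U] by (cases "i = j") simp_all
  qed
  have h1U: "Ck_on 1 U (h k)" for k
    unfolding h_def[abs_def] by (intro Ck_on_mult Ck_on_sum U \<eta>U u q1 cof1)
  have h0: "h k z = 0" if "z \<notin> K" for k z using K(3)[OF that] by (simp add: h_def)
  have h1: "Ck_on 1 UNIV (h k)" for k
    by (rule Ck_on_compact_support[OF U h1U K(1,2) h0])
  have diff: "f differentiable (at z)" if "Ck_on 1 U f" "z \<in> U" for f :: "complex^'n \<Rightarrow> complex" and z
    using that by simp
  have oK: "open (- K)" using K(1) by (simp add: compact_imp_closed open_Compl)
  have \<eta>0: "wirtinger_bar k \<eta> z = 0" if "z \<notin> K" for k z
    using wirtinger_cong_open(2)[OF oK, of z \<eta> "\<lambda>_. 0" k] that K(3) by simp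
  then have dbar\<eta>0: "dbar \<eta> z = 0" if "z \<notin> K" for z using that by (simp add: vec_eq_iff)
  have eq: "(\<Sum>k\<in>UNIV. wirtinger_bar k (h k) z) = E1 z + E2 z" for z
  proof (cases "z \<in> U")
    case False
    then have "z \<notin> K" using K(2) by blast
    then have "wirtinger_bar k (h k) z = 0" for k
      using wirtinger_cong_open(2)[OF oK, of z "h k" "\<lambda>_. 0" k] h0 by simp
    then show ?thesis using K(3)[OF \<open>z \<notin> K\<close>] dbar\<eta>0[OF \<open>z \<notin> K\<close>] by (simp add: E1_def E2_def)
  next
    case z: True
    have S: "(\<lambda>z. \<Sum>j\<in>UNIV. q z $ j * cof (M z) j k) differentiable (at z)" for k
      by (intro diff[OF _ z] Ck_on_sum Ck_on_mult U q1 cof1)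
    have uS: "(\<lambda>z. u z * (\<Sum>j\<in>UNIV. q z $ j * cof (M z) j k)) differentiable (at z)" for k
      by (intro diff[OF _ z] Ck_on_sum Ck_on_mult U q1 cof1 u)
    have qc: "(\<lambda>z. q z $ j * cof (M z) j k) differentiable (at z)" for j k
      by (intro diff[OF _ z] Ck_on_mult U q1 cof1)
    have "wirtinger_bar k (h k) z = \<eta> z * (u z * (\<Sum>j\<in>UNIV. q z $ j * wirtinger_bar k (\<lambda>z. cof (M z) j k) z + M z $ j $ k * cof (M z) j k)
       + wirtinger_bar k u z * (\<Sum>j\<in>UNIV. q z $ j * cof (M z) j k)) + wirtinger_bar k \<eta> z * (u z * (\<Sum>j\<in>UNIV. q z $ j * cof (M z) j k))" for k
    proof -
      have "wirtinger_bar k (\<lambda>z. \<Sum>j\<in>UNIV. q z $ j * cof (M z) j k) z =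
        (\<Sum>j\<in>UNIV. q z $ j * wirtinger_bar k (\<lambda>z. cof (M z) j k) z + M z $ j $ k * cof (M z) j k)"
      proof -
        have "wirtinger_bar k (\<lambda>w. q w $ j) z = M z $ j $ k" for j by (simp add: M_def)
        then show ?thesis
          by (simp only: wirtinger_sum(2)[OF qc] wirtinger_mult(2)[OF diff[OF q1 z] diff[OF cof1 z]])
      qed
      then show ?thesis
        unfolding h_def[abs_def] wirtinger_mult(2)[OF diff[OF \<eta>U z] uS] wirtinger_mult(2)[OF diff[OF u z] S] by simp
    qed
    then have "(\<Sum>k\<in>UNIV. wirtinger_bar k (h k) z) =
      \<eta> z * u z * (\<Sum>k\<in>UNIV. \<Sum>j\<in>UNIV. q z $ j * wirtinger_bar k (\<lambda>z. cof (M z) j k) z)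
      + \<eta> z * u z * (\<Sum>k\<in>UNIV. \<Sum>j\<in>UNIV. M z $ j $ k * cof (M z) j k)
      + \<eta> z * (\<Sum>k\<in>UNIV. \<Sum>j\<in>UNIV. q z $ j * wirtinger_bar k u z * cof (M z) j k)
      + u z * (\<Sum>k\<in>UNIV. \<Sum>j\<in>UNIV. q z $ j * wirtinger_bar k \<eta> z * cof (M z) j k)"
      by (simp add: sum.distrib sum_distrib_left algebra_simps)
    also have "(\<Sum>k\<in>UNIV. \<Sum>j\<in>UNIV. q z $ j * wirtinger_bar k (\<lambda>z. cof (M z) j k) z) = 0"
    proof -
      have "(\<Sum>k\<in>UNIV. \<Sum>j\<in>UNIV. q z $ j * wirtinger_bar k (\<lambda>z. cof (M z) j k) z) =
        (\<Sum>j\<in>UNIV. q z $ j * (\<Sum>k\<in>UNIV. wirtinger_bar k (\<lambda>z. cof (M z) j k) z))"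
        by (subst sum.swap) (simp add: sum_distrib_left)
      also have "\<dots> = 0"
      proof -
        have "(\<Sum>k\<in>UNIV. wirtinger_bar k (\<lambda>z. cof (M z) j k) z) = 0" for j
        proof (rule cof_divergence_free)
          show "(\<lambda>z. M z $ i $ m) differentiable (at z)" for i m by (rule diff[OF M1 z])
          show "wirtinger_bar k (\<lambda>z. M z $ i $ m) z = wirtinger_bar m (\<lambda>z. M z $ i $ k) z" for i k m
            using wirtinger_commute(2)[OF U q z, of k m i] by (simp add: M_def)
        qed
        then show ?thesis by simp
      qed
      finally show ?thesis .
    qed
    \<comment> \<open>One Laplace expansion for each row: the origin of the factor
      \<open>n\<close>.\<close>
    also have "(\<Sum>k\<in>UNIV. \<Sum>j\<in>UNIV. M z $ j $ k * cof (M z) j k) = of_nat CARD('n) * det (M z)"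
      by (subst sum.swap) (simp add: cof_row)
    also have "(\<Sum>k\<in>UNIV. \<Sum>j\<in>UNIV. q z $ j * wirtinger_bar k u z * cof (M z) j k) = ?R z (dbar u z)"
      unfolding rank_one_det_cof by (subst sum.swap) simp
    also have "(\<Sum>k\<in>UNIV. \<Sum>j\<in>UNIV. q z $ j * wirtinger_bar k \<eta> z * cof (M z) j k) = ?R z (dbar \<eta> z)"
      unfolding rank_one_det_cof by (subst sum.swap) simp
    finally show ?thesis by (simp add: E1_def E2_def algebra_simps)
  qed
  have c: "continuous_on U f" if "Ck_on 1 U f" for f :: "complex^'n \<Rightarrow> complex"
    using Ck_on_Suc_imp[of 0 U f] that by simp
  have wb: "continuous_on U (wirtinger_bar k f)" if "Ck_on 1 U f" for f k
    using Ck_on_wirtinger(2)[OF U, of 0 f k] that by simp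
  have cd: "continuous_on U (\<lambda>z. det (M z))"
    using c[OF Ck_on_det[OF U M1]] .
  have cR: "continuous_on U (\<lambda>z. ?R z (dbar f z))" if "Ck_on 1 U f" for f
    by (rule continuous_on_rank_one_det[OF c[OF M1] c[OF q1]]) (simp add: wb[OF that])
  have i1: "integrable lborel E1"
  proof (rule integrable_compact_support[OF continuous_on_compact_support[OF U _ K(1,2)] K(1)])
    show "continuous_on U E1" unfolding E1_def[abs_def]
      by (intro continuous_on_mult continuous_on_add continuous_on_const cR cd c[OF \<eta>U] c[OF u] u)
  qed (auto simp: E1_def K(3))
  have i2: "integrable lborel E2"
  proof (rule integrable_compact_support[OF continuous_on_compact_support[OF U _ K(1,2)] K(1)])
    show "continuous_on U E2" unfolding E2_def[abs_def]
      by (intro continuous_on_mult cR c[OF u] \<eta>U)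
  qed (auto simp: E2_def dbar\<eta>0)
  have "integral\<^sup>L lborel (\<lambda>z. E1 z + E2 z) = (\<Sum>k\<in>UNIV. integral\<^sup>L lborel (wirtinger_bar k (h k)))"
    unfolding eq[symmetric] by (rule Bochner_Integration.integral_sum) (rule integral_wirtinger_bar_eq_0(2)[OF h1 K(1) h0])
  also have "\<dots> = 0" by (simp add: integral_wirtinger_bar_eq_0(1)[OF h1 K(1) h0])
  finally show ?thesis using i1 i2 by (simp add: E1_def[abs_def] E2_def[abs_def])
qed

text \<open>A cutoff of class \<open>C\<^sup>1\<close>, the regularity that one integration by parts
  consumes: \<open>s \<mapsto> (max 0 s)\<^sup>2\<close> is continuously differentiable, and two
  copies of it give the value 1 for \<open>norm z \<le> 1\<close> and 0 for
  \<open>z \<bullet> z \<ge> 2\<close>.\<close>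

definition bump :: "complex^'n \<Rightarrow> real" where
  "bump z = (max 0 (1 - (max 0 (z \<bullet> z - 1))\<^sup>2))\<^sup>2"

lemma max_square_derivative: "((\<lambda>s::real. (max 0 s)\<^sup>2) has_real_derivative 2 * max 0 s) (at s)"
proof -
  consider "s > 0" | "s < 0" | "s = 0" by linarith
  then show ?thesis
  proof cases
    case 1
    have "((\<lambda>s::real. s\<^sup>2) has_real_derivative 2 * s) (at s)" by (auto intro!: derivative_eq_intros)
    then have "((\<lambda>s::real. (max 0 s)\<^sup>2) has_real_derivative 2 * s) (at s)"
      by (rule has_field_derivative_transform_within_open[of _ _ _ "{0<..}"]) (use 1 in auto)
    then show ?thesis using 1 by simp
  next
    case 2
    have "((\<lambda>s::real. 0) has_real_derivative 0) (at s)" by simp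
    then have "((\<lambda>s::real. (max 0 s)\<^sup>2) has_real_derivative 0) (at s)"
      by (rule has_field_derivative_transform_within_open[of _ _ _ "{..<0}"]) (use 2 in auto)
    then show ?thesis using 2 by simp
  next
    case 3
    have "(\<lambda>h. ((max 0 h)\<^sup>2 - 0) / h) \<midarrow>0\<rightarrow> (0::real)"
    proof (rule Lim_null_comparison[where g = "\<lambda>h. \<bar>h\<bar>"])
      have "norm (((max 0 h)\<^sup>2 - 0) / h) \<le> \<bar>h\<bar>" for h :: real
        by (auto simp: max_def power2_eq_square)
      then show "\<forall>\<^sub>F h in at 0. norm (((max 0 h)\<^sup>2 - 0) / h) \<le> \<bar>h :: real\<bar>" by simp
      show "((\<lambda>h::real. \<bar>h\<bar>) \<longlongrightarrow> 0) (at 0)" by (intro tendsto_eq_intros) auto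
    qed
    then show ?thesis using 3 by (simp add: DERIV_def)
  qed
qed

lemma bump_Ck: "Ck_on 1 UNIV (\<lambda>z :: complex^'n. complex_of_real (bump z))"
  unfolding One_nat_def
proof (rule Ck_on_SucI[OF open_UNIV])
  fix z :: "complex^'n"
  let ?a = "\<lambda>z :: complex^'n. z \<bullet> z - 1"
  let ?b = "\<lambda>z :: complex^'n. 1 - (max 0 (?a z))\<^sup>2"
  let ?F = "\<lambda>z v :: complex^'n. 2 * max 0 (?b z) * - (2 * max 0 (?a z) * (2 * (z \<bullet> v)))"
  have "(?a has_derivative (\<lambda>v. 2 * (z \<bullet> v))) (at z)"
    by (auto intro!: derivative_eq_intros simp: inner_commute)
  from has_derivative_compose[OF this max_square_derivative[unfolded has_field_derivative_def]]
  have "((\<lambda>z. (max 0 (?a z))\<^sup>2) has_derivative (\<lambda>v. 2 * max 0 (?a z) * (2 * (z \<bullet> v)))) (at z)" .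
  then have "(?b has_derivative (\<lambda>v. - (2 * max 0 (?a z) * (2 * (z \<bullet> v))))) (at z)"
    using has_derivative_diff[OF has_derivative_const[of 1]] by fastforce
  from has_derivative_compose[OF this max_square_derivative[unfolded has_field_derivative_def]]
  have "(bump has_derivative ?F z) (at z)" unfolding bump_def[abs_def] .
  then show "((\<lambda>z. complex_of_real (bump z)) has_derivative (\<lambda>v. complex_of_real (?F z v))) (at z)"
    by (rule bounded_linear.has_derivative[OF bounded_linear_of_real])
next
  fix v :: "complex^'n"
  show "Ck_on 0 UNIV (\<lambda>z :: complex^'n. complex_of_real (2 * max 0 (1 - (max 0 (z \<bullet> z - 1))\<^sup>2) * - (2 * max 0 (z \<bullet> z - 1) * (2 * (z \<bullet> v)))))"
    by (auto intro!: continuous_intros)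
qed

lemma bump_bounds: "0 \<le> bump z" "bump z \<le> 1"
proof -
  show "0 \<le> bump z" by (simp add: bump_def)
  have "max 0 (1 - (max 0 (z \<bullet> z - 1))\<^sup>2) \<le> 1" by simp
  from power_mono[OF this, of 2] show "bump z \<le> 1" by (simp add: bump_def)
qed

lemma bump_eq_1:
  assumes "norm z \<le> 1" shows "bump z = 1"
proof -
  have "z \<bullet> z \<le> 1" using assms by (simp add: dot_square_norm power_le_one)
  then show ?thesis by (simp add: bump_def)
qed

lemma bump_eq_0:
  assumes "norm z > 2" shows "bump z = 0"
proof -
  have "2\<^sup>2 < (norm z)\<^sup>2" using assms by (intro power_strict_mono) auto
  then have *: "1 \<le> z \<bullet> z - 1" by (simp add: dot_square_norm)
  then have "1\<^sup>2 \<le> (max 0 (z \<bullet> z - 1))\<^sup>2" by (intro power_mono) auto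
  then show ?thesis by (simp add: bump_def)
qed

section \<open>The integrand on the covering space\<close>

lemma Ck_on_compose_holomorphic:
  fixes f :: "complex^'n \<Rightarrow> complex" and F :: "complex^'n \<Rightarrow> complex^'n"
  assumes f: "Ck_on 1 UNIV f" and F: "holomorphic_map_on F UNIV"
  shows "Ck_on 1 UNIV (\<lambda>z. f (F z))"
  unfolding One_nat_def
proof (rule Ck_on_SucI[OF open_UNIV])
  let ?A = "complex_jacobian F"
  have fd: "f differentiable (at z)" for z using f by simp
  show "((\<lambda>z. f (F z)) has_derivative (\<lambda>v. \<Sum>l\<in>UNIV. wirtinger l f (F z) * (?A z *v v) $ l
      + wirtinger_bar l f (F z) * cnj ((?A z *v v) $ l))) (at z)" for z
    using has_derivative_compose[OF holomorphic_map_derivative(1)[OF F UNIV_I, of z] fd[unfolded frechet_derivative_works, of "F z"]]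
    unfolding complex_jacobian_holomorphic[OF F UNIV_I] frechet_derivative_wirtinger[OF fd] .
  have w: "continuous_on UNIV (wirtinger l f)" "continuous_on UNIV (wirtinger_bar l f)" for l
    using Ck_on_wirtinger[OF open_UNIV, of 0 f l] f by simp_all
  have cF: "continuous_on UNIV F" using F by (rule holomorphic_map_on_continuous)
  have cA: "continuous_on UNIV (\<lambda>z. ?A z $ i $ j)" for i j
    by (rule hol_on_continuous[OF hol_on_jacobian[OF open_UNIV F]])
  have c: "continuous_on UNIV (\<lambda>z. (?A z *v v) $ l)" for l v
    unfolding matrix_vector_mult_def vec_lambda_beta by (intro continuous_on_sum continuous_on_mult cA continuous_on_const)
  show "Ck_on 0 UNIV (\<lambda>z. \<Sum>l\<in>UNIV. wirtinger l f (F z) * (?A z *v v) $ l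
      + wirtinger_bar l f (F z) * cnj ((?A z *v v) $ l))" for v
    unfolding Ck_on.simps(1)
    by (intro continuous_on_sum continuous_on_add continuous_on_mult continuous_on_cnj c
        continuous_on_compose2[OF w(1) cF] continuous_on_compose2[OF w(2) cF]) auto
qed

lemma rank_one_det_diff: "rank_one_det A q (v - w) = rank_one_det A q v - rank_one_det A q w"
  by (simp add: rank_one_det_cof algebra_simps sum_subtractf)

text \<open>The differential of \<open>ln |J|^2\<close> is \<open>2 * Re (dJ / J)\<close>, and the
  (1,0)-part of twice the real part of a complex-linear form is that form. Working with
  \<open>ln |J|^2\<close> avoids a branch of \<open>log J\<close>.\<close>

lemma wirtinger_ln_norm_square:
  assumes "hol_on J S" "z \<in> S" "J z \<noteq> 0"
  shows "wirtinger j (\<lambda>z. complex_of_real (ln ((cmod (J z))\<^sup>2))) z = wirtinger j J z / J z"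
    and "(\<lambda>z. complex_of_real (ln ((cmod (J z))\<^sup>2))) differentiable (at z)"
proof -
  let ?D = "frechet_derivative J (at z)"
  have D: "(J has_derivative ?D) (at z)" by (rule hol_onD(1)[OF assms(1,2)])
  have "((\<lambda>z. (Re (J z))\<^sup>2 + (Im (J z))\<^sup>2) has_derivative (\<lambda>v. 2 * (Re (J z) * Re (?D v)) + 2 * (Im (J z) * Im (?D v)))) (at z)"
  proof -
    note R = bounded_linear.has_derivative[OF bounded_linear_Re D] and I = bounded_linear.has_derivative[OF bounded_linear_Im D]
    have "(\<lambda>v. Re (J z) * Re (?D v) + Re (?D v) * Re (J z) + (Im (J z) * Im (?D v) + Im (?D v) * Im (J z))) =
      (\<lambda>v. 2 * (Re (J z) * Re (?D v)) + 2 * (Im (J z) * Im (?D v)))" by (simp add: fun_eq_iff)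
    with has_derivative_add[OF has_derivative_mult[OF R R] has_derivative_mult[OF I I]]
    show ?thesis by (simp only: power2_eq_square)
  qed
  then have "((\<lambda>z. (cmod (J z))\<^sup>2) has_derivative (\<lambda>v. 2 * (Re (J z) * Re (?D v)) + 2 * (Im (J z) * Im (?D v)))) (at z)"
    by (simp only: cmod_power2)
  from has_derivative_ln[OF _ this]
  have "((\<lambda>z. ln ((cmod (J z))\<^sup>2)) has_derivative (\<lambda>v. (2 * (Re (J z) * Re (?D v)) + 2 * (Im (J z) * Im (?D v))) * inverse ((cmod (J z))\<^sup>2))) (at z)"
    using assms(3) by simp
  also have "(\<lambda>v. (2 * (Re (J z) * Re (?D v)) + 2 * (Im (J z) * Im (?D v))) * inverse ((cmod (J z))\<^sup>2)) = (\<lambda>v. 2 * Re (?D v / J z))"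
    by (simp add: Re_divide cmod_power2 divide_inverse algebra_simps fun_eq_iff)
  finally have der: "((\<lambda>z. complex_of_real (ln ((cmod (J z))\<^sup>2))) has_derivative (\<lambda>v. complex_of_real (2 * Re (?D v / J z)))) (at z)"
    by (rule bounded_linear.has_derivative[OF bounded_linear_of_real])
  then show "(\<lambda>z. complex_of_real (ln ((cmod (J z))\<^sup>2))) differentiable (at z)" by (auto simp: differentiable_def)
  have "axis j \<i> = \<i> *s axis j 1" by (simp add: vec_eq_iff axis_def)
  then have i: "?D (axis j \<i>) = \<i> * ?D (axis j 1)" by (simp add: hol_onD(2)[OF assms(1,2)])
  define x where "x = ?D (axis j 1) / J z"
  have "\<i> * ?D (axis j 1) / J z = \<i> * x" by (simp add: x_def)
  then have "wirtinger j (\<lambda>z. complex_of_real (ln ((cmod (J z))\<^sup>2))) z = (complex_of_real (2 * Re x) - \<i> * complex_of_real (2 * Re (\<i> * x))) / 2"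
    unfolding wirtinger_has_derivative(1)[OF der] i by (simp add: x_def)
  also have "\<dots> = x" by (simp add: complex_eq_iff)
  finally show "wirtinger j (\<lambda>z. complex_of_real (ln ((cmod (J z))\<^sup>2))) z = wirtinger j J z / J z"
    by (simp add: x_def hol_on_wirtinger(1)[OF assms(1,2)])
qed

lemma hol_on_wirtinger_commute:
  assumes "open S" "hol_on f S" "z \<in> S"
  shows "wirtinger j (wirtinger l f) z = wirtinger l (wirtinger j f) z"
proof -
  have "wirtinger j (wirtinger l f) z = frechet_derivative (\<lambda>w. frechet_derivative f (at w) (axis l 1)) (at z) (axis j 1)" for j l
  proof -
    have "frechet_derivative (wirtinger l f) (at z) = frechet_derivative (\<lambda>w. frechet_derivative f (at w) (axis l 1)) (at z)"
      by (rule frechet_derivative_cong_open(1)[OF assms(1,3)]) (rule hol_on_wirtinger(1)[OF assms(2)])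
    then show ?thesis using hol_on_wirtinger(1)[OF hol_on_wirtinger_fun[OF assms(1,2)] assms(3)] by simp
  qed
  then show ?thesis using second_derivative_commute[OF assms(1) hol_on_Ck[OF assms(1,2)] assms(3)] by simp
qed

text \<open>The matrix factors as \<open>(N' - A N B) A\<close> with \<open>B\<close> the inverse of
  \<open>A\<close>, and the trace is invariant under conjugation.\<close>

lemma trace_diff_conj:
  fixes A N N' :: "complex^'n^'n"
  assumes "det A \<noteq> 0"
  shows "(\<Sum>i\<in>UNIV. det (replace_row A i ((N' ** A - A ** N) $ i))) = (trace N' - trace N) * det A"
proof -
  obtain B where B: "A ** B = mat 1" "B ** A = mat 1"
    using assms invertible_det_nz[of A] unfolding invertible_def by blast
  have "N' ** A - A ** N = (N' - A ** N ** B) ** A"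
  proof -
    have "(N' - A ** N ** B) ** A = N' ** A - A ** N ** B ** A"
      by (simp add: vec_eq_iff matrix_matrix_mult_def left_diff_distrib sum_subtractf)
    then show ?thesis by (simp add: matrix_mul_assoc[symmetric] B)
  qed
  moreover have "trace (N' - A ** N ** B) = trace N' - trace N"
    by (simp add: trace_sub trace_mul_sym[of "A ** N" B] matrix_mul_assoc B)
  ultimately show ?thesis by (simp only: sum_det_replace_row_mult)
qed

context
  fixes \<gamma> :: "complex^'n \<Rightarrow> complex^'n" and a :: "complex^'n \<Rightarrow> real" and V :: "complex^'n \<Rightarrow> complex^'n"
    and p :: "'n \<Rightarrow> complex^'n \<Rightarrow> complex"
  assumes \<gamma>: "biholomorphic_contraction \<gamma>"
    and a_smooth: "smooth_on (- {0}) a" and a_pos: "\<And>z. z \<noteq> 0 \<Longrightarrow> 0 < a z"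
    and a_inv: "\<And>z. z \<noteq> 0 \<Longrightarrow> a z = a (\<gamma> z) * (cmod (det (complex_jacobian \<gamma> z)))\<^sup>2"
    and V_hol: "holomorphic_map_on V (- {0})"
    and V_inv: "\<And>z. z \<noteq> 0 \<Longrightarrow> V (\<gamma> z) = complex_jacobian \<gamma> z *v V z"
    and p_hol: "\<And>j. hol_on (p j) UNIV"
    and p_eq: "\<And>j z. p j z = wirtinger j (\<lambda>z. det (complex_jacobian \<gamma> z)) z / det (complex_jacobian \<gamma> z)
      + (\<Sum>l\<in>UNIV. p l (\<gamma> z) * complex_jacobian \<gamma> z $ l $ j)"
begin

private abbreviation "A \<equiv> complex_jacobian \<gamma>"
private abbreviation "J z \<equiv> det (complex_jacobian \<gamma> z)"
private abbreviation "U \<equiv> - {0 :: complex^'n}"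

text \<open>\<open>q\<close> is an invariant (1,0)-form, \<open>M\<close> the matrix of its \<open>dbar\<close> and of the Ricci form, and
  \<open>u + f\<close> the divergence of \<open>V\<close>.\<close>

private definition "L w = complex_of_real (ln (a w))"
private definition "q z = (\<chi> j. wirtinger j L z - p j z)"
private definition "M z = (\<chi> j k. wirtinger_bar k (\<lambda>w. q w $ j) z)"
private definition "u z = (\<Sum>j\<in>UNIV. V z $ j * q z $ j)"
private definition "f z = (\<Sum>j\<in>UNIV. V z $ j * p j z) + (\<Sum>l\<in>UNIV. wirtinger l (\<lambda>w. V w $ l) z)"

private lemma openU: "open U" by (simp add: open_Compl)

private lemma \<gamma>_hol: "holomorphic_map_on \<gamma> UNIV" by (rule contraction_hol(1)[OF \<gamma>])

private lemma \<gamma>_nz: "z \<noteq> 0 \<Longrightarrow> \<gamma> z \<noteq> 0"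
  using hopf_iterate_eq_0[OF \<gamma>, of 1 z] by simp

private lemma \<gamma>_0: "\<gamma> 0 = 0" by (rule contraction_0[OF \<gamma>])

private lemma J_nz: "J z \<noteq> 0" by (rule det_jacobian_nonzero[OF \<gamma>])

private lemma J_hol: "hol_on (\<lambda>z. J z) UNIV" by (intro hol_on_det hol_on_jacobian \<gamma>_hol) simp

private lemma A_hol: "hol_on (\<lambda>z. A z $ i $ j) UNIV" by (intro hol_on_jacobian \<gamma>_hol) simp

private lemma L_Ck: "Ck_on k U L"
  unfolding L_def[abs_def] by (rule smooth_on_ln[OF openU a_smooth]) (simp add: a_pos)

private lemma Ck_differentiable: "Ck_on (Suc k) U g \<Longrightarrow> z \<noteq> 0 \<Longrightarrow> g differentiable (at z)"
  by simp

private lemma wirtinger_L_Ck: "Ck_on k U (wirtinger j L)"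
  by (rule Ck_on_wirtinger(1)[OF openU L_Ck])

private lemma q_Ck: "Ck_on k U (\<lambda>z. q z $ j)"
  unfolding q_def vec_lambda_beta
  by (intro Ck_on_diff openU wirtinger_L_Ck hol_on_Ck hol_on_subset[OF p_hol]) simp

text \<open>\<open>p\<close> is holomorphic and disappears under \<open>wirtinger_bar\<close>;
  exchanging the two derivatives of \<open>L\<close> leaves the coefficients of the Ricci
  form.\<close>

private lemma M_eq: "z \<noteq> 0 \<Longrightarrow> M z $ j $ k = wirtinger j (wirtinger_bar k L) z"
  unfolding M_def q_def vec_lambda_beta
  using wirtinger_diff(2)[OF Ck_differentiable[OF wirtinger_L_Ck[of "Suc 0"]] hol_on_differentiable[OF p_hol], of z k j j]
    hol_on_wirtinger(2)[OF p_hol, of z k j] wirtinger_commute(1)[OF openU L_Ck, of z j k]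
  by simp

section \<open>Transformation laws under the contraction\<close>

private lemma wirtinger_L_step:
  assumes z: "z \<noteq> 0"
  shows "wirtinger j L z = wirtinger j J z / J z + (\<Sum>l\<in>UNIV. wirtinger l L (\<gamma> z) * A z $ l $ j)"
proof -
  let ?N = "\<lambda>z. complex_of_real (ln ((cmod (J z))\<^sup>2))"
  have zU: "z \<in> U" using z by simp
  have LU: "L w = ?N w + L (\<gamma> w)" if "w \<in> U" for w
    using that J_nz[of w] a_pos[OF \<gamma>_nz[of w]] a_inv[of w]
    by (simp add: L_def ln_mult)
  have d: "L differentiable (at (\<gamma> z))" by (rule Ck_differentiable[OF L_Ck[of "Suc 0"] \<gamma>_nz[OF z]])
  have d': "(\<lambda>w. L (\<gamma> w)) differentiable (at z)"
    using has_derivative_compose[OF holomorphic_map_derivative(1)[OF \<gamma>_hol, of z] d[unfolded frechet_derivative_works]]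
    by (auto simp: differentiable_def)
  have "wirtinger j L z = wirtinger j (\<lambda>w. ?N w + L (\<gamma> w)) z"
    by (rule wirtinger_cong_open(1)[OF openU zU LU])
  also have "\<dots> = wirtinger j ?N z + wirtinger j (\<lambda>w. L (\<gamma> w)) z"
    by (rule wirtinger_add(1)[OF wirtinger_ln_norm_square(2)[OF J_hol UNIV_I J_nz] d'])
  finally show ?thesis
    using wirtinger_ln_norm_square(1)[OF J_hol UNIV_I J_nz] wirtinger_compose(1)[OF \<gamma>_hol UNIV_I d] by simp
qed

text \<open>The invariance of the volume form gives \<open>\<partial> log a\<close> the same
  inhomogeneous term \<open>\<partial> log J\<close> that \<open>p_eq\<close> gives
  \<open>p\<close>; it cancels in the difference.\<close>

private lemma q_step:
  assumes "z \<noteq> 0"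
  shows "q z $ j = (\<Sum>l\<in>UNIV. A z $ l $ j * q (\<gamma> z) $ l)"
  using wirtinger_L_step[OF assms, of j] p_eq[of j z]
  by (simp add: q_def sum_subtractf[symmetric] algebra_simps)

private definition "cA z = (\<chi> i j. cnj (A z $ i $ j))"

text \<open>The entries of the Jacobian are holomorphic, so \<open>wirtinger_bar\<close> acts only
  on \<open>q \<circ> \<gamma>\<close>, and the chain rule contributes the conjugate Jacobian on the
  right.\<close>

private lemma M_step:
  assumes z: "z \<noteq> 0"
  shows "M z = transpose (A z) ** M (\<gamma> z) ** cA z"
proof -
  have zU: "z \<in> U" using z by simp
  have d: "(\<lambda>w. q w $ l) differentiable (at (\<gamma> z))" for l
    by (rule Ck_differentiable[OF q_Ck[of "Suc 0"] \<gamma>_nz[OF z]])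
  have d': "(\<lambda>w. q (\<gamma> w) $ l) differentiable (at z)" for l
    using has_derivative_compose[OF holomorphic_map_derivative(1)[OF \<gamma>_hol, of z] d[unfolded frechet_derivative_works]]
    by (auto simp: differentiable_def)
  have dA: "(\<lambda>w. A w $ l $ j) differentiable (at z)" for l j by (rule hol_on_differentiable[OF A_hol]) simp
  have "M z $ j $ k = (\<Sum>l\<in>UNIV. \<Sum>m\<in>UNIV. A z $ l $ j * (M (\<gamma> z) $ l $ m * cA z $ m $ k))" for j k
  proof -
    have "M z $ j $ k = wirtinger_bar k (\<lambda>w. \<Sum>l\<in>UNIV. A w $ l $ j * q (\<gamma> w) $ l) z"
      unfolding M_def vec_lambda_beta
      by (rule wirtinger_cong_open(2)[OF openU zU]) (simp add: q_step)
    also have "\<dots> = (\<Sum>l\<in>UNIV. wirtinger_bar k (\<lambda>w. A w $ l $ j * q (\<gamma> w) $ l) z)"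
      by (rule wirtinger_sum(2)) (intro differentiable_mult dA d')
    also have "\<dots> = (\<Sum>l\<in>UNIV. A z $ l $ j * (\<Sum>m\<in>UNIV. M (\<gamma> z) $ l $ m * cA z $ m $ k))"
      by (intro sum.cong refl)
         (simp add: wirtinger_mult(2)[OF dA d'] hol_on_wirtinger(2)[OF A_hol] wirtinger_compose(2)[OF \<gamma>_hol UNIV_I d] M_def cA_def)
    finally show ?thesis by (simp add: sum_distrib_left)
  qed
  then show ?thesis
    by (simp add: vec_eq_iff matrix_matrix_mult_def transpose_def sum_distrib_right mult.assoc)
       (intro allI sum.swap)
qed

private lemma q_step': "z \<noteq> 0 \<Longrightarrow> q z = transpose (A z) *v q (\<gamma> z)"
  by (simp add: vec_eq_iff matrix_vector_mult_def transpose_def q_step)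

private lemma det_cA: "det (transpose (A z)) * det (cA z) = complex_of_real ((cmod (J z))\<^sup>2)"
  using det_cnj[of "A z"] by (simp add: cA_def complex_norm_square[symmetric] del: of_real_power)

private lemma det_M_step: "z \<noteq> 0 \<Longrightarrow> det (M z) = complex_of_real ((cmod (J z))\<^sup>2) * det (M (\<gamma> z))"
  unfolding det_cA[symmetric] by (subst M_step) (simp_all add: det_mul)

private lemma u_step: "z \<noteq> 0 \<Longrightarrow> u (\<gamma> z) = u z"
  unfolding u_def by (simp add: V_inv q_step matrix_vector_mult_def sum_distrib_left sum_distrib_right mult_ac)
    (rule sum.swap)

private lemma V_comp_hol: "hol_on (\<lambda>z. V z $ j) U"
  by (rule hol_on_component(1)[OF V_hol])

private lemma f_hol: "hol_on f U"
  unfolding f_def[abs_def]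
  by (intro hol_on_add hol_on_sum hol_on_mult V_comp_hol hol_on_wirtinger_fun openU hol_on_subset[OF p_hol]) simp

text \<open>Differentiating \<open>V \<circ> \<gamma> = A V\<close> gives
  \<open>N' A = E + A N\<close>, where \<open>N\<close> and \<open>N'\<close> are the Jacobians of
  \<open>V\<close> at \<open>z\<close> and at \<open>\<gamma> z\<close>, and \<open>E\<close> is the
  derivative of \<open>A\<close> along \<open>V\<close>. Jacobi's formula turns \<open>E\<close>
  into the derivative of \<open>J\<close> along \<open>V\<close>, and \<open>trace_diff_conj\<close>
  evaluates it.\<close>

private lemma trace_step:
  assumes z: "z \<noteq> 0"
  shows "(\<Sum>l\<in>UNIV. V z $ l * (wirtinger l J z / J z)) =
    trace (complex_jacobian V (\<gamma> z)) - trace (complex_jacobian V z)"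
proof -
  have zU: "z \<in> U" using z by simp
  let ?N = "complex_jacobian V"
  define E where "E = (\<chi> i j. \<Sum>l\<in>UNIV. wirtinger l (\<lambda>w. A w $ i $ j) z * V z $ l)"
  have dA: "(\<lambda>w. A w $ l $ j) differentiable (at z)" for l j by (rule hol_on_differentiable[OF A_hol]) simp
  have dV: "(\<lambda>w. V w $ l) differentiable (at z)" for l by (rule hol_on_differentiable[OF V_comp_hol zU])
  have dV': "(\<lambda>w. V w $ l) differentiable (at (\<gamma> z))" for l
    by (rule hol_on_differentiable[OF V_comp_hol]) (simp add: \<gamma>_nz z)
  \<comment> \<open>Symmetry of the second derivatives of \<open>\<gamma>\<close>. It turns the
    derivative of column \<open>l\<close> in direction \<open>j\<close>, which differentiating
    \<open>A V\<close> produces, into a derivative along \<open>V\<close>.\<close>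
  have comm: "wirtinger j (\<lambda>w. A w $ i $ l) z = wirtinger l (\<lambda>w. A w $ i $ j) z" for i j l
    using hol_on_wirtinger_commute[OF open_UNIV hol_on_component(1)[OF \<gamma>_hol], of z j l i]
    by (simp add: complex_jacobian_def)
  have "(?N (\<gamma> z) ** A z) $ i $ j = E $ i $ j + (A z ** ?N z) $ i $ j" for i j
  proof -
    have "(?N (\<gamma> z) ** A z) $ i $ j = wirtinger j (\<lambda>w. V (\<gamma> w) $ i) z"
      using wirtinger_compose(1)[OF \<gamma>_hol UNIV_I dV'] by (simp add: matrix_matrix_mult_def complex_jacobian_def)
    also have "\<dots> = wirtinger j (\<lambda>w. \<Sum>l\<in>UNIV. A w $ i $ l * V w $ l) z"
      by (rule wirtinger_cong_open(1)[OF openU zU]) (simp add: V_inv matrix_vector_mult_def)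
    also have "\<dots> = (\<Sum>l\<in>UNIV. wirtinger j (\<lambda>w. A w $ i $ l * V w $ l) z)"
      by (rule wirtinger_sum(1)) (intro differentiable_mult dA dV)
    also have "\<dots> = E $ i $ j + (A z ** ?N z) $ i $ j"
      by (simp add: wirtinger_mult(1)[OF dA dV] sum.distrib E_def matrix_matrix_mult_def complex_jacobian_def[of V] comm)
    finally show ?thesis .
  qed
  then have E: "E = ?N (\<gamma> z) ** A z - A z ** ?N z" by (simp add: vec_eq_iff)
  have "wirtinger l J z = (\<Sum>i\<in>UNIV. det (replace_row (A z) i (\<chi> j. wirtinger l (\<lambda>w. A w $ i $ j) z)))" for l
  proof -
    have "((\<lambda>x. det (A x)) has_derivative (\<lambda>v. \<Sum>i\<in>UNIV. det (replace_row (A z) i (\<chi> j. frechet_derivative (\<lambda>w. A w $ i $ j) (at z) v)))) (at z)"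
      by (rule det_has_derivative) (rule hol_onD(1)[OF A_hol UNIV_I])
    from fun_cong[OF frechet_derivative_at[OF this], of "axis l 1"] show ?thesis
      unfolding hol_on_wirtinger(1)[OF J_hol UNIV_I] hol_on_wirtinger(1)[OF A_hol UNIV_I] by (simp only:)
  qed
  then have "(\<Sum>l\<in>UNIV. V z $ l * wirtinger l J z) = (\<Sum>i\<in>UNIV. det (replace_row (A z) i (E $ i)))"
  proof -
    assume *: "\<And>l. wirtinger l J z = (\<Sum>i\<in>UNIV. det (replace_row (A z) i (\<chi> j. wirtinger l (\<lambda>w. A w $ i $ j) z)))"
    have "(\<Sum>l\<in>UNIV. V z $ l * wirtinger l J z) =
      (\<Sum>l\<in>UNIV. \<Sum>i\<in>UNIV. \<Sum>j\<in>UNIV. wirtinger l (\<lambda>w. A w $ i $ j) z * V z $ l * cof (A z) i j)"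
      unfolding * det_replace_row by (simp add: sum_distrib_left mult_ac)
    also have "\<dots> = (\<Sum>i\<in>UNIV. \<Sum>l\<in>UNIV. \<Sum>j\<in>UNIV. wirtinger l (\<lambda>w. A w $ i $ j) z * V z $ l * cof (A z) i j)"
      by (rule sum.swap)
    also have "\<dots> = (\<Sum>i\<in>UNIV. \<Sum>j\<in>UNIV. \<Sum>l\<in>UNIV. wirtinger l (\<lambda>w. A w $ i $ j) z * V z $ l * cof (A z) i j)"
      by (intro sum.cong refl sum.swap)
    also have "\<dots> = (\<Sum>i\<in>UNIV. det (replace_row (A z) i (E $ i)))"
      unfolding det_replace_row by (simp add: E_def sum_distrib_right)
    finally show ?thesis .
  qed
  also have "\<dots> = (trace (?N (\<gamma> z)) - trace (?N z)) * J z"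
    unfolding E by (rule trace_diff_conj[OF J_nz])
  finally show ?thesis using J_nz[of z] by (simp add: sum_divide_distrib[symmetric] field_simps)
qed

text \<open>By the equation for \<open>p\<close>, the pairing of \<open>V\<close> with
  \<open>p\<close> changes under \<open>\<gamma>\<close> by the logarithmic derivative of
  \<open>J\<close> along \<open>V\<close>, and \<open>trace_step\<close> shows that the coordinate
  divergence of \<open>V\<close> changes by the opposite amount.\<close>

private lemma f_step:
  assumes z: "z \<noteq> 0" shows "f (\<gamma> z) = f z"
proof -
  have tr: "(\<Sum>l\<in>UNIV. wirtinger l (\<lambda>w. V w $ l) z) = trace (complex_jacobian V z)" for z
    by (simp add: trace_def complex_jacobian_def)
  have "(\<Sum>l\<in>UNIV. V (\<gamma> z) $ l * p l (\<gamma> z)) = (\<Sum>j\<in>UNIV. V z $ j * (\<Sum>l\<in>UNIV. p l (\<gamma> z) * A z $ l $ j))"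
    by (simp add: V_inv[OF z] matrix_vector_mult_def sum_distrib_left sum_distrib_right mult_ac) (rule sum.swap)
  also have "\<dots> = (\<Sum>j\<in>UNIV. V z $ j * (p j z - wirtinger j J z / J z))"
    using p_eq[of _ z] by (intro sum.cong refl) simp
  also have "\<dots> = (\<Sum>j\<in>UNIV. V z $ j * p j z) - (trace (complex_jacobian V (\<gamma> z)) - trace (complex_jacobian V z))"
    by (simp only: right_diff_distrib sum_subtractf trace_step[OF z])
  finally show ?thesis by (simp add: f_def tr)
qed

private lemma divergence_eq: "divergence a V z = u z + f z"
  by (simp add: divergence_def u_def f_def q_def L_def[abs_def] sum.distrib[symmetric] algebra_simps)

section \<open>The cutoff and the vanishing of the cut-off integrals\<close>

private definition "\<eta> z = complex_of_real (bump (\<gamma> z)) - complex_of_real (bump z)"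

private lemma \<eta>_Ck: "Ck_on 1 UNIV \<eta>"
  unfolding \<eta>_def[abs_def] by (intro Ck_on_diff open_UNIV Ck_on_compose_holomorphic[OF bump_Ck \<gamma>_hol] bump_Ck)

text \<open>A compact set carrying \<open>\<eta>\<close>: outside the union both bumps vanish, and
  on the removed open set both are 1. The removal keeps \<open>K\<close> away from the origin, where
  \<open>q\<close> and \<open>M\<close> are not controlled.\<close>

private definition "K = (cball 0 2 \<union> inv \<gamma> ` cball 0 2) - (ball 0 1 \<inter> \<gamma> -` ball 0 1)"

private lemma K: "compact K" "K \<subseteq> U" "z \<notin> K \<Longrightarrow> \<eta> z = 0"
proof -
  have "compact (inv \<gamma> ` cball 0 2)"
    using holomorphic_map_on_continuous[OF contraction_hol(2)[OF \<gamma>]]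
    by (intro compact_continuous_image) (auto intro: continuous_on_subset)
  moreover have "open (\<gamma> -` ball 0 1)"
    using holomorphic_map_on_continuous[OF \<gamma>_hol] by (intro open_vimage) auto
  ultimately show "compact K" unfolding K_def by (intro compact_diff compact_Un open_Int) auto
  show "K \<subseteq> U" by (auto simp: K_def \<gamma>_0)
  show "\<eta> z = 0" if "z \<notin> K"
  proof (cases "z \<in> ball 0 1 \<inter> \<gamma> -` ball 0 1")
    case True
    then show ?thesis by (simp add: \<eta>_def bump_eq_1)
  next
    case False
    then have "z \<notin> cball 0 2" "z \<notin> inv \<gamma> ` cball 0 2" using that by (auto simp: K_def)
    moreover have "z = inv \<gamma> (\<gamma> z)" using contraction_bij[OF \<gamma>] by (simp add: bij_is_inj)
    ultimately have "norm z > 2" "norm (\<gamma> z) > 2" by (auto simp: image_iff not_le[symmetric])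
    then show ?thesis by (simp add: \<eta>_def bump_eq_0)
  qed
qed

private lemma M_cont: "continuous_on U (\<lambda>z. M z $ i $ j)"
  unfolding M_def vec_lambda_beta using Ck_on_wirtinger(2)[OF openU q_Ck, of 0] by simp

private lemma detM_cont: "continuous_on U (\<lambda>z. det (M z))"
  using Ck_on_det[OF openU, of 0 M] M_cont by simp

text \<open>In the integration by parts for \<open>\<eta> = \<psi> \<circ> \<gamma> - \<psi>\<close>, the boundary terms of \<open>\<psi> \<circ> \<gamma>\<close> and
  \<open>\<psi>\<close> have the same integral, by invariance.\<close>

lemma integral_cutoff_eq_0:
  assumes w: "Ck_on 1 U w" and w_step: "\<And>z. z \<noteq> 0 \<Longrightarrow> w (\<gamma> z) = w z"
    and c: "\<And>z. z \<noteq> 0 \<Longrightarrow> rank_one_det (M z) (q z) (dbar w z) = of_nat c * (w z * det (M z))"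
  shows "integral\<^sup>L lborel (\<lambda>z. \<eta> z * (w z * det (M z))) = 0"
proof -
  let ?\<psi> = "\<lambda>z :: complex^'n. complex_of_real (bump z)"
  define Q where "Q g z = w z * rank_one_det (M z) (q z) (dbar g z)" for g z
  have \<psi>d: "?\<psi> differentiable (at z)" for z using bump_Ck[where 'n = 'n] by simp
  have \<psi>d': "(\<lambda>w. ?\<psi> (\<gamma> w)) differentiable (at z)" for z
    using Ck_on_compose_holomorphic[OF bump_Ck \<gamma>_hol] by simp
  have cmp: "dbar (\<lambda>w. ?\<psi> (\<gamma> w)) z = dbar ?\<psi> (\<gamma> z) v* cA z" for z
    by (simp add: vec_eq_iff wirtinger_compose(2)[OF \<gamma>_hol UNIV_I \<psi>d] vector_matrix_mult_def cA_def mult.commute)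
  have \<psi>0: "dbar ?\<psi> z = 0" if "z \<notin> cball 0 2 - ball 0 1" for z :: "complex^'n"
  proof (cases "z \<in> ball 0 1")
    case True
    have "wirtinger_bar k ?\<psi> z = wirtinger_bar k (\<lambda>_. 1) z" for k
      by (rule wirtinger_cong_open(2)[OF open_ball True]) (simp add: bump_eq_1)
    then show ?thesis by (simp add: vec_eq_iff)
  next
    case False
    then have z: "z \<in> - cball 0 2" using that by auto
    have "wirtinger_bar k ?\<psi> z = wirtinger_bar k (\<lambda>_. 0) z" for k
      by (rule wirtinger_cong_open(2)[OF _ z]) (auto simp: bump_eq_0)
    then show ?thesis by (simp add: vec_eq_iff)
  qed
  have Q\<eta>: "Q \<eta> z = Q (\<lambda>w. ?\<psi> (\<gamma> w)) z - Q ?\<psi> z" for z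
  proof -
    have "dbar \<eta> z = dbar (\<lambda>w. ?\<psi> (\<gamma> w)) z - dbar ?\<psi> z"
      unfolding \<eta>_def[abs_def] by (simp add: vec_eq_iff wirtinger_diff(2)[OF \<psi>d' \<psi>d])
    then show ?thesis by (simp add: Q_def rank_one_det_diff right_diff_distrib)
  qed
  have Qstep: "Q (\<lambda>w. ?\<psi> (\<gamma> w)) z = (cmod (J z))\<^sup>2 *\<^sub>R Q ?\<psi> (\<gamma> z)" for z
  proof (cases "z = 0")
    case True
    \<comment> \<open>The values of \<open>q\<close> and \<open>M\<close> at 0 are arbitrary, but
      the bump is constant near 0.\<close>
    have "dbar ?\<psi> 0 = 0" by (rule \<psi>0) simp
    then show ?thesis using True by (simp add: Q_def cmp \<gamma>_0)
  next
    case False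
    have "Q (\<lambda>w. ?\<psi> (\<gamma> w)) z = w z * rank_one_det (transpose (A z) ** M (\<gamma> z) ** cA z) (transpose (A z) *v q (\<gamma> z)) (dbar ?\<psi> (\<gamma> z) v* cA z)"
      unfolding Q_def cmp using M_step[OF False] q_step'[OF False] by simp
    also have "\<dots> = w z * (complex_of_real ((cmod (J z))\<^sup>2) * rank_one_det (M (\<gamma> z)) (q (\<gamma> z)) (dbar ?\<psi> (\<gamma> z)))"
      unfolding rank_one_det_congruence det_cA ..
    finally show ?thesis by (simp add: Q_def w_step[OF False] scaleR_conv_of_real)
  qed
  have wc: "continuous_on U w" using Ck_on_Suc_imp[of 0 U w] w by simp
  have R: "continuous_on U (\<lambda>z. rank_one_det (M z) (q z) (dbar g z))" if "Ck_on 1 UNIV g" for g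
  proof (rule continuous_on_rank_one_det)
    show "continuous_on U (\<lambda>z. q z $ j)" for j using q_Ck[of 0] by simp
    show "continuous_on U (\<lambda>z. dbar g z $ j)" for j
      using Ck_on_wirtinger(2)[OF open_UNIV, of 0 g j] that by (auto intro: continuous_on_subset)
  qed (rule M_cont)
  have QC: "continuous_on UNIV (Q ?\<psi>)"
  proof (rule continuous_on_compact_support[OF openU, where K = "cball 0 2 - ball 0 1"])
    show "continuous_on U (Q ?\<psi>)" unfolding Q_def[abs_def] by (intro continuous_on_mult wc R bump_Ck)
    show "compact (cball (0 :: complex^'n) 2 - ball 0 1)" by (intro compact_diff) auto
    show "Q ?\<psi> z = 0" if "z \<notin> cball 0 2 - ball 0 1" for z unfolding Q_def \<psi>0[OF that] by simp
  qed auto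
  have Qint: "integrable lborel (Q ?\<psi>)"
  proof (rule integrable_compact_support[OF QC])
    show "compact (cball (0 :: complex^'n) 2 - ball 0 1)" by (intro compact_diff) auto
    show "Q ?\<psi> z = 0" if "z \<notin> cball 0 2 - ball 0 1" for z unfolding Q_def \<psi>0[OF that] by simp
  qed
  have Qm: "Q ?\<psi> \<in> borel_measurable borel" by (rule borel_measurable_continuous_onI[OF QC])
  have "integral\<^sup>L lborel (Q \<eta>) = integral\<^sup>L lborel (\<lambda>z. (cmod (J z))\<^sup>2 *\<^sub>R Q ?\<psi> (\<gamma> z) - Q ?\<psi> z)"
    unfolding Q\<eta>[abs_def] Qstep by simp
  also have "\<dots> = 0"
    using integral_contraction[OF \<gamma> Qm] Qint by simp
  finally have Q0: "integral\<^sup>L lborel (Q \<eta>) = 0" .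
  have "integral\<^sup>L lborel (\<lambda>z. \<eta> z * (rank_one_det (M z) (q z) (dbar w z) + of_nat CARD('n) * (w z * det (M z)))) = 0"
    using integral_rank_one_det[OF openU q_Ck w \<eta>_Ck K] Q0
    unfolding M_def[symmetric] Q_def[abs_def] by simp
  also have "(\<lambda>z. \<eta> z * (rank_one_det (M z) (q z) (dbar w z) + of_nat CARD('n) * (w z * det (M z)))) =
    (\<lambda>z. of_nat (c + CARD('n)) * (\<eta> z * (w z * det (M z))))"
  proof
    fix z
    show "\<eta> z * (rank_one_det (M z) (q z) (dbar w z) + of_nat CARD('n) * (w z * det (M z))) =
      of_nat (c + CARD('n)) * (\<eta> z * (w z * det (M z)))"
    proof (cases "z = 0")
      case True
      then have "\<eta> z = 0" by (intro K(3)) (use K(2) in auto)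
      then show ?thesis by simp
    next
      case False
      then show ?thesis by (simp add: c algebra_simps)
    qed
  qed
  finally have "of_nat (c + CARD('n)) * integral\<^sup>L lborel (\<lambda>z. \<eta> z * (w z * det (M z))) = 0"
    by (simp only: integral_mult_right_zero)
  \<comment> \<open>The dimension is at least 1, which settles \<open>c = 0\<close> as well.\<close>
  moreover have "of_nat (c + CARD('n)) \<noteq> (0 :: complex)" by (simp only: of_nat_eq_0_iff) simp
  ultimately show ?thesis by (simp only: mult_eq_0_iff) simp
qed


private lemma u_Ck: "Ck_on 1 U u"
  unfolding u_def[abs_def] by (intro Ck_on_sum Ck_on_mult openU q_Ck hol_on_Ck V_comp_hol)

text \<open>Holomorphy of \<open>V\<close> leaves \<open>V v* M\<close> as the antiholomorphic
  derivative of \<open>u\<close>, a combination of the rows of \<open>M\<close>, on which the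
  rank-one determinant collapses.\<close>

private lemma rank_one_det_u:
  assumes z: "z \<noteq> 0"
  shows "rank_one_det (M z) (q z) (dbar u z) = of_nat 1 * (u z * det (M z))"
proof -
  have zU: "z \<in> U" using z by simp
  have dV: "(\<lambda>w. V w $ l) differentiable (at z)" for l by (rule hol_on_differentiable[OF V_comp_hol zU])
  have dq: "(\<lambda>w. q w $ l) differentiable (at z)" for l by (rule Ck_differentiable[OF q_Ck[of "Suc 0"] z])
  have Mk: "wirtinger_bar k (\<lambda>w. q w $ j) z = M z $ j $ k" for j k by (simp add: M_def)
  have "wirtinger_bar k u z = (\<Sum>j\<in>UNIV. wirtinger_bar k (\<lambda>z. V z $ j * q z $ j) z)" for k
    unfolding u_def[abs_def] by (rule wirtinger_sum(2)) (intro differentiable_mult dV dq)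
  then have "dbar u z = V z v* M z"
    by (simp add: vec_eq_iff vector_matrix_mult_def wirtinger_mult(2)[OF dV dq] hol_on_wirtinger(2)[OF V_comp_hol zU] Mk mult.commute)
  then show ?thesis by (simp add: rank_one_det_row_combination u_def mult.commute)
qed

private lemma rank_one_det_f:
  assumes z: "z \<noteq> 0"
  shows "rank_one_det (M z) (q z) (dbar f z) = of_nat 0 * (f z * det (M z))"
proof -
  have "dbar f z = 0" using hol_on_wirtinger(2)[OF f_hol, of z] z by (simp add: vec_eq_iff)
  then show ?thesis by simp
qed

text \<open>The value 0 at the origin makes the density Borel and invariant on the whole space,
  whatever \<open>a\<close> and \<open>V\<close> are there. Weighted with the cutoff, it splits into
  the parts of \<open>u\<close> and \<open>f\<close>, the cases \<open>c = 1\<close> and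
  \<open>c = 0\<close> of \<open>integral_cutoff_eq_0\<close>.\<close>

lemma integral_divergence_det:
  fixes D :: "(complex^'n) set"
  defines "\<Psi> \<equiv> \<lambda>z. if z = 0 then 0 else
    divergence a V z * det (\<chi> j k. wirtinger j (wirtinger_bar k (\<lambda>w. complex_of_real (ln (a w)))) z)"
  assumes D: "D \<in> sets borel" "0 \<notin> D" "inj_on (hopf_proj \<gamma>) D" "hopf_proj \<gamma> ` D = hopf_proj \<gamma> ` (- {0})"
  shows "set_integrable lborel D \<Psi>" and "set_lebesgue_integral lborel D \<Psi> = 0"
proof -
  have Mz: "(\<chi> j k. wirtinger j (wirtinger_bar k (\<lambda>w. complex_of_real (ln (a w)))) z) = M z" if "z \<noteq> 0" for z
    by (simp add: vec_eq_iff M_eq[OF that] L_def[abs_def])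
  have \<Psi>: "\<Psi> z = (u z + f z) * det (M z)" if "z \<noteq> 0" for z
    using that unfolding \<Psi>_def Mz[OF that] divergence_eq by simp
  have \<Psi>0: "\<Psi> 0 = 0" by (simp add: \<Psi>_def)
  have uc: "continuous_on U u" using Ck_on_Suc_imp[of 0 U u] u_Ck by simp
  have fC: "Ck_on 1 U f" by (rule hol_on_Ck[OF openU f_hol])
  have fc: "continuous_on U f" by (rule hol_on_continuous[OF f_hol])
  have "continuous_on U (\<lambda>z. (u z + f z) * det (M z))"
    by (intro continuous_on_mult continuous_on_add uc fc detM_cont)
  then have c: "continuous_on U \<Psi>" by (rule continuous_on_eq) (simp add: \<Psi>)
  have "(\<lambda>z. if z \<in> U then \<Psi> z else 0) \<in> borel_measurable borel"
    using c openU by (intro borel_measurable_continuous_on_if) auto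
  moreover have "(\<lambda>z. if z \<in> U then \<Psi> z else 0) = \<Psi>" by (auto simp: fun_eq_iff \<Psi>0)
  ultimately have meas: "\<Psi> \<in> borel_measurable borel" by simp
  have inv: "\<Psi> z = (cmod (J z))\<^sup>2 *\<^sub>R \<Psi> (\<gamma> z)" for z
  proof (cases "z = 0")
    case True
    then show ?thesis by (simp add: \<gamma>_0 \<Psi>0)
  next
    case False
    then show ?thesis
      using \<Psi>[OF False] \<Psi>[OF \<gamma>_nz[OF False]] u_step[OF False] f_step[OF False] det_M_step[OF False]
      by (simp add: scaleR_conv_of_real mult_ac del: of_real_power)
  qed
  have loc: "set_integrable lborel C \<Psi>" if "compact C" "0 \<notin> C" for C
    unfolding set_integrable_def using that
    by (intro borel_integrable_compact continuous_on_subset[OF c]) auto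
  show "set_integrable lborel D \<Psi>"
    by (rule fundamental_domain_integrable[OF \<gamma> meas inv D loc])
  have \<eta>U: "continuous_on U \<eta>"
    using Ck_on_Suc_imp[of 0 UNIV \<eta>] \<eta>_Ck by (auto intro: continuous_on_subset)
  have split: "(bump (\<gamma> z) - bump z) *\<^sub>R \<Psi> z = \<eta> z * (u z * det (M z)) + \<eta> z * (f z * det (M z))" for z
  proof (cases "z = 0")
    case True
    then have "\<eta> z = 0" by (intro K(3)) (use K(2) in auto)
    then show ?thesis using True by (simp add: \<Psi>0)
  next
    case False
    then show ?thesis by (simp add: \<Psi> \<eta>_def scaleR_conv_of_real algebra_simps)
  qed
  have int: "integrable lborel (\<lambda>z. \<eta> z * (w z * det (M z)))" if "continuous_on U w" for w
  proof (rule integrable_compact_support[OF continuous_on_compact_support[OF openU _ K(1,2)] K(1)])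
    show "continuous_on U (\<lambda>z. \<eta> z * (w z * det (M z)))"
      by (intro continuous_on_mult \<eta>U that detM_cont)
  qed (simp_all add: K(3))
  have bc: "continuous_on UNIV (bump :: complex^'n \<Rightarrow> real)"
    unfolding bump_def[abs_def] by (intro continuous_intros)
  have "set_lebesgue_integral lborel D \<Psi> = integral\<^sup>L lborel (\<lambda>z. (bump (\<gamma> z) - bump z) *\<^sub>R \<Psi> z)"
  proof (rule fundamental_domain_integral[OF \<gamma> meas inv D loc bc bump_bounds])
    show "bump z = 0" if "z \<notin> cball 0 2" for z :: "complex^'n" using that by (simp add: bump_eq_0)
    show "bump z = 1" if "z \<in> ball 0 1" for z :: "complex^'n" using that by (simp add: bump_eq_1)
    show "integrable lborel (\<lambda>z. (bump (\<gamma> z) - bump z) *\<^sub>R \<Psi> z)"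
      unfolding split using int[OF uc] int[OF fc] by simp
  qed auto
  also have "\<dots> = 0"
    unfolding split using int[OF uc] int[OF fc]
      integral_cutoff_eq_0[OF u_Ck u_step rank_one_det_u] integral_cutoff_eq_0[OF fC f_step rank_one_det_f] by simp
  finally show "set_lebesgue_integral lborel D \<Psi> = 0" .
qed

end

section \<open>Descent to the Hopf manifold\<close>

lemma smooth_on_local:
  assumes "\<And>x. x \<in> S \<Longrightarrow> \<exists>T. open T \<and> x \<in> T \<and> smooth_on T f"
  shows "smooth_on S f"
  unfolding smooth_on_def
proof
  fix k show "Ck_on k S f" using assms by (intro Ck_on_local) (meson smooth_on_def)
qed

lemma smooth_on_cong_open:
  assumes "open S" "\<And>x. x \<in> S \<Longrightarrow> f x = g x"
  shows "smooth_on S f \<longleftrightarrow> smooth_on S g"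
  unfolding smooth_on_def using Ck_on_cong[OF assms] by simp

context
  fixes \<gamma> :: "complex^'n \<Rightarrow> complex^'n"
  assumes \<gamma>: "biholomorphic_contraction \<gamma>"
begin

private abbreviation "iter \<equiv> int_iterate \<gamma>"
private abbreviation "proj \<equiv> hopf_proj \<gamma>"

section \<open>Charts of the Hopf manifold and partitions subordinate to them\<close>

private definition "chart W = (proj ` W, inv_into W proj)"

private lemma chart: "evenly_covered \<gamma> W \<Longrightarrow> chart W \<in> hopf_manifold \<gamma>"
  unfolding hopf_chart[OF \<gamma>] chart_def by blast

private lemma hopf_chartE:
  assumes "c \<in> hopf_manifold \<gamma>"
  obtains W where "evenly_covered \<gamma> W" "c = chart W" "fst c = proj ` W" "snd c ` fst c = W"
    "\<And>z. z \<in> W \<Longrightarrow> snd c (proj z) = z"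
proof -
  obtain W where W: "evenly_covered \<gamma> W" "c = chart W"
    using assms unfolding hopf_chart[OF \<gamma>] chart_def by blast
  then have inj: "inj_on proj W" by (simp add: evenly_covered_def)
  show ?thesis
  proof (rule that[OF W])
    show "snd c ` fst c = W" using inj by (simp add: W(2) chart_def inv_into_image_cancel)
    show "snd c (proj z) = z" if "z \<in> W" for z using inj that by (simp add: W(2) chart_def)
  qed (simp add: W(2) chart_def)
qed

private lemma chart_domain: "evenly_covered \<gamma> W \<Longrightarrow> snd (chart W) ` fst (chart W) = W"
  by (simp add: chart_def evenly_covered_def inv_into_image_cancel)

text \<open>The transition map agrees with \<open>iter k\<close> on a whole neighbourhood of
  \<open>z\<close>, hence the derivatives agree as well.\<close>

private lemma transition_chart:
  assumes W: "evenly_covered \<gamma> W" "evenly_covered \<gamma> W'" and z: "z \<in> W" "iter k z \<in> W'"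
  shows "z \<in> overlap (chart W) (chart W')" and "transition (chart W) (chart W') z = iter k z"
    and "complex_jacobian (transition (chart W) (chart W')) z = complex_jacobian (iter k) z"
    and "frechet_derivative (transition (chart W) (chart W')) (at z) = frechet_derivative (iter k) (at z)"
proof -
  have inj: "inj_on proj W" "inj_on proj W'" and nz: "0 \<notin> W" "0 \<notin> W'" and o: "open W" "open W'"
    using W by (auto simp: evenly_covered_def)
  have eq: "transition (chart W) (chart W') x = iter k x" "x \<in> overlap (chart W) (chart W')" if "x \<in> W" "iter k x \<in> W'" for x
  proof -
    have "x \<noteq> 0" "iter k x \<noteq> 0" using that nz by auto
    then have prx: "proj x = proj (iter k x)" using hopf_proj_eq_iff[OF \<gamma>] by blast
    have 1: "inv_into (proj ` W) (inv_into W proj) x = proj x"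
      using inv_into_f_eq[OF inj_on_inv_into[OF order_refl]] that(1) inj(1) by (metis imageI inv_into_f_f)
    show "transition (chart W) (chart W') x = iter k x"
      using that inj by (simp add: transition_def chart_def 1 prx)
    have "proj x \<in> proj ` W \<inter> proj ` W'" using that prx by auto
    then show "x \<in> overlap (chart W) (chart W')"
      unfolding overlap_def chart_def using inj(1) that(1) by (auto intro!: rev_image_eqI[of "proj x"])
  qed
  show "z \<in> overlap (chart W) (chart W')" "transition (chart W) (chart W') z = iter k z" using eq z by auto
  define T where "T = W \<inter> iter k -` W'"
  have T: "open T" "z \<in> T"
    using o z open_vimage[OF o(2) continuous_int_iterate[OF \<gamma>]] by (auto simp: T_def)
  have eqT: "transition (chart W) (chart W') x = iter k x" if "x \<in> T" for x using that eq(1) by (auto simp: T_def)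
  show "frechet_derivative (transition (chart W) (chart W')) (at z) = frechet_derivative (iter k) (at z)"
    by (rule frechet_derivative_cong_open(1)[OF T eqT])
  show "complex_jacobian (transition (chart W) (chart W')) z = complex_jacobian (iter k) z"
    unfolding complex_jacobian_def
    by (auto simp: vec_eq_iff intro!: wirtinger_cong_open(1)[OF T] simp: eqT)
qed

text \<open>\<open>form_integral\<close> is a definite description, so some partition has to be
  exhibited. Finitely many charts cover the image of a compact set of representatives, which is the
  whole manifold.\<close>

lemma hopf_chart_partition_exists: "\<exists>C B. chart_partition (hopf_manifold \<gamma>) C B"
proof -
  obtain K where K: "compact K" "0 \<notin> K" "proj ` K = proj ` (- {0})" by (rule hopf_fundamental_compact[OF \<gamma>])
  have cov: "\<exists>W. evenly_covered \<gamma> W \<and> x \<in> W" if "x \<in> K" for x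
  proof -
    have "x \<noteq> 0" using that K(2) by auto
    then show ?thesis using evenly_covered_nbhd[OF \<gamma>] by metis
  qed
  obtain \<W> where \<W>: "\<W> \<subseteq> {W. evenly_covered \<gamma> W}" "finite \<W>" "K \<subseteq> \<Union>\<W>"
  proof (rule compactE[OF K(1), of "{W. evenly_covered \<gamma> W}"])
    show "K \<subseteq> \<Union>{W. evenly_covered \<gamma> W}" using cov by blast
    show "open W" if "W \<in> {W. evenly_covered \<gamma> W}" for W using that by (simp add: evenly_covered_def)
  qed
  define C where "C = chart ` \<W>"
  have CM: "C \<subseteq> hopf_manifold \<gamma>" using \<W>(1) chart by (auto simp: C_def)
  have fin: "finite C" using \<W>(2) by (simp add: C_def)
  then obtain h :: "_ \<Rightarrow> nat" where h: "inj_on h C" using finite_imp_inj_to_nat_seg by blast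
  \<comment> \<open>The numbering \<open>h\<close> orders the charts; each piece is a chart without
    the charts of smaller number.\<close>
  define B where "B c = fst c - (\<Union>c'\<in>{c'\<in>C. h c' < h c}. fst c')" for c
  have Un: "(\<Union>c\<in>C. B c) = (\<Union>c\<in>C. fst c)"
  proof
    show "(\<Union>c\<in>C. fst c) \<subseteq> (\<Union>c\<in>C. B c)"
    proof
      fix x assume "x \<in> (\<Union>c\<in>C. fst c)"
      then have "\<exists>c. c \<in> C \<and> x \<in> fst c" by blast
      then obtain c where c: "c \<in> C" "x \<in> fst c" "\<And>c'. h c' < h c \<Longrightarrow> \<not> (c' \<in> C \<and> x \<in> fst c')"
        using ex_has_least_nat[of "\<lambda>c. c \<in> C \<and> x \<in> fst c" _ h] by (metis not_le)
      then show "x \<in> (\<Union>c\<in>C. B c)" by (auto simp: B_def)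
    qed
  qed (auto simp: B_def)
  have carrier: "(\<Union>c\<in>C. fst c) = manifold_carrier (hopf_manifold \<gamma>)"
  proof
    show "(\<Union>c\<in>C. fst c) \<subseteq> manifold_carrier (hopf_manifold \<gamma>)" using CM by (auto simp: manifold_carrier_def)
    show "manifold_carrier (hopf_manifold \<gamma>) \<subseteq> (\<Union>c\<in>C. fst c)"
      unfolding hopf_carrier[OF \<gamma>] K(3)[symmetric]
    proof
      fix x assume "x \<in> proj ` K"
      then obtain z W where "x = proj z" "z \<in> W" "W \<in> \<W>" using \<W>(3) by blast
      then have "chart W \<in> C" "x \<in> fst (chart W)" by (auto simp: C_def chart_def)
      then show "x \<in> (\<Union>c\<in>C. fst c)" by blast
    qed
  qed
  have dis: "disjoint_family_on B C"
    unfolding disjoint_family_on_def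
  proof (intro ballI impI)
    fix c c' assume cc: "c \<in> C" "c' \<in> C" "c \<noteq> c'"
    then have "h c < h c' \<or> h c' < h c" using h by (metis inj_onD linorder_neqE_nat)
    then show "B c \<inter> B c' = {}" using cc by (auto simp: B_def)
  qed
  have bor: "snd c ` B c \<in> sets borel" if c: "c \<in> C" for c
  proof -
    obtain W where W: "evenly_covered \<gamma> W" "c = chart W" "fst c = proj ` W" "snd c ` fst c = W"
      "\<And>z. z \<in> W \<Longrightarrow> snd c (proj z) = z"
      by (rule hopf_chartE[OF subsetD[OF CM c]]) blast
    \<comment> \<open>In coordinates a piece is the open set \<open>W\<close> minus finitely many
      open saturated sets, hence Borel.\<close>
    have "snd c ` B c = W - (\<Union>c'\<in>{c'\<in>C. h c' < h c}. {z. z \<noteq> 0 \<and> proj z \<in> fst c'})"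
    proof -
      have "0 \<notin> W" using W(1) by (simp add: evenly_covered_def)
      then have nz: "z \<noteq> 0" if "z \<in> W" for z using that by auto
      have "B c = proj ` (W - (\<Union>c'\<in>{c'\<in>C. h c' < h c}. {z. z \<noteq> 0 \<and> proj z \<in> fst c'}))"
        using nz by (auto simp: B_def W(3))
      then show ?thesis by (auto simp: image_image W(5))
    qed
    moreover have "open {z. z \<noteq> 0 \<and> proj z \<in> fst c'}" if c': "c' \<in> C" for c'
    proof -
      obtain W' where W': "evenly_covered \<gamma> W'" "fst c' = proj ` W'"
        by (rule hopf_chartE[OF subsetD[OF CM c']]) blast
      have "open (iter k ` W')" for k
        using W'(1) by (intro hopf_iterate_open[OF \<gamma>]) (simp add: evenly_covered_def)
      then show ?thesis
        unfolding W'(2) using W'(1) by (subst hopf_saturation[OF \<gamma>]) (auto simp: evenly_covered_def)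
    qed
    then have "open (\<Union>c'\<in>{c'\<in>C. h c' < h c}. {z. z \<noteq> 0 \<and> proj z \<in> fst c'})" by (intro open_UN ballI) blast
    moreover have "open W" using W(1) by (simp add: evenly_covered_def)
    ultimately show ?thesis by (simp add: borel_open sets.Diff)
  qed
  have "chart_partition (hopf_manifold \<gamma>) C B"
    unfolding chart_partition_def using fin CM bor dis Un carrier by (auto simp: B_def)
  then show ?thesis by blast
qed

text \<open>The coordinate images of the pieces together represent every orbit exactly once,
  whichever translates the charts happen to use. This turns the sum over the pieces into one
  integral on the covering space.\<close>

lemma chart_partition_fundamental_domain:
  assumes "chart_partition (hopf_manifold \<gamma>) C B"
  defines "D \<equiv> \<Union>c\<in>C. snd c ` B c"
  shows "D \<in> sets borel" "0 \<notin> D" "inj_on proj D" "proj ` D = proj ` (- {0})"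
    "disjoint_family_on (\<lambda>c. snd c ` B c) C"
proof -
  have P: "finite C" "C \<subseteq> hopf_manifold \<gamma>" "\<And>c. c \<in> C \<Longrightarrow> B c \<subseteq> fst c"
    "\<And>c. c \<in> C \<Longrightarrow> snd c ` B c \<in> sets borel" "disjoint_family_on B C"
    "(\<Union>c\<in>C. B c) = proj ` (- {0})"
    using assms(1) hopf_carrier[OF \<gamma>] by (auto simp: chart_partition_def)
  have pc: "proj z \<in> B c" "z \<noteq> 0" "snd c (proj z) = z" if cz: "c \<in> C" "z \<in> snd c ` B c" for c z
  proof -
    obtain W where W: "evenly_covered \<gamma> W" "fst c = proj ` W" "\<And>z. z \<in> W \<Longrightarrow> snd c (proj z) = z"
      by (rule hopf_chartE[OF subsetD[OF P(2) cz(1)]]) blast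
    obtain x where x: "x \<in> B c" "z = snd c x" using cz(2) by blast
    then obtain y where y: "y \<in> W" "x = proj y" using P(3)[OF cz(1)] W(2) by blast
    then have "z = y" using x W(3) by simp
    then show "proj z \<in> B c" "z \<noteq> 0" "snd c (proj z) = z" using x y W by (auto simp: evenly_covered_def)
  qed
  show "D \<in> sets borel" unfolding D_def using P(1,4) by auto
  show "0 \<notin> D" unfolding D_def using pc(2) by blast
  have same: "c = c'" if "c \<in> C" "c' \<in> C" "z \<in> snd c ` B c" "z' \<in> snd c' ` B c'" "proj z = proj z'" for c c' z z'
  proof -
    have "proj z \<in> B c \<inter> B c'" using pc(1)[OF that(1,3)] pc(1)[OF that(2,4)] that(5) by simp
    then show ?thesis using P(5) that(1,2) unfolding disjoint_family_on_def by blast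
  qed
  show "inj_on proj D"
  proof (rule inj_onI)
    fix z z' assume z: "z \<in> D" "z' \<in> D" "proj z = proj z'"
    then obtain c c' where c: "c \<in> C" "c' \<in> C" "z \<in> snd c ` B c" "z' \<in> snd c' ` B c'" unfolding D_def by blast
    then have "c = c'" using same z(3) by blast
    then show "z = z'" by (metis pc(3)[OF c(1,3)] pc(3)[OF c(2,4)] z(3))
  qed
  show "disjoint_family_on (\<lambda>c. snd c ` B c) C"
    unfolding disjoint_family_on_def using same by blast
  show "proj ` D = proj ` (- {0})"
  proof -
    have "proj ` (snd c ` B c) = B c" if c: "c \<in> C" for c
    proof -
      obtain W where W: "fst c = proj ` W" "\<And>z. z \<in> W \<Longrightarrow> snd c (proj z) = z"
        by (rule hopf_chartE[OF subsetD[OF P(2) c]]) blast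
      have "proj (snd c x) = x" if x: "x \<in> B c" for x
      proof -
        obtain y where "y \<in> W" "x = proj y" using x P(3)[OF c] W(1) by blast
        then show ?thesis using W(2) by simp
      qed
      then show ?thesis by (simp add: image_image)
    qed
    then show ?thesis unfolding D_def P(6)[symmetric] image_UN by simp
  qed
qed

text \<open>The description in \<open>form_integral\<close> is evaluated by showing that every
  partition gives the sum 0 and that a partition exists. For each partition the sum is a constant
  times the integral of \<open>\<Psi>\<close> over the fundamental domain made of its
  pieces.\<close>

lemma futaki_invariant_hopf_eq_0:
  assumes \<Omega>: "volume_form (hopf_manifold \<gamma>) \<Omega>" and V: "holomorphic_vector_field (hopf_manifold \<gamma>) V"
  shows "futaki_invariant (hopf_manifold \<gamma>) \<Omega> V = 0"
proof -
  let ?M = "hopf_manifold \<gamma>"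
  have "\<exists>W. evenly_covered \<gamma> W \<and> z \<in> W" if "z \<noteq> 0" for z
    using evenly_covered_nbhd[OF \<gamma> that] by metis
  \<comment> \<open>Selects a chart at every point, through which the tensors are lifted to
    \<open>a\<close> and \<open>v\<close>.\<close>
  then obtain Wc where Wc: "\<And>z. z \<noteq> 0 \<Longrightarrow> evenly_covered \<gamma> (Wc z)" "\<And>z. z \<noteq> 0 \<Longrightarrow> z \<in> Wc z" by metis
  define a where "a z = \<Omega> (chart (Wc z)) z" for z
  define v where "v z = V (chart (Wc z)) z" for z
  have nzW: "z \<noteq> 0" if "evenly_covered \<gamma> W" "z \<in> W" for z W using that by (auto simp: evenly_covered_def)
  have trans\<Omega>: "\<Omega> (chart W) z = \<Omega> (chart W') (iter k z) * (cmod (det (complex_jacobian (iter k) z)))\<^sup>2"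
    if "evenly_covered \<gamma> W" "evenly_covered \<gamma> W'" "z \<in> W" "iter k z \<in> W'" for W W' z k
    using \<Omega> chart[OF that(1)] chart[OF that(2)] transition_chart[OF that] unfolding volume_form_def by metis
  have transV: "V (chart W') (iter k z) = frechet_derivative (iter k) (at z) (V (chart W) z)"
    if "evenly_covered \<gamma> W" "evenly_covered \<gamma> W'" "z \<in> W" "iter k z \<in> W'" for W W' z k
    using V chart[OF that(1)] chart[OF that(2)] transition_chart[OF that] unfolding holomorphic_vector_field_def by metis
  have "complex_jacobian id z = (mat 1 :: complex^'n^'n)" for z using complex_jacobian_id by (simp add: id_def)
  then have pw0: "complex_jacobian id z = (mat 1 :: complex^'n^'n)" for z .
  have fid: "frechet_derivative id (at z) = id" for z :: "complex^'n"
    by (rule frechet_derivative_at[symmetric]) (simp add: id_def)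
  \<comment> \<open>The exponent \<open>k = 0\<close> compares two charts at the same point, so the
    lift does not depend on the selection; below, \<open>k = 1\<close> gives the behaviour under
    \<open>\<gamma>\<close>.\<close>
  have aW: "\<Omega> (chart W) z = a z" if "evenly_covered \<gamma> W" "z \<in> W" for W z
    using trans\<Omega>[of W "Wc z" z 0] Wc[OF nzW[OF that]] that
    by (simp add: pw0 a_def)
  have vW: "V (chart W) z = v z" if "evenly_covered \<gamma> W" "z \<in> W" for W z
    using transV[of W "Wc z" z 0] Wc[OF nzW[OF that]] that
    by (simp add: fid v_def)
  have a_inv: "a z = a (\<gamma> z) * (cmod (det (complex_jacobian \<gamma> z)))\<^sup>2" if "z \<noteq> 0" for z
  proof -
    have "\<gamma> z \<noteq> 0" using hopf_iterate_eq_0[OF \<gamma>, of 1 z] that by simp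
    then show ?thesis using trans\<Omega>[of "Wc z" "Wc (\<gamma> z)" z 1] Wc that by (simp add: a_def)
  qed
  have v_inv: "v (\<gamma> z) = complex_jacobian \<gamma> z *v v z" if "z \<noteq> 0" for z
  proof -
    have "\<gamma> z \<noteq> 0" using hopf_iterate_eq_0[OF \<gamma>, of 1 z] that by simp
    then show ?thesis using transV[of "Wc z" "Wc (\<gamma> z)" z 1] Wc that
      by (simp add: v_def complex_jacobian_holomorphic[OF contraction_hol(1)[OF \<gamma>]])
  qed
  have opW: "open W" if "evenly_covered \<gamma> W" for W using that by (simp add: evenly_covered_def)
  have a_pos: "0 < a z" if "z \<noteq> 0" for z
    using \<Omega> chart[OF Wc(1)[OF that]] Wc(2)[OF that] chart_domain[OF Wc(1)[OF that]]
    unfolding volume_form_def a_def by metis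
  have a_smooth: "smooth_on (- {0}) a"
  proof (rule smooth_on_local)
    fix x :: "complex^'n" assume "x \<in> - {0}"
    then have x: "evenly_covered \<gamma> (Wc x)" "x \<in> Wc x" using Wc by auto
    have "smooth_on (Wc x) (\<Omega> (chart (Wc x)))"
      using \<Omega> chart[OF x(1)] chart_domain[OF x(1)] unfolding volume_form_def by metis
    then have "smooth_on (Wc x) a"
      using smooth_on_cong_open[OF opW[OF x(1)], of "\<Omega> (chart (Wc x))" a] aW[OF x(1)] by simp
    then show "\<exists>T. open T \<and> x \<in> T \<and> smooth_on T a" using x opW by blast
  qed
  have v_hol: "holomorphic_map_on v (- {0})"
    unfolding holomorphic_map_on_def
  proof
    fix z :: "complex^'n" assume "z \<in> - {0}"
    then have z: "evenly_covered \<gamma> (Wc z)" "z \<in> Wc z" using Wc by auto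
    have "holomorphic_map_on (V (chart (Wc z))) (Wc z)"
      using V chart[OF z(1)] chart_domain[OF z(1)] unfolding holomorphic_vector_field_def by metis
    then obtain D where D: "(V (chart (Wc z)) has_derivative D) (at z)" "\<forall>c v. D (c *s v) = c *s D v"
      using z(2) unfolding holomorphic_map_on_def by blast
    have "(v has_derivative D) (at z)"
      by (rule has_derivative_transform_within_open[OF D(1) opW[OF z(1)] z(2)]) (rule vW[OF z(1)])
    then show "\<exists>D. (v has_derivative D) (at z) \<and> (\<forall>c v. D (c *s v) = c *s D v)" using D(2) by blast
  qed
  obtain p where p: "\<And>j. hol_on (p j) UNIV"
    "\<And>j z. p j z = wirtinger j (\<lambda>z. det (complex_jacobian \<gamma> z)) z / det (complex_jacobian \<gamma> z)
      + (\<Sum>l\<in>UNIV. p l (\<gamma> z) * complex_jacobian \<gamma> z $ l $ j)"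
    by (rule jacobian_cocycle_solution[OF \<gamma>]) blast
  obtain \<beta> where \<beta>: "\<And>H :: complex^'n^'n. wedge_power CARD('n) (\<lambda>u v. - \<i> * (\<Sum>j\<in>UNIV. \<Sum>k\<in>UNIV.
    H $ j $ k * (u $ j * cnj (v $ k) - v $ j * cnj (u $ k)))) complex_frame = \<beta> * det H"
    by (rule wedge_power_eq_det) blast
  define \<Psi> where "\<Psi> z = (if z = 0 then 0 else
    divergence a v z * det (\<chi> j k. wirtinger j (wirtinger_bar k (\<lambda>w. complex_of_real (ln (a w)))) z))" for z
  define \<omega> where "\<omega> c z = divergence (\<Omega> c) (V c) z * wedge_power CARD('n) (ricci_form (\<Omega> c) z) complex_frame" for c z
  have \<omega>: "\<omega> (chart W) z = \<beta> * \<Psi> z" if W: "evenly_covered \<gamma> W" "z \<in> W" for W z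
  proof -
    note o = opW[OF W(1)]
    have l: "complex_of_real (ln (\<Omega> (chart W) w)) = complex_of_real (ln (a w))" if "w \<in> W" for w
      using aW[OF W(1) that] by simp
    \<comment> \<open>The outer operator needs agreement of the inner derivatives on all of the open
      set \<open>W\<close>, not only at \<open>z\<close>.\<close>
    have "wirtinger j (wirtinger_bar k (\<lambda>w. complex_of_real (ln (\<Omega> (chart W) w)))) z =
      wirtinger j (wirtinger_bar k (\<lambda>w. complex_of_real (ln (a w)))) z" for j k
      by (rule wirtinger_cong_open(1)[OF o W(2)]) (rule wirtinger_cong_open(2)[OF o _ l])
    then have "ricci_form (\<Omega> (chart W)) z = ricci_form a z" by (simp add: ricci_form_def fun_eq_iff)
    moreover have "divergence (\<Omega> (chart W)) (V (chart W)) z = divergence a v z"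
      unfolding divergence_def
      by (intro arg_cong2[of _ _ _ _ "(+)"] sum.cong refl arg_cong2[of _ _ _ _ "(*)"] wirtinger_cong_open(1)[OF o W(2)] l)
         (simp_all add: vW[OF W(1)] W(2))
    moreover have "wedge_power CARD('n) (ricci_form a z) complex_frame =
        \<beta> * det (\<chi> j k. wirtinger j (wirtinger_bar k (\<lambda>w. complex_of_real (ln (a w)))) z)"
      unfolding \<beta>[symmetric] by (simp add: ricci_form_def[abs_def])
    ultimately show ?thesis using nzW[OF W] by (simp add: \<omega>_def \<Psi>_def)
  qed
  have zero: "(\<Sum>c\<in>C. LINT z : snd c ` B c | lborel. \<omega> c z) = 0" if P: "chart_partition ?M C B" for C B
  proof -
    note D = chart_partition_fundamental_domain[OF P]
    have CM: "finite C" "C \<subseteq> ?M" "\<And>c. c \<in> C \<Longrightarrow> B c \<subseteq> fst c" "\<And>c. c \<in> C \<Longrightarrow> snd c ` B c \<in> sets borel"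
      using P by (auto simp: chart_partition_def)
    note int = integral_divergence_det[OF \<gamma> a_smooth a_pos a_inv v_hol v_inv p D(1-4), folded \<Psi>_def]
    have "(LINT z : snd c ` B c | lborel. \<omega> c z) = \<beta> * (LINT z : snd c ` B c | lborel. \<Psi> z)" if c: "c \<in> C" for c
    proof -
      obtain W where W: "evenly_covered \<gamma> W" "c = chart W" "snd c ` fst c = W"
        by (rule hopf_chartE[OF subsetD[OF CM(2) c]]) blast
      have sub: "snd c ` B c \<subseteq> W" using W(3) CM(3)[OF c] by blast
      have "(LINT z : snd c ` B c | lborel. \<omega> c z) = (LINT z : snd c ` B c | lborel. \<beta> * \<Psi> z)"
        using CM(4)[OF c] sub \<omega>[OF W(1)] by (intro set_lebesgue_integral_cong) (auto simp: W(2))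
      then show ?thesis by simp
    qed
    then have "(\<Sum>c\<in>C. LINT z : snd c ` B c | lborel. \<omega> c z) = \<beta> * (\<Sum>c\<in>C. LINT z : snd c ` B c | lborel. \<Psi> z)"
      by (simp add: sum_distrib_left)
    also have "(\<Sum>c\<in>C. LINT z : snd c ` B c | lborel. \<Psi> z) = (LINT z : (\<Union>c\<in>C. snd c ` B c) | lborel. \<Psi> z)"
    proof (rule set_integral_finite_Union[symmetric])
      show "set_integrable lborel (snd c ` B c) \<Psi>" if "c \<in> C" for c
        using set_integrable_subset[OF int(1)] CM(4)[OF that] that by auto
    qed (use CM D(5) in auto)
    also have "\<dots> = 0" by (rule int(2))
    finally show ?thesis by simp
  qed
  show ?thesis
    unfolding futaki_invariant_def form_integral_def \<omega>_def[symmetric]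
  proof (rule the_equality)
    show "\<exists>C B. chart_partition ?M C B \<and> 0 = (\<Sum>c\<in>C. LINT z : snd c ` B c | lborel. \<omega> c z)"
    proof -
      obtain C B where P: "chart_partition ?M C B" using hopf_chart_partition_exists by blast
      show ?thesis by (intro exI conjI) (rule P, rule zero[OF P, symmetric])
    qed
    show "I = 0" if I0: "\<exists>C B. chart_partition ?M C B \<and> I = (\<Sum>c\<in>C. LINT z : snd c ` B c | lborel. \<omega> c z)" for I
    proof -
      obtain C B where P: "chart_partition ?M C B" and I: "I = (\<Sum>c\<in>C. LINT z : snd c ` B c | lborel. \<omega> c z)"
        using I0 by blast
      show ?thesis unfolding I by (rule zero[OF P])
    qed
  qed
qed

end

theorem theorem3p1:
  fixes \<gamma> :: "complex^'n \<Rightarrow> complex^'n"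
    and \<Omega> :: "((complex^'n) set, 'n) chart \<Rightarrow> complex^'n \<Rightarrow> real"
    and V :: "((complex^'n) set, 'n) chart \<Rightarrow> complex^'n \<Rightarrow> complex^'n"
  assumes "biholomorphic_contraction \<gamma>"
    and "volume_form (hopf_manifold \<gamma>) \<Omega>"
    and "holomorphic_vector_field (hopf_manifold \<gamma>) V"
  shows "futaki_invariant (hopf_manifold \<gamma>) \<Omega> V = 0"
  using assms by (rule futaki_invariant_hopf_eq_0)

end
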